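(* For every $\epsilon>0$, every connected planar graph admits a planar straight-line drawing with spanning ratio smaller than $1+\epsilon$.
   Context: A drawing of a graph maps each vertex to a distinct point of the plane and each edge to a Jordan arc between its end-vertices; it is straight-line if every edge is drawn as a straight-line segment, and planar if no two edges intersect except at common end-vertices. In a straight-line drawing $\Gamma$, the length of a path is the sum of the Euclidean lengths of its edges, $\pi_\Gamma(u,v)$ is the minimum length of a path between $u$ and $v$, and $\|uv\|_\Gamma$ is the Euclidean distance between $u$ and $v$. The spanning ratio of $\Gamma$ is $\max_{u\neq v}\pi_\Gamma(u,v)/\|uv\|_\Gamma$. *)

theory Defs
  imports "HOL-Analysis.Analysis"
begin

definition simple_graph :: "'a set \<Rightarrow> 'a set set \<Rightarrow> bool" where
  "simple_graph V E \<longleftrightarrow> finite V \<and>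
     (\<forall>e\<in>E. \<exists>u v. u \<in> V \<and> v \<in> V \<and> u \<noteq> v \<and> e = {u, v})"

definition walk :: "'a set \<Rightarrow> 'a set set \<Rightarrow> 'a list \<Rightarrow> bool" where
  "walk V E xs \<longleftrightarrow> xs \<noteq> [] \<and> set xs \<subseteq> V \<and>
     (\<forall>i. Suc i < length xs \<longrightarrow> {xs ! i, xs ! Suc i} \<in> E)"

definition gpath :: "'a set \<Rightarrow> 'a set set \<Rightarrow> 'a list \<Rightarrow> bool" where
  "gpath V E xs \<longleftrightarrow> walk V E xs \<and> distinct xs"

definition connected_graph :: "'a set \<Rightarrow> 'a set set \<Rightarrow> bool" where
  "connected_graph V E \<longleftrightarrow>
     (\<forall>u\<in>V. \<forall>v\<in>V. \<exists>xs. walk V E xs \<and> hd xs = u \<and> last xs = v)"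

definition drawing :: "'a set \<Rightarrow> 'a set set \<Rightarrow> ('a \<Rightarrow> complex) \<Rightarrow> ('a set \<Rightarrow> real \<Rightarrow> complex) \<Rightarrow> bool" where
  "drawing V E p \<gamma> \<longleftrightarrow> inj_on p V \<and>
     (\<forall>e\<in>E. arc (\<gamma> e) \<and>
        (\<exists>u v. e = {u, v} \<and> pathstart (\<gamma> e) = p u \<and> pathfinish (\<gamma> e) = p v))"

definition planar_drawing :: "'a set \<Rightarrow> 'a set set \<Rightarrow> ('a \<Rightarrow> complex) \<Rightarrow> ('a set \<Rightarrow> real \<Rightarrow> complex) \<Rightarrow> bool" where
  "planar_drawing V E p \<gamma> \<longleftrightarrow> drawing V E p \<gamma> \<and>
     (\<forall>e\<in>E. \<forall>e'\<in>E. e \<noteq> e' \<longrightarrow> path_image (\<gamma> e) \<inter> path_image (\<gamma> e') \<subseteq> p ` (e \<inter> e'))"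

definition straight_line_drawing :: "'a set \<Rightarrow> 'a set set \<Rightarrow> ('a \<Rightarrow> complex) \<Rightarrow> ('a set \<Rightarrow> real \<Rightarrow> complex) \<Rightarrow> bool" where
  "straight_line_drawing V E p \<gamma> \<longleftrightarrow> drawing V E p \<gamma> \<and>
     (\<forall>e\<in>E. \<exists>u v. e = {u, v} \<and> path_image (\<gamma> e) = closed_segment (p u) (p v))"

definition planar_graph :: "'a set \<Rightarrow> 'a set set \<Rightarrow> bool" where
  "planar_graph V E \<longleftrightarrow> (\<exists>p \<gamma>. planar_drawing V E p \<gamma>)"

definition path_length :: "('a \<Rightarrow> complex) \<Rightarrow> 'a list \<Rightarrow> real" where
  "path_length p xs = (\<Sum>i<length xs - 1. dist (p (xs ! i)) (p (xs ! Suc i)))"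

definition graph_dist :: "'a set \<Rightarrow> 'a set set \<Rightarrow> ('a \<Rightarrow> complex) \<Rightarrow> 'a \<Rightarrow> 'a \<Rightarrow> real" where
  "graph_dist V E p u v =
     Inf {path_length p xs | xs. gpath V E xs \<and> hd xs = u \<and> last xs = v}"

definition spanning_ratio :: "'a set \<Rightarrow> 'a set set \<Rightarrow> ('a \<Rightarrow> complex) \<Rightarrow> real" where
  "spanning_ratio V E p =
     Max {graph_dist V E p u v / dist (p u) (p v) | u v. u \<in> V \<and> v \<in> V \<and> u \<noteq> v}"

end

(* Draw the vertices one at a time, each new one extremely far above everything drawn so far. If the
   i-th vertex v has an earlier neighbour w, then seen from v the earlier drawing is almost a point, so the
   detour through w is negligible and the spanning ratio stays below 1 + \<epsilon>. The drawing stays planar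
   provided the earlier neighbours of v can be seen from infinitely high up and lie consecutively on a
   contour of visible vertices; everything strictly between the extreme neighbours is then hidden by v.

   So everything reduces to a combinatorial order of the vertices, a "stacking". It is built by induction
   on the graph. Cut vertices and separation pairs {x, y} are removed by stacking one side and inserting
   a stacking of the other side next to x at the moment when y is about to be placed; here the virtual
   edge {x, y} is planar because it can be drawn along a path through the other side. If no pair of vertices
   separates, delete the vertex v to be stacked last: the face of the rest that contains v is bounded by a
   cycle J through all neighbours of v, and an inversion at v brings all other vertices inside J. A closed
   disc is then filled from a bottom path, already placed, to the complementary top path by cutting it
   along a path through its interior. The main topological input for this is the theta curve
   theorem: an arc across the inside of a Jordan curve splits it into the insides of two smaller ones. *)
theory Submission
  imports Defs
begin

section \<open>Stackings\<close>

text \<open>The geometry is purely asymptotic: once the abscissa of a new vertex is chosen, every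
  further requirement holds for all large heights, and old pairs keep the paths they have. The hard
  part is to find an order in which the placed neighbours of each new vertex are still visible and
  lie within one replaceable stretch. Cutting a disc by a chord threatens this: the disc filled
  first may place both ends of an edge that belongs to the other disc, and the first filling knows
  nothing of that edge. All cuts are therefore extremal: the chord taken leaves the fewest edges
  inside the disc filled second, since an offending edge would be a shortcut of the chord. Two
  strengthenings carry the induction over separation pairs: the last vertex \<open>v\<close> is left
  out while all its neighbours are required on the final contour, and the first vertex
  \<open>c\<close> stays at the left end. With the pair joined by a virtual edge, one side can then
  be stacked from \<open>x\<close> up to, but without, \<open>y\<close>, and this block fits next to
  a visible \<open>x\<close> just before \<open>y\<close> arrives.\<close>

definition nbrs :: "'a set set \<Rightarrow> 'a set \<Rightarrow> 'a \<Rightarrow> 'a set" where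
  "nbrs E S v = {w \<in> S. {v, w} \<in> E}"

text \<open>
  \<open>stacks E S C S' C'\<close> leads from placed vertices \<open>S\<close> with contour \<open>C\<close> (the vertices visible from above,
  from left to right) to \<open>S'\<close> with contour \<open>C'\<close>. A new vertex hides the stretch \<open>B\<close> and may in addition be
  adjacent to the two contour vertices next to it. It need not be adjacent to them, and any contour
  vertex may be forgotten.
\<close>

inductive stacks :: "'a set set \<Rightarrow> 'a set \<Rightarrow> 'a list \<Rightarrow> 'a set \<Rightarrow> 'a list \<Rightarrow> bool"
  for E S C where
  stacks_refl: "stacks E S C S C"
| stacks_drop: "stacks E S C S' (A @ B @ D) \<Longrightarrow> stacks E S C S' (A @ D)"
| stacks_add: "\<lbrakk>stacks E S C S' (A @ B @ D); v \<notin> S'; nbrs E S' v \<noteq> {};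
     nbrs E S' v \<subseteq> set (take 1 (rev A)) \<union> set B \<union> set (take 1 D)\<rbrakk>
   \<Longrightarrow> stacks E S C (insert v S') (A @ v # D)"

lemma stacks_trans:
  assumes "stacks E S1 C1 S2 C2" "stacks E S C S1 C1"
  shows "stacks E S C S2 C2"
  using assms
proof induction
  case (stacks_drop S' A B D)
  then show ?case by (blast intro: stacks.stacks_drop)
next
  case (stacks_add S' A B D v)
  then show ?case by (intro stacks.stacks_add[where B = B]) auto
qed

lemma stacks_subset: "stacks E S C S' C' \<Longrightarrow> S \<subseteq> S'"
  by (induction rule: stacks.induct) auto

lemma stacks_rev:
  assumes "stacks E S C S' C'"
  shows "stacks E S (rev C) S' (rev C')"
  using assms
proof induction
  case stacks_refl
  show ?case by (rule stacks.intros)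
next
  case (stacks_drop S' A B D)
  then show ?case
    using stacks.stacks_drop[of E S "rev C" S' "rev D" "rev B" "rev A"] by simp
next
  case (stacks_add S' A B D v)
  have "stacks E S (rev C) (insert v S') (rev D @ v # rev A)"
    by (rule stacks.stacks_add[where B = "rev B"]) (use stacks_add in auto)
  then show ?case by simp
qed

text \<open>A step only touches the replaced stretch and the two contour vertices next to it, so a
  stacking may run inside a longer contour and beside further placed vertices \<open>U\<close>. The
  edge sets have to agree only on pairs containing a new vertex; this leaves room for virtual
  edges.\<close>

lemma stacks_frame:
  assumes "stacks E1 S C S' C'" "U \<inter> S' = {}"
    and "\<And>x w. x \<in> S' - S \<Longrightarrow> w \<in> S' \<union> U \<Longrightarrow> {x, w} \<in> E \<longleftrightarrow> {x, w} \<in> E1 \<and> w \<in> S'"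
  shows "stacks E (S \<union> U) (A @ C @ D) (S' \<union> U) (A @ C' @ D)"
  using assms
proof induction
  case stacks_refl
  show ?case by (rule stacks.intros)
next
  case (stacks_drop S' A0 B0 D0)
  then show ?case
    using stacks.stacks_drop[of E "S \<union> U" "A @ C @ D" "S' \<union> U" "A @ A0" B0 "D0 @ D"] by simp
next
  case (stacks_add S' A0 B0 D0 v)
  have *: "nbrs E (S' \<union> U) v = nbrs E1 S' v"
  proof -
    have "v \<in> insert v S' - S" using stacks_add stacks_subset by blast
    from stacks_add.prems(2)[OF this] show ?thesis
      using stacks_add.prems(1) unfolding nbrs_def by blast
  qed
  have "stacks E (S \<union> U) (A @ C @ D) (S' \<union> U) (A @ (A0 @ B0 @ D0) @ D)"
    by (rule stacks_add.IH) (use stacks_add in auto)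
  then have "stacks E (S \<union> U) (A @ C @ D) (S' \<union> U) ((A @ A0) @ B0 @ (D0 @ D))" by simp
  then have "stacks E (S \<union> U) (A @ C @ D) (insert v (S' \<union> U)) ((A @ A0) @ v # (D0 @ D))"
  proof (rule stacks.stacks_add)
    show "v \<notin> S' \<union> U" using stacks_add by auto
    show "nbrs E (S' \<union> U) v \<noteq> {}" using stacks_add * by simp
    \<comment> \<open>If \<open>A0\<close> is empty, the longer contour offers one more admissible
      neighbour, so the bound can only grow.\<close>
    have "set (take 1 (rev A0)) \<subseteq> set (take 1 (rev (A @ A0)))"
      by (cases "rev A0") auto
    moreover have "set (take 1 D0) \<subseteq> set (take 1 (D0 @ D))" by (cases D0) auto
    ultimately show "nbrs E (S' \<union> U) v \<subseteq> set (take 1 (rev (A @ A0))) \<union> set B0 \<union> set (take 1 (D0 @ D))"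
      using stacks_add * by auto
  qed
  then show ?case by simp
qed

text \<open>
  Vertices count as degenerate segments, so that disjointness of cells also says that the
  drawing is injective and that no vertex lies on a non-incident edge.
\<close>

definition cells :: "'a set set \<Rightarrow> 'a set \<Rightarrow> 'a set set" where
  "cells E S = {e \<in> E. e \<subseteq> S} \<union> (\<lambda>u. {u}) ` S"

definition disjoint_cells :: "'a set set \<Rightarrow> 'a set \<Rightarrow> ('a \<Rightarrow> complex) \<Rightarrow> bool" where
  "disjoint_cells E S p \<longleftrightarrow> (\<forall>k\<in>cells E S. \<forall>l\<in>cells E S. k \<noteq> l \<longrightarrow>
     convex hull (p ` k) \<inter> convex hull (p ` l) \<subseteq> p ` (k \<inter> l))"

text \<open>The ratio clause asks for one short path per pair instead of bounding
  \<open>graph_dist\<close>: such a path survives every later addition, so only pairs with the new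
  vertex have to be estimated. It also yields connectivity. Visible vertices may be missing from
  \<open>C\<close>.\<close>

definition good_drawing :: "real \<Rightarrow> 'a set set \<Rightarrow> 'a set \<Rightarrow> 'a list \<Rightarrow> ('a \<Rightarrow> complex) \<Rightarrow> bool" where
  "good_drawing \<epsilon> E S C p \<longleftrightarrow> disjoint_cells E S p \<and>
     set C \<subseteq> S \<and> sorted_wrt (<) (map (\<lambda>c. Re (p c)) C) \<and>
     (\<forall>c\<in>set C. \<forall>k\<in>cells E S. \<forall>z\<in>convex hull (p ` k). Re z = Re (p c) \<longrightarrow> Im z \<le> Im (p c)) \<and>
     (\<forall>u\<in>S. \<forall>w\<in>S. u \<noteq> w \<longrightarrow> (\<exists>L. gpath S E L \<and> hd L = u \<and> last L = w \<and>
         path_length p L < (1 + \<epsilon>) * dist (p u) (p w)))"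

text \<open>There is a slope \<open>M\<close> such that, above the height of \<open>w\<close>, the
  set \<open>K\<close> stays below the lines of slope \<open>M\<close> and \<open>-M\<close> through
  \<open>w\<close>; a steeper segment from \<open>w\<close> stays above them.\<close>

lemma steep_segment_avoids:
  assumes K: "compact K" and vis: "\<And>z. z \<in> K \<Longrightarrow> Re z = Re w \<Longrightarrow> Im z \<le> Im w"
    and wK: "w \<in> K \<Longrightarrow> \<exists>b. K = closed_segment w b" and x: "x \<noteq> Re w"
  shows "\<forall>\<^sub>F Y in at_top. closed_segment w (Complex x Y) \<inter> K \<subseteq> {w}"
proof -
  \<comment> \<open>If \<open>w\<close> lies on \<open>K\<close>, then \<open>K\<close> is a segment
    from \<open>w\<close> and its own slope serves as \<open>M\<close>; if it is vertical,
    visibility leaves no points above \<open>w\<close>.\<close>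
  obtain M where M: "\<And>z. z \<in> K \<Longrightarrow> z \<noteq> w \<Longrightarrow> Im z > Im w \<Longrightarrow> Im z - Im w \<le> M * \<bar>Re z - Re w\<bar>"
  proof (cases "w \<in> K")
    case True
    then obtain b where b: "K = closed_segment w b" using wK by blast
    show ?thesis
    proof (rule that[of "\<bar>Im b - Im w\<bar> / \<bar>Re b - Re w\<bar>"])
      fix z assume z: "z \<in> K" "Im z > Im w"
      then obtain t where t: "z = w + of_real t * (b - w)" "0 \<le> t"
        unfolding b closed_segment_def by (auto simp: algebra_simps scaleR_conv_of_real)
      show "Im z - Im w \<le> \<bar>Im b - Im w\<bar> / \<bar>Re b - Re w\<bar> * \<bar>Re z - Re w\<bar>"
      proof (cases "Re b = Re w")
        case True
        then show ?thesis using vis[OF z(1)] z t by auto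
      next
        case False
        have "t * (Im b - Im w) \<le> t * \<bar>Im b - Im w\<bar>" using t(2) by (intro mult_left_mono) auto
          then show ?thesis using t(2) False by (simp add: t(1) abs_mult mult.commute)
      qed
    qed
  next
    case False
    \<comment> \<open>Only the part of \<open>K\<close> at or above the height of \<open>w\<close>
      matters. Visibility keeps it off the vertical line of \<open>w\<close>, so by compactness its
      horizontal distance from \<open>w\<close> has a positive minimum and its height a maximum;
      \<open>M\<close> is their quotient.\<close>
    define K0 where "K0 = K \<inter> {z. Im w \<le> Im z}"
    have cK0: "compact K0"
      unfolding K0_def by (intro compact_Int_closed K closed_Collect_le continuous_intros)
    show ?thesis
    proof (cases "K0 = {}")
      case True
      then show ?thesis by (intro that[of 0]) (auto simp: K0_def)
    next
      case ne: False
      obtain z1 where z1: "z1 \<in> K0" "\<And>z. z \<in> K0 \<Longrightarrow> \<bar>Re z1 - Re w\<bar> \<le> \<bar>Re z - Re w\<bar>"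
        using continuous_attains_inf[OF cK0 ne, of "\<lambda>z. \<bar>Re z - Re w\<bar>"] by (force intro!: continuous_intros)
      obtain z2 where z2: "z2 \<in> K0" "\<And>z. z \<in> K0 \<Longrightarrow> Im z \<le> Im z2"
        using continuous_attains_sup[OF cK0 ne, of Im] by (force intro!: continuous_intros)
      have "Re z1 \<noteq> Re w"
      proof
        assume "Re z1 = Re w"
        then have "Im z1 = Im w" using vis[of z1] z1(1) by (auto simp: K0_def)
        then have "z1 = w" using \<open>Re z1 = Re w\<close> by (simp add: complex_eq_iff)
        then show False using False z1(1) by (auto simp: K0_def)
      qed
      then have pos: "\<bar>Re z1 - Re w\<bar> > 0" by simp
      show ?thesis
      proof (rule that[of "(Im z2 - Im w) / \<bar>Re z1 - Re w\<bar>"])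
        fix z assume "z \<in> K" "Im z > Im w"
        then have z: "z \<in> K0" by (auto simp: K0_def)
        have "Im z - Im w \<le> (Im z2 - Im w) * 1" using z2(2)[OF z] by simp
        also have "\<dots> \<le> (Im z2 - Im w) * (\<bar>Re z - Re w\<bar> / \<bar>Re z1 - Re w\<bar>)"
          using z1(2)[OF z] pos z2(1) by (intro mult_left_mono) (auto simp: K0_def)
        finally show "Im z - Im w \<le> (Im z2 - Im w) / \<bar>Re z1 - Re w\<bar> * \<bar>Re z - Re w\<bar>" by simp
      qed
    qed
  qed
  have "\<forall>\<^sub>F Y in at_top. Y > max (Im w) (Im w + M * \<bar>x - Re w\<bar>)"
    by (rule eventually_gt_at_top)
  then show ?thesis
  proof eventually_elim
    case (elim Y)
    show ?case
    proof (rule subsetI)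
      fix z assume z: "z \<in> closed_segment w (Complex x Y) \<inter> K"
      then obtain t where t: "z = w + of_real t * (Complex x Y - w)" "0 \<le> t" "t \<le> 1"
        unfolding closed_segment_def by (auto simp: algebra_simps scaleR_conv_of_real)
      show "z \<in> {w}"
      proof (rule ccontr)
        assume ne: "z \<notin> {w}"
        then have tpos: "t > 0" using t by (cases "t = 0") auto
        have im: "Im z - Im w = t * (Y - Im w)" and re: "Re z - Re w = t * (x - Re w)"
          by (auto simp: t(1))
        have "t * (Y - Im w) > 0" using tpos elim by simp
        then have "Im z > Im w" using im by linarith
        then have "t * (Y - Im w) \<le> M * (t * \<bar>x - Re w\<bar>)"
          using M[of z] z ne im re tpos by (auto simp: abs_mult)
        then have "t * (Y - Im w) \<le> t * (M * \<bar>x - Re w\<bar>)" by (simp add: mult_ac)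
        then show False using tpos elim by simp
      qed
    qed
  qed
qed

text \<open>\<open>X\<close> will hold the abscissae of the placed vertices; avoiding them keeps new
  edges from being vertical. \<open>F\<close> or \<open>G\<close> is empty when the new vertex comes
  to an end of the contour.\<close>

lemma exists_real_between:
  fixes F G X :: "real set"
  assumes "finite F" "finite G" "finite X" "\<And>a g. a \<in> F \<Longrightarrow> g \<in> G \<Longrightarrow> a < g"
  shows "\<exists>x. x \<notin> X \<and> (\<forall>a\<in>F. a < x) \<and> (\<forall>g\<in>G. x < g)"
proof -
  obtain lo hi where lh: "lo < hi" "\<And>a. a \<in> F \<Longrightarrow> a \<le> lo" "\<And>g. g \<in> G \<Longrightarrow> hi \<le> g"
  proof (cases "F = {} \<or> G = {}")
    case True
    show ?thesis
    proof (cases "F = {}")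
      case True
      show ?thesis
      proof (rule that[of "Min (insert 0 G) - 1" "Min (insert 0 G)"])
        show "Min (insert 0 G) \<le> g" if "g \<in> G" for g using that assms by (intro Min_le) auto
      qed (use True in auto)
    next
      case False
      then show ?thesis
        using True assms by (intro that[of "Max F" "Max F + 1"]) auto
    qed
  next
    case False
    then show ?thesis
      using assms by (intro that[of "Max F" "Min G"]) auto
  qed
  have "infinite ({lo<..<hi} - X)"
    using lh(1) assms(3) by (simp add: Diff_infinite_finite)
  then obtain x where "x \<in> {lo<..<hi} - X" by (metis finite.emptyI equals0I)
  then show ?thesis using lh by (intro exI[of _ x]) fastforce
qed

section \<open>Extending paths by one vertex\<close>

lemma path_length_Cons:
  "L \<noteq> [] \<Longrightarrow> path_length p (v # L) = dist (p v) (p (hd L)) + path_length p L"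
  unfolding path_length_def
  by (cases L) (auto simp: sum.lessThan_Suc_shift simp del: sum.lessThan_Suc)

lemma path_length_snoc:
  assumes "L \<noteq> []"
  shows "path_length p (L @ [v]) = path_length p L + dist (p (last L)) (p v)"
proof -
  obtain n where n: "length L = Suc n" using assms by (cases L) auto
  have "path_length p (L @ [v]) = (\<Sum>i<Suc n. dist (p ((L @ [v]) ! i)) (p ((L @ [v]) ! Suc i)))"
    by (simp add: path_length_def n)
  also have "\<dots> = (\<Sum>i<n. dist (p ((L @ [v]) ! i)) (p ((L @ [v]) ! Suc i))) + dist (p (L ! n)) (p v)"
    using n by (simp add: nth_append)
  also have "(\<Sum>i<n. dist (p ((L @ [v]) ! i)) (p ((L @ [v]) ! Suc i))) = path_length p L"
    unfolding path_length_def n by (intro sum.cong) (auto simp: nth_append n)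
  also have "L ! n = last L" using assms n by (simp add: last_conv_nth)
  finally show ?thesis .
qed

lemma gpath_Cons:
  assumes "gpath S E L" "v \<notin> S" "{v, hd L} \<in> E"
  shows "gpath (insert v S) E (v # L)"
proof -
  have "{(v # L) ! i, (v # L) ! Suc i} \<in> E" if "Suc i < length (v # L)" for i
    using assms that unfolding gpath_def walk_def by (cases i) (auto simp: hd_conv_nth)
  then show ?thesis using assms unfolding gpath_def walk_def by auto
qed

lemma gpath_snoc:
  assumes "gpath S E L" "v \<notin> S" "{last L, v} \<in> E"
  shows "gpath (insert v S) E (L @ [v])"
proof -
  have "{(L @ [v]) ! i, (L @ [v]) ! Suc i} \<in> E" if i: "Suc i < length (L @ [v])" for i
  proof (cases "Suc i < length L")
    case True
    then show ?thesis using assms unfolding gpath_def walk_def by (auto simp: nth_append)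
  next
    case False
    then have "Suc i = length L" using i by simp
    then show ?thesis using assms unfolding gpath_def walk_def
      by (auto simp: nth_append last_conv_nth simp flip: \<open>Suc i = length L\<close>)
  qed
  then show ?thesis using assms unfolding gpath_def walk_def by auto
qed

lemma path_length_cong: "(\<And>x. x \<in> set L \<Longrightarrow> p x = q x) \<Longrightarrow> path_length p L = path_length q L"
  unfolding path_length_def by (intro sum.cong) auto

lemma gpath_mono: "gpath S E L \<Longrightarrow> S \<subseteq> S' \<Longrightarrow> gpath S' E L"
  unfolding gpath_def walk_def by blast

section \<open>Straight-line drawings from stackings\<close>

text \<open>The distances to \<open>a\<close> and \<open>b\<close> differ by at most
  \<open>dist a b\<close>, so the detour costs a constant, while \<open>\<epsilon>\<close> times the
  distance to \<open>b\<close> is at least \<open>\<epsilon> * (Y - Im b)\<close>. Solving for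
  \<open>Y\<close> gives the threshold.\<close>

lemma far_point_ratio:
  assumes "\<epsilon> > 0"
  shows "\<forall>\<^sub>F Y in at_top. dist (Complex x Y) a + c < (1 + \<epsilon>) * dist (Complex x Y) b"
proof -
  have "\<forall>\<^sub>F Y in at_top. Y > Im b + (\<bar>c\<bar> + dist a b) / \<epsilon>" by (rule eventually_gt_at_top)
  then show ?thesis
  proof eventually_elim
    case (elim Y)
    have "Y - Im b \<le> dist (Complex x Y) b"
      using abs_Im_le_cmod[of "Complex x Y - b"] by (simp add: dist_norm)
    then have "(\<bar>c\<bar> + dist a b) / \<epsilon> < dist (Complex x Y) b" using elim by linarith
    then have "\<bar>c\<bar> + dist a b < \<epsilon> * dist (Complex x Y) b"
      using assms by (simp add: divide_less_eq mult.commute)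
    moreover have "dist (Complex x Y) a \<le> dist (Complex x Y) b + dist a b"
      by (metis dist_triangle dist_commute)
    ultimately show ?case by (simp add: algebra_simps)
  qed
qed

lemma Re_closed_segment_eq:
  assumes "z \<in> closed_segment a b" "Re a \<noteq> Re b"
  shows "Re z = Re a \<Longrightarrow> z = a"
    and "min (Re a) (Re b) \<le> Re z" "Re z \<le> max (Re a) (Re b)" "Im z \<le> max (Im a) (Im b)"
proof -
  obtain t where t: "z = (1 - t) *\<^sub>R a + t *\<^sub>R b" "0 \<le> t" "t \<le> 1"
    using assms(1) by (auto simp: closed_segment_def)
  have re: "Re z = (1 - t) * Re a + t * Re b" and im: "Im z = (1 - t) * Im a + t * Im b"
    by (simp_all add: t)
  show "z = a" if "Re z = Re a"
  proof -
    have "t * (Re b - Re a) = Re z - Re a" using re by (simp add: algebra_simps)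
    then have "t * (Re b - Re a) = 0" using that by simp
    then show ?thesis using assms(2) t by auto
  qed
  have "z \<in> {z. min (Re a) (Re b) \<le> Re z \<and> Re z \<le> max (Re a) (Re b) \<and> Im z \<le> max (Im a) (Im b)}"
  proof -
    let ?S = "{z. min (Re a) (Re b) \<le> Re z \<and> Re z \<le> max (Re a) (Re b) \<and> Im z \<le> max (Im a) (Im b)}"
    have "?S = {z. Re z \<ge> min (Re a) (Re b)} \<inter> {z. Re z \<le> max (Re a) (Re b)} \<inter> {z. Im z \<le> max (Im a) (Im b)}"
      by auto
    then have "convex ?S"
      by (simp only:) (intro convex_Int convex_halfspace_Re_ge convex_halfspace_Re_le convex_halfspace_Im_le)
    then have "closed_segment a b \<subseteq> ?S"
      by (intro closed_segment_subset) auto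
    then show ?thesis using assms(1) by blast
  qed
  then show "min (Re a) (Re b) \<le> Re z" "Re z \<le> max (Re a) (Re b)" "Im z \<le> max (Im a) (Im b)" by auto
qed

text \<open>The second common point puts both segments on one ray from \<open>c\<close>, so the
  shorter one is contained in the longer one.\<close>

lemma segments_common_end:
  fixes c :: "'a::euclidean_space"
  assumes "z \<in> closed_segment a c" "z \<in> closed_segment b c" "z \<noteq> c"
  shows "a \<in> closed_segment b c \<or> b \<in> closed_segment a c"
proof -
  obtain s where s: "z = c + s *\<^sub>R (a - c)" "0 \<le> s" "s \<le> 1"
    using assms(1) by (subst (asm) closed_segment_commute) (auto simp: closed_segment_def algebra_simps)
  obtain t where t: "z = c + t *\<^sub>R (b - c)" "0 \<le> t" "t \<le> 1"
    using assms(2) by (subst (asm) closed_segment_commute) (auto simp: closed_segment_def algebra_simps)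
  have pos: "s > 0" "t > 0" using assms(3) s t by (auto simp: less_le)
  have eq: "s *\<^sub>R (a - c) = t *\<^sub>R (b - c)" using s(1) t(1) by simp
  show ?thesis
  proof (cases "t \<le> s")
    case True
    have "a - c = (t / s) *\<^sub>R (b - c)"
      using arg_cong[OF eq, of "\<lambda>v. (1 / s) *\<^sub>R v"] pos by (simp del: scaleR_cancel_left)
    then have "a = c + (t / s) *\<^sub>R (b - c)" by (metis add.commute diff_add_cancel)
    then have "a = (1 - t / s) *\<^sub>R c + (t / s) *\<^sub>R b"
      by (simp add: scaleR_diff_left scaleR_diff_right)
    moreover have "0 \<le> t / s" "t / s \<le> 1" using pos True by auto
    ultimately have "a \<in> closed_segment c b" unfolding closed_segment_def by blast
    then show ?thesis by (simp add: closed_segment_commute)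
  next
    case False
    have "b - c = (s / t) *\<^sub>R (a - c)"
      using arg_cong[OF eq[symmetric], of "\<lambda>v. (1 / t) *\<^sub>R v"] pos by (simp del: scaleR_cancel_left)
    then have "b = c + (s / t) *\<^sub>R (a - c)" by (metis add.commute diff_add_cancel)
    then have "b = (1 - s / t) *\<^sub>R c + (s / t) *\<^sub>R a"
      by (simp add: scaleR_diff_left scaleR_diff_right)
    moreover have "0 \<le> s / t" "s / t \<le> 1" using pos False by auto
    ultimately have "b \<in> closed_segment c a" unfolding closed_segment_def by blast
    then show ?thesis by (simp add: closed_segment_commute)
  qed
qed

text \<open>The abscissa is chosen between those of \<open>A\<close> and \<open>D\<close>, the
  height \<open>Y\<close> last. Each requirement on \<open>Y\<close> is one of finitely many that
  hold for all large \<open>Y\<close>, so one height meets them all.\<close>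

lemma good_drawing_add:
  fixes E :: "'a set set"
  assumes good: "good_drawing \<epsilon> E S (A @ B @ D) p" and fin: "finite S"
    and doub: "\<And>e. e \<in> E \<Longrightarrow> \<exists>u w. u \<noteq> w \<and> e = {u, w}"
    and v: "v \<notin> S" and ne: "nbrs E S v \<noteq> {}"
    and sub: "nbrs E S v \<subseteq> set (take 1 (rev A)) \<union> set B \<union> set (take 1 D)"
    and eps: "\<epsilon> > 0"
  shows "\<exists>q. good_drawing \<epsilon> E (insert v S) (A @ v # D) q"
proof -
  define N where "N = nbrs E S v"
  have disj: "disjoint_cells E S p" and setC: "set (A @ B @ D) \<subseteq> S"
    and sorted: "sorted_wrt (<) (map (\<lambda>c. Re (p c)) (A @ B @ D))"
    by (rule good[unfolded good_drawing_def, THEN conjunct1]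
      good[unfolded good_drawing_def, THEN conjunct2, THEN conjunct1]
      good[unfolded good_drawing_def, THEN conjunct2, THEN conjunct2, THEN conjunct1])+
  note good' = good[unfolded good_drawing_def, THEN conjunct2, THEN conjunct2, THEN conjunct2]
  note vis = good'[THEN conjunct1, rule_format]
  note ratio = good'[THEN conjunct2, rule_format]
  have NS: "N \<subseteq> S" by (auto simp: N_def nbrs_def)
  have "set (take 1 (rev A)) \<subseteq> set A" "set (take 1 D) \<subseteq> set D"
    using set_take_subset[of 1 "rev A"] set_take_subset[of 1 D] by auto
  then have NC: "N \<subseteq> set (A @ B @ D)" using sub unfolding N_def by auto
  have cells_sub: "k \<subseteq> S" "finite k" "k \<noteq> {}" if "k \<in> cells E S" for k
    using that fin doub finite_subset unfolding cells_def by fastforce+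
  have finc: "finite (cells E S)" using cells_sub fin by (meson Pow_iff finite_Pow_iff finite_subset subsetI)
  have cell1: "{u} \<in> cells E S" if "u \<in> S" for u using that by (auto simp: cells_def)
  have cell2: "k = {w} \<or> (\<exists>b. k = {w, b})" if "k \<in> cells E S" "w \<in> k" for w k
    using that doub unfolding cells_def by fastforce
  have on_cell: "w \<in> k" if "k \<in> cells E S" "w \<in> S" "p w \<in> convex hull (p ` k)" for w k
  proof (rule ccontr)
    assume "w \<notin> k"
    then have "convex hull (p ` {w}) \<inter> convex hull (p ` k) \<subseteq> p ` ({w} \<inter> k)"
      using disj that cell1 unfolding disjoint_cells_def by blast
    then show False using that \<open>w \<notin> k\<close> by auto
  qed
  have AD: "Re (p a) < Re (p d)" if "a \<in> set A" "d \<in> set D" for a d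
    using sorted that by (auto simp: sorted_wrt_append)
  \<comment> \<open>The position of \<open>x\<close> relative to \<open>B\<close> is free, because
    \<open>B\<close> is going to be hidden.\<close>
  obtain x where x: "x \<notin> (\<lambda>u. Re (p u)) ` S" "\<And>a. a \<in> set A \<Longrightarrow> Re (p a) < x"
    "\<And>d. d \<in> set D \<Longrightarrow> x < Re (p d)"
  proof -
    have "\<exists>x. x \<notin> (\<lambda>u. Re (p u)) ` S \<and> (\<forall>a\<in>(\<lambda>u. Re (p u)) ` set A. a < x) \<and> (\<forall>d\<in>(\<lambda>u. Re (p u)) ` set D. x < d)"
      by (rule exists_real_between) (use AD fin in auto)
    then show ?thesis using that by auto
  qed
  have xN: "x \<noteq> Re (p u)" if "u \<in> S" for u using x(1) that by auto
  \<comment> \<open>A steep segment from a visible neighbour meets an old cell at most in that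
    neighbour.\<close>
  have ev1: "\<forall>\<^sub>F Y in at_top. \<forall>w\<in>N. \<forall>k\<in>cells E S.
      closed_segment (p w) (Complex x Y) \<inter> convex hull (p ` k) \<subseteq> p ` ({w} \<inter> k)"
  proof (intro eventually_ball_finite ballI finc)
    show "finite N" using NS fin finite_subset by blast
    fix w k assume w: "w \<in> N" and k: "k \<in> cells E S"
    have "\<forall>\<^sub>F Y in at_top. closed_segment (p w) (Complex x Y) \<inter> convex hull (p ` k) \<subseteq> {p w}"
    proof (rule steep_segment_avoids)
      show "compact (convex hull (p ` k))"
        using cells_sub[OF k] by (simp add: finite_imp_compact_convex_hull)
      show "Im z \<le> Im (p w)" if "z \<in> convex hull (p ` k)" "Re z = Re (p w)" for z
        using vis[of w k z] that w k NC by blast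
      show "\<exists>b. convex hull (p ` k) = closed_segment (p w) b" if "p w \<in> convex hull (p ` k)"
      proof -
        have "k = {w} \<or> (\<exists>b. k = {w, b})" using cell2[OF k on_cell[OF k _ that]] w NS by blast
        then show ?thesis
        proof (elim disjE exE)
          assume "k = {w}"
          then show ?thesis by (intro exI[of _ "p w"]) simp
        next
          fix b assume "k = {w, b}"
          then show ?thesis by (intro exI[of _ "p b"]) (simp add: segment_convex_hull)
        qed
      qed
      show "x \<noteq> Re (p w)" using xN w NS by auto
    qed
    then show "\<forall>\<^sub>F Y in at_top. closed_segment (p w) (Complex x Y) \<inter> convex hull (p ` k) \<subseteq> p ` ({w} \<inter> k)"
    proof eventually_elim
      case (elim Y)
      show ?case
      proof
        fix z assume z: "z \<in> closed_segment (p w) (Complex x Y) \<inter> convex hull (p ` k)"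
        then have "z = p w" using elim by blast
        then have "w \<in> k" using on_cell[OF k, of w] w NS z by blast
        then show "z \<in> p ` ({w} \<inter> k)" using \<open>z = p w\<close> by blast
      qed
    qed
  qed
  have ev2: "\<forall>\<^sub>F Y in at_top. \<forall>k\<in>cells E S. \<forall>z\<in>convex hull (p ` k). Im z < Y"
  proof (rule eventually_ball_finite[OF finc], rule ballI)
    fix k assume k: "k \<in> cells E S"
    have "bounded (convex hull (p ` k))"
      using cells_sub[OF k] by (simp add: finite_imp_bounded_convex_hull)
    then obtain M where M: "\<And>z. z \<in> convex hull (p ` k) \<Longrightarrow> norm z \<le> M"
      by (auto simp: bounded_iff)
    have "\<forall>\<^sub>F Y in at_top. Y > M" by (rule eventually_gt_at_top)
    then show "\<forall>\<^sub>F Y in at_top. \<forall>z\<in>convex hull (p ` k). Im z < Y"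
    proof eventually_elim
      case (elim Y)
      then show ?case using M abs_Im_le_cmod by (smt (verit))
    qed
  qed
  \<comment> \<open>The connecting paths are fixed before \<open>Y\<close>, so their lengths are
    constants as \<open>Y\<close> grows. The \<open>max\<close> in \<open>ev3\<close> keeps both
    directions, which saves comparing a path with its reverse.\<close>
  obtain P where P: "\<And>u w. u \<in> S \<Longrightarrow> w \<in> S \<Longrightarrow> gpath S E (P u w) \<and> hd (P u w) = u \<and> last (P u w) = w"
  proof -
    have "\<exists>L. gpath S E L \<and> hd L = u \<and> last L = w" if "u \<in> S" "w \<in> S" for u w
    proof (cases "u = w")
      case True
      then show ?thesis using that by (intro exI[of _ "[u]"]) (auto simp: gpath_def walk_def)
    qed (use ratio that in blast)
    then have "\<forall>u w. \<exists>L. u \<in> S \<longrightarrow> w \<in> S \<longrightarrow> gpath S E L \<and> hd L = u \<and> last L = w" by blast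
    then obtain P where "\<forall>u w. u \<in> S \<longrightarrow> w \<in> S \<longrightarrow> gpath S E (P u w) \<and> hd (P u w) = u \<and> last (P u w) = w"
      unfolding choice_iff by blast
    then show ?thesis using that by blast
  qed
  have ev3: "\<forall>\<^sub>F Y in at_top. \<forall>w\<in>N. \<forall>u\<in>S. dist (Complex x Y) (p w) + max (path_length p (P u w)) (path_length p (P w u))
      < (1 + \<epsilon>) * dist (Complex x Y) (p u)"
    using NS fin finite_subset by (intro eventually_ball_finite ballI far_point_ratio eps) blast+
  obtain Y where Y: "(\<forall>w\<in>N. \<forall>k\<in>cells E S.
      closed_segment (p w) (Complex x Y) \<inter> convex hull (p ` k) \<subseteq> p ` ({w} \<inter> k)) \<and>
    (\<forall>k\<in>cells E S. \<forall>z\<in>convex hull (p ` k). Im z < Y) \<and>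
    (\<forall>w\<in>N. \<forall>u\<in>S. dist (Complex x Y) (p w) + max (path_length p (P u w)) (path_length p (P w u))
      < (1 + \<epsilon>) * dist (Complex x Y) (p u))"
    using eventually_happens'[OF trivial_limit_at_top_linorder eventually_conj[OF ev1 eventually_conj[OF ev2 ev3]]]
    by (elim exE)
  note Y1 = Y[THEN conjunct1, rule_format]
  note Y2 = Y[THEN conjunct2, THEN conjunct1, rule_format]
  note Y3 = Y[THEN conjunct2, THEN conjunct2, rule_format]
  define z0 where "z0 = Complex x Y"
  define q where "q = p(v := z0)"
  have qv: "q v = z0" and qS: "\<And>u. u \<in> S \<Longrightarrow> q u = p u" using v by (auto simp: q_def)
  have qimg: "q ` k = p ` k" if "k \<subseteq> S" for k using qS that by (auto intro!: image_cong)
  have newcells: "cells E (insert v S) = cells E S \<union> insert {v} ((\<lambda>w. {w, v}) ` N)"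
  proof -
    have "e \<in> cells E S \<or> e \<in> (\<lambda>w. {w, v}) ` N" if e: "e \<in> E" "e \<subseteq> insert v S" for e
    proof (cases "v \<in> e")
      case True
      then obtain w where "e = {v, w}" "w \<noteq> v" using doub[OF e(1)] by blast
      then show ?thesis using e unfolding N_def nbrs_def by (auto simp: insert_commute)
    qed (use e in \<open>auto simp: cells_def\<close>)
    moreover have "{w, v} \<in> cells E (insert v S)" if "w \<in> N" for w
      using that by (auto simp: cells_def N_def nbrs_def insert_commute)
    ultimately show ?thesis by (auto simp: cells_def)
  qed
  have hull_new: "convex hull (q ` {w, v}) = closed_segment (p w) z0" if "w \<in> N" for w
    using that NS qS qv by (auto simp: segment_convex_hull)
  \<comment> \<open>Otherwise both segments lie on one ray from \<open>z0\<close>, and the old end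
    of one lies on the other, against the choice of \<open>Y\<close>.\<close>
  have segdisj: "closed_segment (p w) z0 \<inter> closed_segment (p w') z0 \<subseteq> {z0}"
    if "w \<in> N" "w' \<in> N" "w \<noteq> w'" for w w'
  proof
    fix z assume z: "z \<in> closed_segment (p w) z0 \<inter> closed_segment (p w') z0"
    have "p w \<notin> closed_segment (p w') z0" "p w' \<notin> closed_segment (p w) z0"
      using Y1[of w "{w'}"] Y1[of w' "{w}"] cell1 NS that unfolding z0_def by auto
    then show "z \<in> {z0}" using segments_common_end[of z "p w" z0 "p w'"] z by blast
  qed
  have z0_old: "z0 \<notin> convex hull (p ` k)" if "k \<in> cells E S" for k
    using Y2[OF that, of z0] by (auto simp: z0_def)
  have sym: "convex hull (q ` k) \<inter> convex hull (q ` l) \<subseteq> q ` (k \<inter> l)"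
    if kl: "k \<in> cells E S" "l \<in> insert {v} ((\<lambda>w. {w, v}) ` N)" for k l
  proof (cases "l = {v}")
    case True
    then show ?thesis using z0_old[OF that(1)] qimg[OF cells_sub(1)[OF that(1)]] qv by simp
  next
    case False
    then obtain w where w: "w \<in> N" "l = {w, v}" using kl(2) by blast
    have "convex hull (q ` k) \<inter> convex hull (q ` l) \<subseteq> p ` ({w} \<inter> k)"
      using Y1[OF w(1) that(1)] qimg[OF cells_sub(1)[OF that(1)]] hull_new[OF w(1)] w(2)
      by (auto simp: z0_def)
    also have "\<dots> \<subseteq> q ` (k \<inter> l)" using w qS NS by auto
    finally show ?thesis .
  qed
  have new_new: "convex hull (q ` k) \<inter> convex hull (q ` l) \<subseteq> q ` (k \<inter> l)"
    if kl: "k \<in> insert {v} ((\<lambda>w. {w, v}) ` N)" "l \<in> insert {v} ((\<lambda>w. {w, v}) ` N)" "k \<noteq> l" for k l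
  proof -
    have vkl: "v \<in> k" "v \<in> l" using kl by auto
    have "z0 \<in> q ` (k \<inter> l)" by (rule image_eqI[of _ _ v]) (simp_all add: qv vkl)
    then have zz: "{z0} \<subseteq> q ` (k \<inter> l)" by (simp only: insert_subset empty_subsetI simp_thms)
    have hh: "convex hull (q ` k) \<inter> convex hull (q ` l) \<subseteq> {z0}"
    proof (cases "k = {v} \<or> l = {v}")
      case True
      then show ?thesis by (elim disjE) (simp_all add: qv)
    next
      case False
      obtain w where w: "w \<in> N" "k = {w, v}" using kl(1) False by (elim insertE imageE) auto
      obtain w' where w': "w' \<in> N" "l = {w', v}" using kl(2) False by (elim insertE imageE) auto
      have "w \<noteq> w'" using w w' kl(3) by auto
      then show ?thesis
        unfolding w(2) w'(2) hull_new[OF w(1)] hull_new[OF w'(1)] using w(1) w'(1) by (intro segdisj)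
    qed
    show ?thesis by (rule subset_trans[OF hh zz])
  qed
  have "disjoint_cells E (insert v S) q"
    unfolding disjoint_cells_def
  proof (intro ballI impI)
    fix k l assume kl: "k \<in> cells E (insert v S)" "l \<in> cells E (insert v S)" "k \<noteq> l"
    consider "k \<in> cells E S" "l \<in> cells E S" | "k \<in> cells E S" "l \<in> insert {v} ((\<lambda>w. {w, v}) ` N)"
      | "l \<in> cells E S" "k \<in> insert {v} ((\<lambda>w. {w, v}) ` N)"
      | "k \<in> insert {v} ((\<lambda>w. {w, v}) ` N)" "l \<in> insert {v} ((\<lambda>w. {w, v}) ` N)"
      using kl(1)[unfolded newcells Un_iff] kl(2)[unfolded newcells Un_iff] by (elim disjE) assumption+
    then show "convex hull (q ` k) \<inter> convex hull (q ` l) \<subseteq> q ` (k \<inter> l)"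
    proof cases
      case 1
      then have s: "k \<subseteq> S" "l \<subseteq> S" "k \<inter> l \<subseteq> S" using cells_sub by blast+
      show ?thesis unfolding qimg[OF s(1)] qimg[OF s(2)] qimg[OF s(3)]
        using disj 1 kl(3) unfolding disjoint_cells_def by blast
    next
      case 3
      then show ?thesis using sym[of l k] by (simp add: Int_commute)
    next
      case 2
      then show ?thesis by (rule sym)
    next
      case 4
      then show ?thesis using kl(3) by (rule new_new)
    qed
  qed
  moreover have "set (A @ v # D) \<subseteq> insert v S" using setC by auto
  moreover have "sorted_wrt (<) (map (\<lambda>c. Re (q c)) (A @ v # D))"
  proof -
    have "map (\<lambda>c. Re (q c)) (A @ v # D) = map (\<lambda>c. Re (p c)) A @ x # map (\<lambda>c. Re (p c)) D"
      using setC qS by (auto simp: qv z0_def)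
    moreover have "sorted_wrt (<) (map (\<lambda>c. Re (p c)) A @ x # map (\<lambda>c. Re (p c)) D)"
      using sorted x AD by (auto simp: sorted_wrt_append)
    ultimately show ?thesis by (simp only:)
  qed
  moreover have "Im z \<le> Im (q c)"
    if c: "c \<in> set (A @ v # D)" and k: "k \<in> cells E (insert v S)"
      and z: "z \<in> convex hull (q ` k)" "Re z = Re (q c)" for c k z
  proof (cases "c = v")
    case True
    have "Im z \<le> Y"
    proof (cases "k \<in> cells E S")
      case True
      then show ?thesis using Y2[OF True] z qimg cells_sub by force
    next
      case False
      then consider "k = {v}" | w where "w \<in> N" "k = {w, v}"
        using k[unfolded newcells Un_iff] by (elim disjE insertE imageE) simp_all
      then show ?thesis
      proof cases
        case 1
        then show ?thesis using z qv by (simp add: z0_def)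
      next
        case 2
        have "Im (p w) < Y" using Y2[OF cell1[of w], of "p w"] 2 NS by auto
        then show ?thesis
          using Re_closed_segment_eq(4)[of z "p w" z0] z hull_new[OF 2(1)] 2 xN[of w] NS
          by (auto simp: z0_def)
      qed
    qed
    then show ?thesis using True qv by (simp add: z0_def)
  next
    case False
    then have c: "c \<in> set A \<or> c \<in> set D" "c \<in> S" using c setC by auto
    show ?thesis
    proof (cases "k \<in> cells E S")
      case True
      then show ?thesis using vis[of c k z] c z qimg[OF cells_sub(1)[OF True]] qS by auto
    next
      case k': False
      then consider "k = {v}" | w where "w \<in> N" "k = {w, v}"
        using k[unfolded newcells Un_iff] by (elim disjE insertE imageE) simp_all
      then show ?thesis
      proof cases
        case 1
        then show ?thesis using z qv qS c xN[of c] by (simp add: z0_def)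
      next
        case 2
        have wS: "w \<in> S" using 2 NS by auto
        have zseg: "z \<in> closed_segment (p w) z0" using z hull_new 2 by auto
        have re: "Re (p w) \<noteq> Re z0" using xN[OF wS] by (simp add: z0_def)
        have rz: "Re z = Re (p c)" using z qS c by simp
        \<comment> \<open>A new edge spans the abscissae between its old end \<open>w\<close> and
          \<open>x\<close>. A vertex of \<open>A\<close> is left of \<open>x\<close> and not right
          of \<open>w\<close>, since \<open>w\<close> comes at the earliest last in
          \<open>A\<close>; \<open>D\<close> is symmetric. So the edge can reach the vertical line
          of \<open>c\<close> only at \<open>p w\<close>.\<close>
        have "Re (p c) = Re (p w)"
        proof -
          have wcase: "w \<in> set (take 1 (rev A)) \<or> w \<in> set B \<or> w \<in> set (take 1 D)"
            using sub 2 by (auto simp: N_def)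
          consider "c \<in> set A" | "c \<in> set D" using c by blast
          then show ?thesis
          proof cases
            case 1
            have "Re (p c) \<le> Re (p w)"
              using wcase
            proof (elim disjE)
              assume "w \<in> set (take 1 (rev A))"
              then obtain A' where "A = A' @ [w]" by (cases A rule: rev_cases) auto
              then show ?thesis using 1 sorted by (auto simp: sorted_wrt_append less_imp_le)
            next
              assume "w \<in> set B"
              then show ?thesis using 1 sorted by (auto simp: sorted_wrt_append less_imp_le)
            next
              assume "w \<in> set (take 1 D)"
              then have "w \<in> set D" using set_take_subset[of 1 D] by auto
              then show ?thesis using 1 AD less_imp_le by blast
            qed
            then show ?thesis
              using Re_closed_segment_eq(2)[OF zseg re] rz x(2)[OF 1] by (auto simp: z0_def min_def split: if_splits)
          next
            case 2
            have "Re (p w) \<le> Re (p c)"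
              using wcase
            proof (elim disjE)
              assume "w \<in> set (take 1 (rev A))"
              then have "w \<in> set A" using set_take_subset[of 1 "rev A"] by auto
              then show ?thesis using 2 AD less_imp_le by blast
            next
              assume "w \<in> set B"
              then show ?thesis using 2 sorted by (auto simp: sorted_wrt_append less_imp_le)
            next
              assume "w \<in> set (take 1 D)"
              then obtain D' where "D = w # D'" by (cases D) auto
              then show ?thesis using 2 sorted by (auto simp: sorted_wrt_append less_imp_le)
            qed
            then show ?thesis
              using Re_closed_segment_eq(3)[OF zseg re] rz x(3)[OF 2] by (auto simp: z0_def max_def split: if_splits)
          qed
        qed
        moreover have "z = p w" using Re_closed_segment_eq(1)[OF zseg re] calculation rz by simp
        ultimately show ?thesis using vis[of c "{w}" "p w"] c cell1[OF wS] qS by auto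
      qed
    qed
  qed
  moreover have "\<exists>L. gpath (insert v S) E L \<and> hd L = u \<and> last L = w \<and>
         path_length q L < (1 + \<epsilon>) * dist (q u) (q w)"
    if uw: "u \<in> insert v S" "w \<in> insert v S" "u \<noteq> w" for u w
  proof -
    have plq: "path_length q L = path_length p L" if "gpath S E L" for L
      using that qS unfolding gpath_def walk_def by (intro path_length_cong) auto
    \<comment> \<open>One old neighbour \<open>y\<close> serves as the detour for all pairs with
      \<open>v\<close>.\<close>
    obtain y where y: "y \<in> N" using ne N_def by auto
    have yv: "{v, y} \<in> E" "{y, v} \<in> E" "y \<in> S" using y by (auto simp: N_def nbrs_def insert_commute)
    consider "u \<in> S" "w \<in> S" | "u = v" "w \<in> S" | "u \<in> S" "w = v" using uw by blast
    then show ?thesis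
    proof cases
      case 1
      then obtain L where L: "gpath S E L" "hd L = u" "last L = w" "path_length p L < (1 + \<epsilon>) * dist (p u) (p w)"
        using ratio uw by blast
      then show ?thesis using plq[OF L(1)] qS 1 by (intro exI[of _ L]) (auto intro: gpath_mono)
    next
      case 2
      let ?L = "P y w"
      have L: "gpath S E ?L" "hd ?L = y" "last ?L = w" using P yv 2 by auto
      have Ln: "?L \<noteq> []" using L(1) by (auto simp: gpath_def walk_def)
      have "path_length q (v # ?L) = dist z0 (p y) + path_length p ?L"
        using path_length_Cons[OF Ln, of q v] plq[OF L(1)] L qv qS yv by simp
      also have "\<dots> < (1 + \<epsilon>) * dist z0 (p w)" using Y3[OF y 2(2)] by (simp add: z0_def)
      finally show ?thesis using 2 gpath_Cons[OF L(1) v] L yv Ln qv qS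
        by (intro exI[of _ "v # ?L"]) auto
    next
      case 3
      let ?L = "P u y"
      have L: "gpath S E ?L" "hd ?L = u" "last ?L = y" using P yv 3 by auto
      have Ln: "?L \<noteq> []" using L(1) by (auto simp: gpath_def walk_def)
      have "path_length q (?L @ [v]) = path_length p ?L + dist (p y) z0"
        using path_length_snoc[OF Ln, of q v] plq[OF L(1)] L qv qS yv by simp
      also have "\<dots> < (1 + \<epsilon>) * dist z0 (p u)" using Y3[OF y 3(1)] by (simp add: z0_def dist_commute)
      finally show ?thesis using 3 gpath_snoc[OF L(1) v] L yv Ln qv qS
        by (intro exI[of _ "?L @ [v]"]) (auto simp: dist_commute)
    qed
  qed
  ultimately have "good_drawing \<epsilon> E (insert v S) (A @ v # D) q"
    unfolding good_drawing_def by blast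
  then show ?thesis by blast
qed

lemma stacks_good_drawing:
  assumes "stacks E {r} [r] S C" and eps: "\<epsilon> > 0"
    and doub: "\<And>e. e \<in> E \<Longrightarrow> \<exists>u w. u \<noteq> w \<and> e = {u, w}"
  shows "finite S \<and> (\<exists>p. good_drawing \<epsilon> E S C p)"
  using assms(1)
proof induction
  case stacks_refl
  have "cells E {r} = {{r}}" using doub by (fastforce simp: cells_def)
  then have "good_drawing \<epsilon> E {r} [r] (\<lambda>_. 0)"
    unfolding good_drawing_def disjoint_cells_def by auto
  then show ?case by blast
next
  case (stacks_drop S' A B D)
  then obtain p where p: "good_drawing \<epsilon> E S' (A @ B @ D) p" by blast
  then have "good_drawing \<epsilon> E S' (A @ D) p"
    unfolding good_drawing_def by (auto simp: sorted_wrt_append)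
  then show ?case using stacks_drop by blast
next
  case (stacks_add S' A B D v)
  then show ?case using good_drawing_add[OF _ _ doub _ _ _ eps, where S = S' and A = A and B = B and D = D and v = v] by blast
qed

theorem stacks_imp_drawing:
  assumes "stacks E {r} [r] V C" and eps: "\<epsilon> > 0" and sg: "simple_graph V E"
  shows "\<exists>p \<gamma>. planar_drawing V E p \<gamma> \<and> straight_line_drawing V E p \<gamma> \<and>
           (card V \<ge> 2 \<longrightarrow> spanning_ratio V E p < 1 + \<epsilon>)"
proof -
  have sgE: "\<exists>u v. u \<in> V \<and> v \<in> V \<and> u \<noteq> v \<and> e = {u, v}" if "e \<in> E" for e
    using sg that unfolding simple_graph_def by (elim conjE) (erule bspec)
  have doub: "\<exists>u w. u \<noteq> w \<and> e = {u, w}" if "e \<in> E" for e using sgE[OF that] by blast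
  have eV: "e \<subseteq> V" if "e \<in> E" for e using sgE[OF that] by auto
  obtain p where fin: "finite V" and good: "good_drawing \<epsilon> E V C p"
  proof -
    have "finite V \<and> (\<exists>p. good_drawing \<epsilon> E V C p)"
      by (rule stacks_good_drawing[OF assms(1) eps doub])
    then show ?thesis using that by (elim conjE exE)
  qed
  have disj: "disjoint_cells E V p" using good by (simp add: good_drawing_def)
  \<comment> \<open>Edges are unordered, so an orientation has to be chosen before
    \<open>linepath\<close> applies.\<close>
  define ends where "ends e = (SOME (u, w). u \<noteq> w \<and> e = {u, w})" for e :: "'a set"
  have ends: "fst (ends e) \<noteq> snd (ends e)" "e = {fst (ends e), snd (ends e)}" if "e \<in> E" for e
  proof -
    have "\<exists>x. case x of (u, w) \<Rightarrow> u \<noteq> w \<and> e = {u, w}" using doub[OF that] by auto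
    then have "case ends e of (u, w) \<Rightarrow> u \<noteq> w \<and> e = {u, w}" unfolding ends_def by (rule someI_ex)
    then show "fst (ends e) \<noteq> snd (ends e)" "e = {fst (ends e), snd (ends e)}" by (auto split: prod.splits)
  qed
  define \<gamma> where "\<gamma> e = linepath (p (fst (ends e))) (p (snd (ends e)))" for e
  have inj: "inj_on p V"
  proof (rule inj_onI, rule ccontr)
    fix u w assume uw: "u \<in> V" "w \<in> V" "p u = p w" "u \<noteq> w"
    have "{u} \<in> cells E V" "{w} \<in> cells E V" using uw by (auto simp: cells_def)
    then have "convex hull (p ` {u}) \<inter> convex hull (p ` {w}) \<subseteq> p ` ({u} \<inter> {w})"
      using disj uw unfolding disjoint_cells_def by blast
    then show False using uw by auto
  qed
  have hull: "path_image (\<gamma> e) = convex hull (p ` e)" if "e \<in> E" for e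
  proof -
    have "convex hull (p ` e) = convex hull (p ` {fst (ends e), snd (ends e)})" using ends[OF that] by simp
    then show ?thesis by (simp add: \<gamma>_def segment_convex_hull)
  qed
  have dr: "drawing V E p \<gamma>"
    unfolding drawing_def
  proof (intro conjI ballI inj)
    fix e assume e: "e \<in> E"
    have "p (fst (ends e)) \<noteq> p (snd (ends e))"
      using inj ends[OF e] eV[OF e] by (metis inj_on_contraD insert_subset)
    then show "arc (\<gamma> e)" by (simp add: \<gamma>_def)
    show "\<exists>u v. e = {u, v} \<and> pathstart (\<gamma> e) = p u \<and> pathfinish (\<gamma> e) = p v"
      using ends[OF e] by (intro exI[of _ "fst (ends e)"] exI[of _ "snd (ends e)"]) (simp add: \<gamma>_def)
  qed
  have pd: "planar_drawing V E p \<gamma>"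
    unfolding planar_drawing_def
  proof (intro conjI ballI impI dr)
    fix e e' assume e: "e \<in> E" "e' \<in> E" "e \<noteq> e'"
    then have "e \<in> cells E V" "e' \<in> cells E V" using eV by (auto simp: cells_def)
    then show "path_image (\<gamma> e) \<inter> path_image (\<gamma> e') \<subseteq> p ` (e \<inter> e')"
      using disj e hull unfolding disjoint_cells_def by simp
  qed
  have sl: "straight_line_drawing V E p \<gamma>"
    unfolding straight_line_drawing_def
  proof (intro conjI ballI dr)
    fix e assume e: "e \<in> E"
    show "\<exists>u v. e = {u, v} \<and> path_image (\<gamma> e) = closed_segment (p u) (p v)"
      using ends[OF e] by (intro exI[of _ "fst (ends e)"] exI[of _ "snd (ends e)"]) (simp add: \<gamma>_def)
  qed
  have "spanning_ratio V E p < 1 + \<epsilon>" if c2: "card V \<ge> 2"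
  proof -
    let ?R = "{graph_dist V E p u v / dist (p u) (p v) | u v. u \<in> V \<and> v \<in> V \<and> u \<noteq> v}"
    have "?R \<subseteq> (\<lambda>(u, v). graph_dist V E p u v / dist (p u) (p v)) ` (V \<times> V)" by auto
    then have finR: "finite ?R" by (rule finite_subset) (simp add: fin)
    \<comment> \<open>\<open>Max\<close> says nothing about an empty set; two vertices make
      \<open>?R\<close> nonempty.\<close>
    have neR: "?R \<noteq> {}"
    proof -
      have "\<not> card V \<le> Suc 0" using c2 by simp
      then obtain u v where "u \<in> V" "v \<in> V" "u \<noteq> v"
        unfolding card_le_Suc0_iff_eq[OF fin] by blast
      then show ?thesis by blast
    qed
    have "r < 1 + \<epsilon>" if r: "r \<in> ?R" for r
    proof -
      obtain u v where uv: "u \<in> V" "v \<in> V" "u \<noteq> v" "r = graph_dist V E p u v / dist (p u) (p v)"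
        using r by auto
      obtain L where L: "gpath V E L" "hd L = u" "last L = v"
        "path_length p L < (1 + \<epsilon>) * dist (p u) (p v)"
        using good[unfolded good_drawing_def, THEN conjunct2, THEN conjunct2, THEN conjunct2, THEN conjunct2,
          rule_format, OF uv(1-3)] by (elim exE conjE)
      have pl_nonneg: "0 \<le> path_length p L" for L unfolding path_length_def by (simp add: sum_nonneg)
      have "graph_dist V E p u v \<le> path_length p L"
        unfolding graph_dist_def
        by (intro cInf_lower) (use L pl_nonneg in \<open>auto simp: bdd_below_def\<close>)
      moreover have "dist (p u) (p v) > 0" using inj uv by (auto simp: inj_on_def)
      ultimately show ?thesis using L(4) uv(4) by (simp add: divide_less_eq)
    qed
    then show ?thesis unfolding spanning_ratio_def using finR neR by simp
  qed
  then show ?thesis using pd sl by blast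
qed

section \<open>Cycles and disc systems\<close>

fun pedges :: "'a list \<Rightarrow> 'a set set" where
  "pedges (x # y # L) = insert {x, y} (pedges (y # L))"
| "pedges _ = {}"

lemma pedges_append: "pedges (A @ x # D) = pedges (A @ [x]) \<union> pedges (x # D)"
  by (induction A rule: pedges.induct) auto

lemma pedges_append2: "pedges (A @ x # y # D) = insert {x, y} (pedges (A @ [x]) \<union> pedges (y # D))"
  using pedges_append[of A x "y # D"] by auto

lemma pedges_rev [simp]: "pedges (rev L) = pedges L"
proof (induction L rule: pedges.induct)
  case (1 x y L)
  then show ?case using pedges_append[of "rev L" y "[x]"] by (auto simp: insert_commute)
qed auto

lemma pedges_subset: "e \<in> pedges L \<Longrightarrow> e \<subseteq> set L"
  by (induction L rule: pedges.induct) auto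

lemma pedges_pair: "e \<in> pedges L \<Longrightarrow> distinct L \<Longrightarrow> \<exists>a b. a \<noteq> b \<and> e = {a, b} \<and> a \<in> set L \<and> b \<in> set L"
  by (induction L rule: pedges.induct) auto

text \<open>An edge of a repetition-free path has two distinct ends, and paths that share at most
  one vertex cannot both contain them.\<close>

lemma pedges_meet: "distinct A \<Longrightarrow> set A \<inter> set B \<subseteq> {x} \<Longrightarrow> pedges A \<inter> pedges B = {}"
proof (rule ccontr)
  assume *: "distinct A" "set A \<inter> set B \<subseteq> {x}" "pedges A \<inter> pedges B \<noteq> {}"
  then obtain e where e: "e \<in> pedges A" "e \<in> pedges B" by blast
  obtain a b where "a \<noteq> b" "e = {a, b}" using pedges_pair[OF e(1) *(1)] by blast
  then show False using pedges_subset[OF e(1)] pedges_subset[OF e(2)] *(2) by blast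
qed

lemma Union_pedges: "length L \<ge> 2 \<Longrightarrow> \<Union> (pedges L) = set L"
proof (induction L rule: pedges.induct)
  case (1 x y L)
  then show ?case by (cases L) auto
qed auto

lemma distinct_split2:
  assumes "x \<in> set L" "y \<in> set L" "x \<noteq> y"
  shows "(\<exists>X M Y. L = X @ x # M @ y # Y) \<or> (\<exists>X M Y. L = X @ y # M @ x # Y)"
proof -
  obtain X R where L: "L = X @ x # R" using assms(1) by (meson split_list)
  show ?thesis
  proof (cases "y \<in> set R")
    case True
    then obtain M Y where "R = M @ y # Y" by (meson split_list)
    then show ?thesis using L by blast
  next
    case False
    then have "y \<in> set X" using assms L by auto
    then obtain X1 X2 where "X = X1 @ y # X2" by (meson split_list)
    then have "L = X1 @ y # X2 @ x # R" using L by simp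
    then show ?thesis by blast
  qed
qed

section \<open>Reachability within a vertex set\<close>

definition step :: "'a set set \<Rightarrow> 'a set \<Rightarrow> ('a \<times> 'a) set" where
  "step E W = {(a, b). {a, b} \<in> E \<and> a \<in> W \<and> b \<in> W}"

lemma sym_step: "sym (step E W)"
  by (auto simp: sym_def step_def insert_commute)

lemma step_rtrancl_sym: "(a, b) \<in> (step E W)\<^sup>* \<Longrightarrow> (b, a) \<in> (step E W)\<^sup>*"
  by (rule symD[OF sym_rtrancl[OF sym_step]])

lemma step_rtrancl_path:
  assumes "(a, b) \<in> (step E W)\<^sup>*" "a \<in> W"
  shows "\<exists>P. distinct P \<and> P \<noteq> [] \<and> hd P = a \<and> last P = b \<and> set P \<subseteq> W \<and> pedges P \<subseteq> E"
  using assms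
proof (induction rule: rtrancl_induct)
  case base
  then show ?case by (intro exI[of _ "[a]"]) auto
next
  case (step b c)
  then obtain P where P: "distinct P" "P \<noteq> []" "hd P = a" "last P = b" "set P \<subseteq> W" "pedges P \<subseteq> E" by blast
  show ?case
  proof (cases "c \<in> set P")
    \<comment> \<open>When the walk returns to \<open>c\<close>, the list is cut back to the initial
      part ending there, so it stays distinct.\<close>
    case True
    then obtain P1 P2 where P12: "P = P1 @ c # P2" by (meson split_list)
    have "hd (P1 @ [c]) = a" using P(3) P12 by (cases P1) auto
    moreover have "pedges (P1 @ [c]) \<subseteq> E" using P(6) pedges_append[of P1 c P2] P12 by auto
    ultimately show ?thesis using P P12 by (intro exI[of _ "P1 @ [c]"]) auto
  next
    case False
    have "P = butlast P @ [b]" using P by (metis append_butlast_last_id)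
    then have "pedges (P @ [c]) = insert {b, c} (pedges P)"
      using pedges_append2[of "butlast P" b c "[]"] by (metis append.assoc append_Cons append_Nil pedges.simps(2) pedges.simps(3) sup_bot.right_neutral)
    then show ?thesis using False P step(2) by (intro exI[of _ "P @ [c]"]) (auto simp: step_def)
  qed
qed

text \<open>
  A cycle, given as a bottom path \<open>B\<close> and a top path \<open>T\<close> with common ends. A single edge is allowed
  as one of the two paths.
\<close>

definition cyc :: "'a set set \<Rightarrow> 'a list \<Rightarrow> 'a list \<Rightarrow> bool" where
  "cyc E B T \<longleftrightarrow> distinct B \<and> distinct T \<and> pedges B \<subseteq> E \<and> pedges T \<subseteq> E \<and>
     (\<exists>s B' T' t. B = s # B' @ [t] \<and> T = s # T' @ [t] \<and> set B \<inter> set T = {s, t}) \<and> pedges B \<inter> pedges T = {}"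

lemma cyc_sym: "cyc E B T \<Longrightarrow> cyc E T B"
  unfolding cyc_def by blast

lemma cyc_rev:
  assumes "cyc E B T" shows "cyc E (rev B) (rev T)"
proof -
  obtain s B' T' t where *: "B = s # B' @ [t]" "T = s # T' @ [t]" "set B \<inter> set T = {s, t}"
    using assms unfolding cyc_def by (elim conjE exE)
  have "\<exists>s B' T' t. rev B = s # B' @ [t] \<and> rev T = s # T' @ [t] \<and> set (rev B) \<inter> set (rev T) = {s, t}"
    using * by (intro exI[of _ t] exI[of _ "rev B'"] exI[of _ "rev T'"] exI[of _ s]) auto
  then show ?thesis using assms unfolding cyc_def by simp
qed

lemma cycE:
  assumes "cyc E B T"
  obtains s B' T' t where "B = s # B' @ [t]" "T = s # T' @ [t]" "set B \<inter> set T = {s, t}" "s \<noteq> t"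
proof -
  obtain s B' T' t where *: "B = s # B' @ [t]" "T = s # T' @ [t]" "set B \<inter> set T = {s, t}"
    using assms unfolding cyc_def by blast
  moreover have "s \<noteq> t" using assms * unfolding cyc_def by auto
  ultimately show ?thesis using that by blast
qed

lemma cyc_Union: "cyc E B T \<Longrightarrow> \<Union> (pedges B \<union> pedges T) = set B \<union> set T"
  by (erule cycE) (simp add: Union_pedges)

lemma cycI:
  assumes "distinct B" "distinct T" "pedges B \<subseteq> E" "pedges T \<subseteq> E"
    "hd B = s" "last B = t" "hd T = s" "last T = t" "s \<noteq> t" "B \<noteq> []" "T \<noteq> []"
    "set B \<inter> set T = {s, t}" "pedges B \<inter> pedges T = {}"
  shows "cyc E B T"
proof -
  have *: "\<exists>L'. L = s # L' @ [t]" if "hd L = s" "last L = t" "L \<noteq> []" for L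
    using that assms(9) by (cases L; cases "tl L" rule: rev_cases) auto
  obtain B' T' where "B = s # B' @ [t]" "T = s # T' @ [t]"
    using *[OF assms(5,6,10)] *[OF assms(7,8,11)] by (elim exE)
  then have "\<exists>s B' T' t. B = s # B' @ [t] \<and> T = s # T' @ [t] \<and> set B \<inter> set T = {s, t}"
    using assms(12) by (intro exI conjI)
  then show ?thesis unfolding cyc_def using assms(1-4,13) by (intro conjI)
qed

text \<open>Any two vertices of the bottom path can become the common ends: the rest of the cycle
  runs from \<open>x\<close> back to the left end, along all of \<open>T\<close>, and from the right
  end back to \<open>y\<close>.\<close>

lemma cyc_recut:
  assumes cyc: "cyc E B T" and B: "B = X @ x # M @ y # Y"
  obtains L where "cyc E (x # M @ [y]) L" "pedges L = pedges (X @ [x]) \<union> pedges T \<union> pedges (y # Y)"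
    "set L = set X \<union> {x} \<union> set T \<union> {y} \<union> set Y" "hd L = x" "last L = y" "distinct L" "L \<noteq> []"
proof -
  obtain s B' T' t where st: "B = s # B' @ [t]" "T = s # T' @ [t]" "set B \<inter> set T = {s, t}" "s \<noteq> t"
    using cycE[OF cyc] .
  have dB: "distinct B" and dT: "distinct T" and pB: "pedges B \<subseteq> E" and pT: "pedges T \<subseteq> E"
    and pBT: "pedges B \<inter> pedges T = {}" using cyc by (auto simp: cyc_def)
  \<comment> \<open>\<open>X1\<close> and \<open>Y1\<close> omit the ends \<open>s\<close> and
    \<open>t\<close>, which \<open>T\<close> already contributes to \<open>L2\<close>.\<close>
  define X1 where "X1 = tl (X @ [x])"
  define Y1 where "Y1 = butlast (y # Y)"
  have X1: "X @ [x] = s # X1" using st(1) B unfolding X1_def by (cases X) auto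
  have Y1: "y # Y = Y1 @ [t]"
    using arg_cong[OF trans[OF st(1)[symmetric] B], of last] unfolding Y1_def
    by (metis append_butlast_last_id last.simps last_appendR last_snoc list.distinct(1) append_Cons)
  have setB: "set B = set X \<union> {x} \<union> set M \<union> {y} \<union> set Y" using B by auto
  have setX: "insert x (set X) = insert s (set X1)" using arg_cong[OF X1, of set] by auto
  have setY: "insert y (set Y) = insert t (set Y1)" using arg_cong[OF Y1, of set] by auto
  have pB_eq: "pedges B = pedges (X @ [x]) \<union> pedges (x # M @ [y]) \<union> pedges (y # Y)"
    unfolding B using pedges_append[of X x "M @ y # Y"] pedges_append[of "x # M" y Y] by auto
  define L2 where "L2 = rev X1 @ T @ rev Y1"
  have L2e: "pedges L2 = pedges (X @ [x]) \<union> pedges T \<union> pedges (y # Y)"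
  proof -
    have "pedges L2 = pedges (rev X1 @ [s]) \<union> pedges (s # (T' @ t # rev Y1))"
      unfolding L2_def st(2) using pedges_append[of "rev X1" s "T' @ t # rev Y1"] by simp
    also have "pedges (s # (T' @ t # rev Y1)) = pedges T \<union> pedges (t # rev Y1)"
      unfolding st(2) using pedges_append[of "s # T'" t "rev Y1"] by simp
    also have "pedges (rev X1 @ [s]) = pedges (X @ [x])"
      unfolding X1 using pedges_rev[of "s # X1"] by simp
    also have "pedges (t # rev Y1) = pedges (y # Y)"
      unfolding Y1 using pedges_rev[of "Y1 @ [t]"] by simp
    finally show ?thesis by auto
  qed
  have L2s: "set L2 = set X \<union> {x} \<union> set T \<union> {y} \<union> set Y"
    using setX setY st(2) unfolding L2_def by auto
  have dXY: "distinct (X @ [x])" "distinct (y # Y)" "(set X \<union> {x}) \<inter> (set Y \<union> {y}) = {}" "x \<noteq> y" using dB B by auto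
  have inB: "set X1 \<subseteq> set B" "set Y1 \<subseteq> set B" using setX setY setB by auto
  have dX1: "distinct X1" "s \<notin> set X1" using dXY X1 by auto
  have dY1: "distinct Y1" "t \<notin> set Y1" using dXY Y1 by auto
  have "set X1 \<inter> set Y1 = {}" using dXY(3) setX setY by blast
  moreover have "t \<notin> set X1" using dXY(3) setX setY by blast
  moreover have "s \<notin> set Y1" using dXY(3) setX setY by blast
  ultimately have dL2: "distinct L2" unfolding L2_def using dX1 dY1 dT inB st(3) by auto
  have hdL2: "hd L2 = x" unfolding L2_def st(2) using X1 by (cases X1 rule: rev_cases) auto
  have lastL2: "last L2 = y" unfolding L2_def st(2) using Y1 by (cases Y1) auto
  have c12: "cyc E (x # M @ [y]) L2"
  proof (rule cycI)
    show "set (x # M @ [y]) \<inter> set L2 = {x, y}"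
    proof -
      have "set M \<inter> set T = {}"
      proof -
        have "set M \<inter> {s, t} = {}" using dB B setX setY by auto
        then show ?thesis using st(3) setB by blast
      qed
      then show ?thesis using dB B L2s by auto
    qed
    have "pedges (x # M @ [y]) \<inter> pedges (X @ [x]) = {}"
      by (rule pedges_meet[where x = x]) (use dB B in auto)
    moreover have "pedges (x # M @ [y]) \<inter> pedges (y # Y) = {}"
      by (rule pedges_meet[where x = y]) (use dB B in auto)
    ultimately show "pedges (x # M @ [y]) \<inter> pedges L2 = {}" using L2e pB_eq pBT by blast
    show "distinct (x # M @ [y])" using dB B by auto
    show "pedges (x # M @ [y]) \<subseteq> E" "pedges L2 \<subseteq> E" using pB pT pB_eq L2e by auto
  qed (use dL2 hdL2 lastL2 dXY(4) L2_def st(2) in auto)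
  show ?thesis by (rule that[OF c12 L2e L2s hdL2 lastL2 dL2]) (simp add: L2_def st(2))
qed

text \<open>The successor of \<open>c\<close> on \<open>B\<close> serves as \<open>w\<close>, which
  is why \<open>c\<close> must not be last.\<close>

lemma cyc_rotate_aux:
  assumes cyc: "cyc E B T" and c: "c \<in> set B" "c \<noteq> last B"
  shows "\<exists>w T'. cyc E [c, w] T' \<and> pedges [c, w] \<union> pedges T' = pedges B \<union> pedges T"
proof -
  obtain X R where XR: "B = X @ c # R" using c(1) by (meson split_list)
  have "R \<noteq> []" using XR c(2) by auto
  then obtain d Y where "R = d # Y" by (cases R) auto
  then have B: "B = X @ c # [] @ d # Y" using XR by simp
  obtain L where L: "cyc E (c # [] @ [d]) L" "pedges L = pedges (X @ [c]) \<union> pedges T \<union> pedges (d # Y)"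
    using cyc_recut[OF cyc B] .
  have "pedges B = insert {c, d} (pedges (X @ [c]) \<union> pedges (d # Y))" using B pedges_append2[of X c d Y] by simp
  then show ?thesis using L by (intro exI[of _ d] exI[of _ L]) auto
qed

text \<open>In the three-connected case the filling starts from one placed edge, so the bottom path
  has to shrink to an edge at the prescribed first vertex. The right end has no successor and is
  reached by mirroring.\<close>

lemma cyc_rotate:
  assumes cyc: "cyc E B T" and c: "c \<in> set B \<union> set T"
  shows "\<exists>w T'. cyc E [c, w] T' \<and> pedges [c, w] \<union> pedges T' = pedges B \<union> pedges T"
proof -
  obtain s B' T' t where st: "B = s # B' @ [t]" "T = s # T' @ [t]" "set B \<inter> set T = {s, t}" "s \<noteq> t"
    using cycE[OF cyc] .
  consider "c \<in> set B" "c \<noteq> last B" | "c \<in> set T" "c \<noteq> last T" | "c = t" using c st by auto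
  then show ?thesis
  proof cases
    case 1
    then show ?thesis by (rule cyc_rotate_aux[OF cyc])
  next
    case 2
    then show ?thesis using cyc_rotate_aux[OF cyc_sym[OF cyc]] by (simp add: Un_commute)
  next
    case 3
    then have "c \<in> set (rev B)" "c \<noteq> last (rev B)" using st by auto
    from cyc_rotate_aux[OF cyc_rev[OF cyc] this] show ?thesis unfolding pedges_rev .
  qed
qed

text \<open>
  Think of \<open>iv Z\<close> and \<open>ie Z\<close> as the vertices and edges inside the cycle with edge set \<open>Z\<close>.
\<close>

locale disc_system =
  fixes V :: "'a set" and E :: "'a set set" and iv :: "'a set set \<Rightarrow> 'a set" and ie :: "'a set set \<Rightarrow> 'a set set"
  assumes finite_E: "finite E"
    and edge: "e \<in> E \<Longrightarrow> \<exists>u w. u \<in> V \<and> w \<in> V \<and> u \<noteq> w \<and> e = {u, w}"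
    and iv_V: "iv Z \<subseteq> V" and ie_E: "ie Z \<subseteq> E"
    and iv_disjoint: "cyc E B T \<Longrightarrow> iv (pedges B \<union> pedges T) \<inter> (set B \<union> set T) = {}"
    and ie_disjoint: "cyc E B T \<Longrightarrow> ie (pedges B \<union> pedges T) \<inter> (pedges B \<union> pedges T) = {}"
    and edge_inside: "\<lbrakk>cyc E B T; x \<in> iv (pedges B \<union> pedges T); {x, y} \<in> E\<rbrakk> \<Longrightarrow> {x, y} \<in> ie (pedges B \<union> pedges T)"
    and end_inside: "\<lbrakk>cyc E B T; e \<in> ie (pedges B \<union> pedges T); x \<in> e\<rbrakk> \<Longrightarrow> x \<in> iv (pedges B \<union> pedges T) \<union> (set B \<union> set T)"
    and theta: "\<lbrakk>cyc E L1 L2; cyc E L1 L; cyc E L2 L; pedges L \<inter> ie (pedges L1 \<union> pedges L2) \<noteq> {}\<rbrakk> \<Longrightarrow>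
       iv (pedges L1 \<union> pedges L2) = iv (pedges L1 \<union> pedges L) \<union> iv (pedges L2 \<union> pedges L) \<union> (set L - {hd L, last L}) \<and>
       ie (pedges L1 \<union> pedges L2) = ie (pedges L1 \<union> pedges L) \<union> ie (pedges L2 \<union> pedges L) \<union> pedges L \<and>
       iv (pedges L1 \<union> pedges L) \<inter> iv (pedges L2 \<union> pedges L) = {} \<and>
       ie (pedges L1 \<union> pedges L) \<inter> ie (pedges L2 \<union> pedges L) = {}"
begin

text \<open>\<open>P\<close> lists the inner vertices only, so \<open>P = []\<close> is a single
  inside edge.\<close>

definition chord :: "'a set set \<Rightarrow> 'a \<Rightarrow> 'a list \<Rightarrow> 'a \<Rightarrow> bool" where
  "chord Z x P y \<longleftrightarrow> distinct P \<and> set P \<subseteq> iv Z \<and> pedges (x # P @ [y]) \<subseteq> ie Z"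

lemma chord_rev: "chord Z x P y \<Longrightarrow> chord Z y (rev P) x"
  unfolding chord_def using pedges_rev[of "x # P @ [y]"] by simp

definition splits :: "'a set set \<Rightarrow> 'a set set \<Rightarrow> 'a set set \<Rightarrow> 'a list \<Rightarrow> 'a set set \<Rightarrow> bool" where
  "splits Z Z1 Z2 P F \<longleftrightarrow> iv Z = iv Z1 \<union> iv Z2 \<union> set P \<and> ie Z = ie Z1 \<union> ie Z2 \<union> F \<and>
     iv Z1 \<inter> iv Z2 = {} \<and> ie Z1 \<inter> ie Z2 = {}"

text \<open>Recutting at \<open>x\<close> and \<open>y\<close> turns the cycle and the chord into
  three paths with common ends, the form in which \<open>theta\<close> applies. The chord becomes
  the top of the lower disc and part of the bottom of the upper one.\<close>

lemma theta_bottom: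
  assumes cyc: "cyc E B T" and B: "B = X @ x # M @ y # Y"
    and ch: "chord (pedges B \<union> pedges T) x P y"
  shows "cyc E (x # M @ [y]) (x # P @ [y])" "cyc E (X @ x # P @ y # Y) T"
    "splits (pedges B \<union> pedges T) (pedges (x # M @ [y]) \<union> pedges (x # P @ [y]))
       (pedges (X @ x # P @ y # Y) \<union> pedges T) P (pedges (x # P @ [y]))"
proof -
  let ?Z = "pedges B \<union> pedges T"
  obtain s B' T' t where st: "B = s # B' @ [t]" "T = s # T' @ [t]" "set B \<inter> set T = {s, t}" "s \<noteq> t"
    using cycE[OF cyc] .
  have dB: "distinct B" and dT: "distinct T" and pB: "pedges B \<subseteq> E" and pT: "pedges T \<subseteq> E"
    and pBT: "pedges B \<inter> pedges T = {}" using cyc by (auto simp: cyc_def)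
  define X1 where "X1 = tl (X @ [x])"
  define Y1 where "Y1 = butlast (y # Y)"
  have X1: "X @ [x] = s # X1" using st(1) B unfolding X1_def by (cases X) auto
  have Y1: "y # Y = Y1 @ [t]"
    using arg_cong[OF trans[OF st(1)[symmetric] B], of last] unfolding Y1_def
    by (metis append_butlast_last_id last.simps last_appendR last_snoc list.distinct(1) append_Cons)
  have setB: "set B = set X \<union> {x} \<union> set M \<union> {y} \<union> set Y" using B by auto
  have setX: "insert x (set X) = insert s (set X1)" using arg_cong[OF X1, of set] by auto
  have setY: "insert y (set Y) = insert t (set Y1)" using arg_cong[OF Y1, of set] by auto
  have Pd: "distinct P" "set P \<subseteq> iv ?Z" "pedges (x # P @ [y]) \<subseteq> ie ?Z" using ch by (auto simp: chord_def)
  have Pout: "set P \<inter> (set B \<union> set T) = {}" using Pd(2) iv_disjoint[OF cyc] by blast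
  have pP: "pedges (x # P @ [y]) \<inter> (pedges B \<union> pedges T) = {}" using Pd(3) ie_disjoint[OF cyc] by blast
  have pPE: "pedges (x # P @ [y]) \<subseteq> E" using Pd(3) ie_E by blast
  have pB_eq: "pedges B = pedges (X @ [x]) \<union> pedges (x # M @ [y]) \<union> pedges (y # Y)"
    unfolding B using pedges_append[of X x "M @ y # Y"] pedges_append[of "x # M" y Y] by auto
  obtain L2 where c12: "cyc E (x # M @ [y]) L2" and L2e: "pedges L2 = pedges (X @ [x]) \<union> pedges T \<union> pedges (y # Y)"
    and L2s: "set L2 = set X \<union> {x} \<union> set T \<union> {y} \<union> set Y" and hdL2: "hd L2 = x" and lastL2: "last L2 = y"
    and dL2: "distinct L2" and neL2: "L2 \<noteq> []"
    using cyc_recut[OF cyc B] .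
  have dXY: "x \<noteq> y" using dB B by auto
  have dLP: "distinct (x # P @ [y])" using Pd(1) Pout setB dXY by auto
  show c1: "cyc E (x # M @ [y]) (x # P @ [y])"
  proof (rule cycI)
    show "set (x # M @ [y]) \<inter> set (x # P @ [y]) = {x, y}" using Pout setB by auto
    show "pedges (x # M @ [y]) \<inter> pedges (x # P @ [y]) = {}" using pP pB_eq by blast
    show "distinct (x # M @ [y])" using dB B by auto
    show "pedges (x # M @ [y]) \<subseteq> E" using pB pB_eq by auto
  qed (use dLP pPE dXY in auto)
  have c2': "cyc E L2 (x # P @ [y])"
  proof (rule cycI)
    show "set L2 \<inter> set (x # P @ [y]) = {x, y}" using Pout setB L2s by auto
    show "pedges L2 \<inter> pedges (x # P @ [y]) = {}" using pP pB_eq L2e by blast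
    show "pedges L2 \<subseteq> E" using pB pT pB_eq L2e by auto
  qed (use dLP dL2 hdL2 lastL2 pPE dXY neL2 in auto)
  have pQ: "pedges (X @ x # P @ y # Y) = pedges (X @ [x]) \<union> pedges (x # P @ [y]) \<union> pedges (y # Y)"
    using pedges_append[of X x "P @ y # Y"] pedges_append[of "x # P" y Y] by auto
  show "cyc E (X @ x # P @ y # Y) T"
  proof (rule cycI)
    show "distinct (X @ x # P @ y # Y)" using dB B Pd(1) Pout by auto
    have st': "s \<in> insert x (set X)" "t \<in> insert y (set Y)" using setX setY by auto
    have "set B \<inter> set T = {s, t}" by (rule st(3))
    then show "set (X @ x # P @ y # Y) \<inter> set T = {s, t}" using Pout setB st' by auto
    show "pedges (X @ x # P @ y # Y) \<inter> pedges T = {}" using pQ pP pBT pB_eq by blast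
    show "pedges (X @ x # P @ y # Y) \<subseteq> E" using pQ pB pB_eq pPE by auto
    show "hd (X @ x # P @ y # Y) = s" using X1 by (cases X) auto
    show "last (X @ x # P @ y # Y) = t" using Y1 by (cases Y rule: rev_cases) auto
  qed (use st dT pT in auto)
  have Z12: "pedges (x # M @ [y]) \<union> pedges L2 = ?Z" using pB_eq L2e by auto
  have Z2: "pedges L2 \<union> pedges (x # P @ [y]) = pedges (X @ x # P @ y # Y) \<union> pedges T" using pQ L2e by auto
  have ne: "pedges (x # P @ [y]) \<noteq> {}" by (cases P) auto
  have "pedges (x # P @ [y]) \<inter> ie (pedges (x # M @ [y]) \<union> pedges L2) \<noteq> {}"
    unfolding Z12 using Pd(3) ne by blast
  from theta[OF c12 c1 c2' this] show "splits ?Z (pedges (x # M @ [y]) \<union> pedges (x # P @ [y]))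
       (pedges (X @ x # P @ y # Y) \<union> pedges T) P (pedges (x # P @ [y]))"
    unfolding Z12 Z2 splits_def using dLP by auto
qed

text \<open>Here the chord joins an inner vertex of the top to an inner vertex of the bottom. It
  ends the top path of the left disc and begins the bottom path of the right disc, so the left disc
  can be filled first.\<close>

lemma theta_cross:
  assumes cyc: "cyc E B T" and B: "B = X @ x # Y" and T: "T = U @ y # W"
    and ne: "X \<noteq> []" "Y \<noteq> []" "U \<noteq> []" "W \<noteq> []"
    and ch: "chord (pedges B \<union> pedges T) y P x"
  shows "cyc E (X @ [x]) (U @ y # P @ [x])" "cyc E (y # P @ x # Y) (y # W)"
    "splits (pedges B \<union> pedges T) (pedges (X @ [x]) \<union> pedges (U @ y # P @ [x]))
       (pedges (y # P @ x # Y) \<union> pedges (y # W)) P (pedges (y # P @ [x]))"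
proof -
  let ?Z = "pedges B \<union> pedges T"
  obtain s B' T' t where st: "B = s # B' @ [t]" "T = s # T' @ [t]" "set B \<inter> set T = {s, t}" "s \<noteq> t"
    using cycE[OF cyc] .
  have dB: "distinct B" and dT: "distinct T" and pB: "pedges B \<subseteq> E" and pT: "pedges T \<subseteq> E"
    and pBT: "pedges B \<inter> pedges T = {}" using cyc by (auto simp: cyc_def)
  obtain X1 where X1: "X = s # X1" using st(1) B ne(1) by (cases X) auto
  obtain U1 where U1: "U = s # U1" using st(2) T ne(3) by (cases U) auto
  obtain Y1 where Y1: "Y = Y1 @ [t]" using st(1) B ne(2) by (cases Y rule: rev_cases) auto
  obtain W1 where W1: "W = W1 @ [t]" using st(2) T ne(4) by (cases W rule: rev_cases) auto
  have Pd: "distinct P" "set P \<subseteq> iv ?Z" "pedges (y # P @ [x]) \<subseteq> ie ?Z" using ch by (auto simp: chord_def)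
  have Pout: "set P \<inter> (set B \<union> set T) = {}" using Pd(2) iv_disjoint[OF cyc] by blast
  have pP: "pedges (y # P @ [x]) \<inter> (pedges B \<union> pedges T) = {}" using Pd(3) ie_disjoint[OF cyc] by blast
  have pPE: "pedges (y # P @ [x]) \<subseteq> E" using Pd(3) ie_E by blast
  have setB: "set B = {s, t, x} \<union> set X1 \<union> set Y1" using B X1 Y1 by auto
  have setT: "set T = {s, t, y} \<union> set U1 \<union> set W1" using T U1 W1 by auto
  have xy: "x \<noteq> y" "x \<notin> set T" "y \<notin> set B" 
    using dB dT B T X1 Y1 U1 W1 st(3) by auto
  have dis: "(insert x (set X1 \<union> set Y1)) \<inter> (insert y (set U1 \<union> set W1)) = {}"
    using dB dT B T X1 Y1 U1 W1 st(3) setB setT by auto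
  have pB_eq: "pedges B = pedges (X @ [x]) \<union> pedges (x # Y)" unfolding B by (rule pedges_append)
  have pT_eq: "pedges T = pedges (U @ [y]) \<union> pedges (y # W)" unfolding T by (rule pedges_append)
  have dLP: "distinct (y # P @ [x])" using Pd(1) Pout B T xy by auto
  \<comment> \<open>Both arcs of the cycle are read from \<open>y\<close> to \<open>x\<close>, one
    through the left end and one through the right end, to match the chord.\<close>
  define L1 where "L1 = y # rev U1 @ s # X1 @ [x]"
  define L2 where "L2 = y # W1 @ t # rev Y1 @ [x]"
  have L1e: "pedges L1 = pedges (X @ [x]) \<union> pedges (U @ [y])"
  proof -
    have "pedges L1 = pedges (y # rev U1 @ [s]) \<union> pedges (s # X1 @ [x])"
      unfolding L1_def using pedges_append[of "y # rev U1" s "X1 @ [x]"] by simp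
    also have "pedges (y # rev U1 @ [s]) = pedges (U @ [y])"
      unfolding U1 using pedges_rev[of "s # U1 @ [y]"] by simp
    finally show ?thesis by (auto simp: X1)
  qed
  have L2e: "pedges L2 = pedges (x # Y) \<union> pedges (y # W)"
  proof -
    have "pedges L2 = pedges (y # W1 @ [t]) \<union> pedges (t # rev Y1 @ [x])"
      unfolding L2_def using pedges_append[of "y # W1" t "rev Y1 @ [x]"] by simp
    also have "pedges (t # rev Y1 @ [x]) = pedges (x # Y)"
      unfolding Y1 using pedges_rev[of "x # Y1 @ [t]"] by simp
    finally show ?thesis by (auto simp: W1)
  qed
  have dL1: "distinct L1" and dL2: "distinct L2" unfolding L1_def L2_def
    using dB dT dis xy by (auto simp: B T X1 Y1 U1 W1)
  have c12: "cyc E L1 L2"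
  proof (rule cycI)
    show "set L1 \<inter> set L2 = {y, x}" unfolding L1_def L2_def
      using dB dT dis by (auto simp: B T X1 Y1 U1 W1)
    have "pedges (X @ [x]) \<inter> pedges (x # Y) = {}"
      by (rule pedges_meet[where x = x]) (use dB B in auto)
    moreover have "pedges (U @ [y]) \<inter> pedges (y # W) = {}"
      by (rule pedges_meet[where x = y]) (use dT T in auto)
    ultimately show "pedges L1 \<inter> pedges L2 = {}" using L1e L2e pB_eq pT_eq pBT by blast
    show "pedges L1 \<subseteq> E" "pedges L2 \<subseteq> E" using pB pT pB_eq pT_eq L1e L2e by auto
  qed (use dL1 dL2 xy in \<open>auto simp: L1_def L2_def\<close>)
  have c1: "cyc E L1 (y # P @ [x])"
  proof (rule cycI)
    show "set L1 \<inter> set (y # P @ [x]) = {y, x}" unfolding L1_def using Pout setB setT by auto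
    show "pedges L1 \<inter> pedges (y # P @ [x]) = {}" using pP pB_eq pT_eq L1e by blast
    show "pedges L1 \<subseteq> E" using pB pT pB_eq pT_eq L1e by auto
  qed (use dL1 dLP pPE xy in \<open>auto simp: L1_def\<close>)
  have c2: "cyc E L2 (y # P @ [x])"
  proof (rule cycI)
    show "set L2 \<inter> set (y # P @ [x]) = {y, x}" unfolding L2_def using Pout setB setT by auto
    show "pedges L2 \<inter> pedges (y # P @ [x]) = {}" using pP pB_eq pT_eq L2e by blast
    show "pedges L2 \<subseteq> E" using pB pT pB_eq pT_eq L2e by auto
  qed (use dL2 dLP pPE xy in \<open>auto simp: L2_def\<close>)
  have pQ1: "pedges (U @ y # P @ [x]) = pedges (U @ [y]) \<union> pedges (y # P @ [x])"
    using pedges_append[of U y "P @ [x]"] by auto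
  have pQ2: "pedges (y # P @ x # Y) = pedges (y # P @ [x]) \<union> pedges (x # Y)"
    using pedges_append[of "y # P" x Y] by auto
  show "cyc E (X @ [x]) (U @ y # P @ [x])"
  proof (rule cycI[where s = s and t = x])
    show "set (X @ [x]) \<inter> set (U @ y # P @ [x]) = {s, x}"
      using Pout setB dis xy dB dT by (auto simp: B T X1 Y1 U1 W1)
    show "pedges (X @ [x]) \<inter> pedges (U @ y # P @ [x]) = {}" using pQ1 pP pB_eq pT_eq pBT by blast
    show "pedges (X @ [x]) \<subseteq> E" "pedges (U @ y # P @ [x]) \<subseteq> E" using pQ1 pB pT pB_eq pT_eq pPE by auto
    show "distinct (U @ y # P @ [x])" using Pd(1) Pout dB dT xy by (auto simp: B T)
    show "distinct (X @ [x])" "s \<noteq> x" using dB by (auto simp: B X1)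
  qed (use ne in \<open>auto simp: X1 U1\<close>)
  show "cyc E (y # P @ x # Y) (y # W)"
  proof (rule cycI[where s = y and t = t])
    show "set (y # P @ x # Y) \<inter> set (y # W) = {y, t}"
      using Pout setB dis xy dB dT by (auto simp: B T X1 Y1 U1 W1)
    show "pedges (y # P @ x # Y) \<inter> pedges (y # W) = {}" using pQ2 pP pB_eq pT_eq pBT by blast
    show "pedges (y # P @ x # Y) \<subseteq> E" "pedges (y # W) \<subseteq> E" using pQ2 pB pT pB_eq pT_eq pPE by auto
    show "distinct (y # P @ x # Y)" using Pd(1) Pout dB dT xy by (auto simp: B T)
    show "distinct (y # W)" "y \<noteq> t" using dT by (auto simp: T W1)
  qed (use ne in \<open>auto simp: Y1 W1\<close>)
  have Z12: "pedges L1 \<union> pedges L2 = ?Z" using pB_eq pT_eq L1e L2e by auto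
  have Z1: "pedges L1 \<union> pedges (y # P @ [x]) = pedges (X @ [x]) \<union> pedges (U @ y # P @ [x])" using pQ1 L1e by auto
  have Z2: "pedges L2 \<union> pedges (y # P @ [x]) = pedges (y # P @ x # Y) \<union> pedges (y # W)" using pQ2 L2e by auto
  have neP: "pedges (y # P @ [x]) \<noteq> {}" by (cases P) auto
  have "pedges (y # P @ [x]) \<inter> ie (pedges L1 \<union> pedges L2) \<noteq> {}"
    unfolding Z12 using Pd(3) neP by blast
  from theta[OF c12 c1 c2 this] show "splits ?Z (pedges (X @ [x]) \<union> pedges (U @ y # P @ [x]))
       (pedges (y # P @ x # Y) \<union> pedges (y # W)) P (pedges (y # P @ [x]))"
    unfolding Z12 Z1 Z2 splits_def using dLP by auto
qed

text \<open>The walk is followed until it first leaves the inside. An edge with an end inside has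
  its other end inside or on the cycle, so the exit \<open>b\<close> is on the cycle, and it is not
  in \<open>X\<close> because the walk avoids \<open>X\<close>.\<close>

lemma exit_inside:
  assumes cyc: "cyc E B T" and w: "w \<in> iv (pedges B \<union> pedges T)"
    and reach: "(w, k) \<in> (step E (- X))\<^sup>*" and k: "k \<notin> iv (pedges B \<union> pedges T)"
  shows "\<exists>a b. (w, a) \<in> (step E (iv (pedges B \<union> pedges T)))\<^sup>* \<and> a \<in> iv (pedges B \<union> pedges T) \<and>
     {a, b} \<in> E \<and> b \<in> set B \<union> set T \<and> b \<notin> X"
proof -
  let ?I = "iv (pedges B \<union> pedges T)"
  have "(z \<in> ?I \<and> (w, z) \<in> (step E ?I)\<^sup>*) \<or>
     (\<exists>a b. (w, a) \<in> (step E ?I)\<^sup>* \<and> a \<in> ?I \<and> {a, b} \<in> E \<and> b \<in> set B \<union> set T \<and> b \<notin> X)"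
    if "(w, z) \<in> (step E (- X))\<^sup>*" for z
    using that
  proof (induction rule: rtrancl_induct)
    case (step y z)
    show ?case
    proof (cases "y \<in> ?I \<and> (w, y) \<in> (step E ?I)\<^sup>*")
      case True
      have yz: "{y, z} \<in> E" "z \<notin> X" using step(2) by (auto simp: step_def)
      have "z \<in> ?I \<union> (set B \<union> set T)"
        using end_inside[OF cyc edge_inside[OF cyc _ yz(1)], of z] True by blast
      then show ?thesis
      proof
        assume "z \<in> ?I"
        then have "(y, z) \<in> step E ?I" using True yz by (auto simp: step_def)
        then show ?thesis using True \<open>z \<in> ?I\<close> rtrancl_into_rtrancl by metis
      next
        assume "z \<in> set B \<union> set T"
        then show ?thesis using True yz by blast
      qed
    qed (use step.IH in blast)
  qed (use w in auto)
  from this[OF reach] k show ?thesis by blast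
qed

text \<open>Two exits from the same component of the inside are linked through that component, and
  all edges used are inside by \<open>edge_inside\<close>.\<close>

lemma chord_from_exits:
  assumes cyc: "cyc E B T" and a: "a \<in> iv (pedges B \<union> pedges T)" "(w, a) \<in> (step E (iv (pedges B \<union> pedges T)))\<^sup>*" "{a, b} \<in> E"
    and a': "a' \<in> iv (pedges B \<union> pedges T)" "(w, a') \<in> (step E (iv (pedges B \<union> pedges T)))\<^sup>*" "{a', b'} \<in> E"
  shows "\<exists>P. chord (pedges B \<union> pedges T) b P b'"
proof -
  let ?I = "iv (pedges B \<union> pedges T)"
  have "(a, a') \<in> (step E ?I)\<^sup>*" using step_rtrancl_sym[OF a(2)] a'(2) by (rule rtrancl_trans)
  from step_rtrancl_path[OF this a(1)] obtain P where P: "distinct P" "P \<noteq> []" "hd P = a" "last P = a'"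
    "set P \<subseteq> ?I" "pedges P \<subseteq> E" by blast
  have "pedges P \<subseteq> ie (pedges B \<union> pedges T)"
  proof
    fix e assume e: "e \<in> pedges P"
    then obtain c d where "e = {c, d}" "c \<in> set P" using pedges_pair[OF e P(1)] by blast
    then show "e \<in> ie (pedges B \<union> pedges T)" using edge_inside[OF cyc, of c d] P(5,6) e by blast
  qed
  moreover have "{b, a} \<in> ie (pedges B \<union> pedges T)" "{a', b'} \<in> ie (pedges B \<union> pedges T)"
    using edge_inside[OF cyc a(1,3)] edge_inside[OF cyc a'(1,3)] by (simp_all add: insert_commute)
  moreover have "pedges (b # P @ [b']) = {{b, a}, {a', b'}} \<union> pedges P"
  proof -
    obtain P1 where P1: "P = a # P1" using P by (cases P) auto
    obtain P2 where P2: "P = P2 @ [a']" using P by (cases P rule: rev_cases) auto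
    have "pedges (b # P @ [b']) = insert {b, a} (pedges (P @ [b']))" using P1 by simp
    also have "pedges (P @ [b']) = insert {a', b'} (pedges P)"
      using pedges_append2[of P2 a' b' "[]"] P2 by simp
    finally show ?thesis by auto
  qed
  ultimately have "chord (pedges B \<union> pedges T) b P b'" unfolding chord_def using P by auto
  then show ?thesis by blast
qed

lemma edge_chord: "{x, y} \<in> ie Z \<Longrightarrow> chord Z x [] y"
  by (simp add: chord_def)

lemma cyc_in_V: "cyc E B T \<Longrightarrow> set B \<union> set T \<subseteq> V"
proof
  fix x assume c: "cyc E B T" and "x \<in> set B \<union> set T"
  then have "x \<in> \<Union> (pedges B \<union> pedges T)" unfolding cyc_Union[OF c] by simp
  then obtain e where e: "e \<in> pedges B \<union> pedges T" "x \<in> e" by blast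
  then have "e \<in> E" using c by (auto simp: cyc_def)
  then show "x \<in> V" using edge[of e] e(2) by auto
qed

text \<open>For arguments in which the division into bottom and top does not matter: by exchanging
  the two paths or reversing the chord, all positions of its ends reduce to
  \<open>theta_bottom\<close> and \<open>theta_cross\<close>. The last inclusion keeps both new
  cycles in any edge set that contains the old cycle and the chord.\<close>

lemma chord_splits:
  assumes cyc: "cyc E B T" and xy: "x \<in> set B \<union> set T" "y \<in> set B \<union> set T" "x \<noteq> y"
    and ch: "chord (pedges B \<union> pedges T) x P y"
  shows "\<exists>B1 T1 B2 T2 Q F. cyc E B1 T1 \<and> cyc E B2 T2 \<and> set Q = set P \<and> F \<noteq> {} \<and> F = pedges (x # P @ [y]) \<and>
    splits (pedges B \<union> pedges T) (pedges B1 \<union> pedges T1) (pedges B2 \<union> pedges T2) Q F \<and>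
    F \<subseteq> pedges B1 \<union> pedges T1 \<and> F \<subseteq> pedges B2 \<union> pedges T2 \<and>
    pedges B1 \<union> pedges T1 \<union> pedges B2 \<union> pedges T2 \<subseteq> pedges B \<union> pedges T \<union> F"
proof -
  have same: ?thesis if B: "B0 = X @ x' # M @ y' # Y" and c: "cyc E B0 T0" and Z: "pedges B0 \<union> pedges T0 = pedges B \<union> pedges T"
    and ch': "chord (pedges B \<union> pedges T) x' P' y'" and F: "pedges (x' # P' @ [y']) = pedges (x # P @ [y])" "set P' = set P"
    for B0 T0 X x' M y' Y P'
  proof -
    note th = theta_bottom[OF c B, of P', unfolded Z, OF ch']
    have p1: "pedges (X @ x' # P' @ y' # Y) = pedges (X @ [x']) \<union> pedges (x' # P' @ [y']) \<union> pedges (y' # Y)"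
      using pedges_append[of X x' "P' @ y' # Y"] pedges_append[of "x' # P'" y' Y] by auto
    have p2: "pedges B0 = pedges (X @ [x']) \<union> pedges (x' # M @ [y']) \<union> pedges (y' # Y)"
      unfolding B using pedges_append[of X x' "M @ y' # Y"] pedges_append[of "x' # M" y' Y] by auto
    show ?thesis
    proof (intro exI conjI)
      show "cyc E (x' # M @ [y']) (x' # P' @ [y'])" by (rule th(1))
      show "cyc E (X @ x' # P' @ y' # Y) (T0)" by (rule th(2))
      show "set P' = set P" by (rule F(2))
      show "pedges (x # P @ [y]) = pedges (x # P @ [y])" by (rule refl)
      show "pedges (x # P @ [y]) \<noteq> {}" by (cases P) auto
      show "splits (pedges B \<union> pedges T) (pedges (x' # M @ [y']) \<union> pedges (x' # P' @ [y'])) (pedges (X @ x' # P' @ y' # Y) \<union> pedges (T0)) P' (pedges (x # P @ [y]))"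
        using th(3) unfolding F(1) .
      show "pedges (x # P @ [y]) \<subseteq> pedges (x' # M @ [y']) \<union> pedges (x' # P' @ [y'])" unfolding F(1)[symmetric] by blast
      show "pedges (x # P @ [y]) \<subseteq> pedges (X @ x' # P' @ y' # Y) \<union> pedges (T0)" unfolding F(1)[symmetric] p1 by blast
      show "pedges (x' # M @ [y']) \<union> pedges (x' # P' @ [y']) \<union> pedges (X @ x' # P' @ y' # Y) \<union> pedges (T0) \<subseteq> pedges B \<union> pedges T \<union> pedges (x # P @ [y])"
        unfolding F(1)[symmetric] Z[symmetric] p1 p2 by blast
    qed
  qed
  have crs: ?thesis if x': "x' \<in> set B" "x' \<notin> set T" and y': "y' \<in> set T" "y' \<notin> set B"
    and ch': "chord (pedges B \<union> pedges T) y' P' x'" and F: "pedges (y' # P' @ [x']) = pedges (x # P @ [y])" "set P' = set P"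
    for x' y' P'
  proof -
    obtain s B' T' t where st: "B = s # B' @ [t]" "T = s # T' @ [t]" "set B \<inter> set T = {s, t}" "s \<noteq> t"
      using cycE[OF cyc] .
    obtain X Y where B: "B = X @ x' # Y" using x'(1) by (meson split_list)
    obtain U W where T: "T = U @ y' # W" using y'(1) by (meson split_list)
    have ne: "X \<noteq> []" "U \<noteq> []" using B T st x' y' by (cases X; cases U; auto)+
    have ne2: "Y \<noteq> []" "W \<noteq> []" using B T st x' y' by (cases Y rule: rev_cases; cases W rule: rev_cases; auto)+
    note th = theta_cross[OF cyc B T ne(1) ne2(1) ne(2) ne2(2) ch']
    have q1: "pedges (U @ y' # P' @ [x']) = pedges (U @ [y']) \<union> pedges (y' # P' @ [x'])"
      using pedges_append[of U y' "P' @ [x']"] by auto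
    have q2: "pedges (y' # P' @ x' # Y) = pedges (y' # P' @ [x']) \<union> pedges (x' # Y)"
      using pedges_append[of "y' # P'" x' Y] by auto
    have q3: "pedges B = pedges (X @ [x']) \<union> pedges (x' # Y)" unfolding B by (rule pedges_append)
    have q4: "pedges T = pedges (U @ [y']) \<union> pedges (y' # W)" unfolding T by (rule pedges_append)
    show ?thesis
    proof (intro exI conjI)
      show "cyc E (X @ [x']) (U @ y' # P' @ [x'])" by (rule th(1))
      show "cyc E (y' # P' @ x' # Y) (y' # W)" by (rule th(2))
      show "set P' = set P" by (rule F(2))
      show "pedges (x # P @ [y]) = pedges (x # P @ [y])" by (rule refl)
      show "pedges (x # P @ [y]) \<noteq> {}" by (cases P) auto
      show "splits (pedges B \<union> pedges T) (pedges (X @ [x']) \<union> pedges (U @ y' # P' @ [x'])) (pedges (y' # P' @ x' # Y) \<union> pedges (y' # W)) P' (pedges (x # P @ [y]))"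
        using th(3) unfolding F(1) .
      show "pedges (x # P @ [y]) \<subseteq> pedges (X @ [x']) \<union> pedges (U @ y' # P' @ [x'])" unfolding F(1)[symmetric] q1 by blast
      show "pedges (x # P @ [y]) \<subseteq> pedges (y' # P' @ x' # Y) \<union> pedges (y' # W)" unfolding F(1)[symmetric] q2 by blast
      show "pedges (X @ [x']) \<union> pedges (U @ y' # P' @ [x']) \<union> pedges (y' # P' @ x' # Y) \<union> pedges (y' # W) \<subseteq> pedges B \<union> pedges T \<union> pedges (x # P @ [y])"
        unfolding F(1)[symmetric] q1 q2 q3 q4 by blast
    qed
  qed
  have rF: "pedges (y # rev P @ [x]) = pedges (x # P @ [y])" using pedges_rev[of "x # P @ [y]"] by simp
  consider "x \<in> set B" "y \<in> set B" | "x \<in> set T" "y \<in> set T" | "x \<in> set B" "x \<notin> set T" "y \<in> set T" "y \<notin> set B"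
    | "y \<in> set B" "y \<notin> set T" "x \<in> set T" "x \<notin> set B" using xy by blast
  then show ?thesis
  proof cases
    case 1
    from distinct_split2[OF 1 xy(3)] show ?thesis
      using same[OF _ cyc refl ch refl refl] same[OF _ cyc refl chord_rev[OF ch] rF set_rev] by blast
  next
    case 2
    from distinct_split2[OF 2 xy(3)] show ?thesis
      using same[OF _ cyc_sym[OF cyc] Un_commute ch refl refl] same[OF _ cyc_sym[OF cyc] Un_commute chord_rev[OF ch] rF set_rev] by blast
  next
    case 3
    then show ?thesis using crs[OF 3 chord_rev[OF ch] rF set_rev] by blast
  next
    case 4
    then show ?thesis using crs[OF 4 ch refl refl] by blast
  qed
qed

end

section \<open>Filling a disc\<close>

lemma pedges_shortcut: "pedges (A @ a # b # C) \<subseteq> insert {a, b} (pedges (A @ a # M @ b # C))"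
  using pedges_append2[of A a b C] pedges_append[of A a "M @ b # C"] pedges_append[of "a # M" b C] by auto

text \<open>Once a path has an inner vertex, each of its edges has an inner end. It shows that a top
  edge of the disc filled second is not yet complete after the first filling.\<close>

lemma pedges_not_ends:
  assumes "distinct (x # M @ [y])" "M \<noteq> []" "e \<in> pedges (x # M @ [y])"
  shows "\<not> e \<subseteq> {x, y}"
proof -
  obtain m M' where M: "M = m # M'" using assms(2) by (cases M) auto
  show ?thesis
  proof (cases "e = {x, m}")
    case True
    then show ?thesis using assms(1) M by auto
  next
    case False
    then have e: "e \<in> pedges (M @ [y])" using assms(3) M by auto
    obtain a b where "a \<noteq> b" "e = {a, b}" "a \<in> set (M @ [y])" "b \<in> set (M @ [y])"
      using pedges_pair[OF e] assms(1) by auto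
    then show ?thesis using assms(1) by auto
  qed
qed

lemma list_ends:
  assumes "hd L = x" "last L = y" "length L \<ge> 2"
  shows "\<exists>P. L = x # P @ [y]"
  using assms by (cases L; cases "tl L" rule: rev_cases) auto

context disc_system
begin

text \<open>
  No two vertices separate a vertex from \<open>K\<close>. Together with \<open>K \<inter> iv Z = {}\<close> this gives every vertex inside
  a cycle three distinct attachments to the cycle; unlike connectivity of the closed disc, it
  passes unchanged to smaller discs.
\<close>

definition attached :: "'a set \<Rightarrow> bool" where
  "attached K \<longleftrightarrow> (\<forall>w\<in>V. \<forall>x\<in>V. \<forall>y\<in>V. w \<noteq> x \<longrightarrow> w \<noteq> y \<longrightarrow> (\<exists>k\<in>K. (w, k) \<in> (step E (- {x, y}))\<^sup>*))"

text \<open>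
  The last but one condition says that nothing new has an edge to a placed vertex that leaves the closed disc.
\<close>

definition fillable :: "'a set \<Rightarrow> 'a set \<Rightarrow> 'a list \<Rightarrow> 'a list \<Rightarrow> bool" where
  "fillable K S B T \<longleftrightarrow> cyc E B T \<and> set B \<subseteq> S \<and> S \<inter> iv (pedges B \<union> pedges T) = {} \<and>
     S \<inter> set T = {hd T, last T} \<and>
     (\<forall>e\<in>E. e \<subseteq> S \<union> iv (pedges B \<union> pedges T) \<union> set T \<longrightarrow> \<not> e \<subseteq> S \<longrightarrow>
        e \<in> ie (pedges B \<union> pedges T) \<union> (pedges B \<union> pedges T)) \<and>
     K \<inter> iv (pedges B \<union> pedges T) = {}"

abbreviation filled :: "'a set \<Rightarrow> 'a list \<Rightarrow> 'a list \<Rightarrow> bool" where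
  "filled S B T \<equiv> (\<forall>A D. stacks E S (A @ B @ D) (S \<union> iv (pedges B \<union> pedges T) \<union> set T) (A @ T @ D))"

lemma fillable_cyc: "fillable K S B T \<Longrightarrow> cyc E B T"
  by (simp add: fillable_def)

lemma finite_ie: "finite (ie Z)"
  using finite_E ie_E by (rule finite_subset[rotated])

text \<open>The inside edge \<open>{a, b}\<close> moves onto the boundary, and every inside edge of
  the new disc was inside the old one.\<close>

lemma shortcut_smaller:
  assumes "cyc E Q T" "Q = L1 @ a # Lm @ b # L3" "{a, b} \<in> ie (pedges Q \<union> pedges T)"
  shows "card (ie (pedges (L1 @ a # b # L3) \<union> pedges T)) < card (ie (pedges Q \<union> pedges T))"
proof -
  note th = theta_bottom[OF assms(1,2) edge_chord[OF assms(3)]]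
  have c: "cyc E (L1 @ a # b # L3) T" using th(2) by simp
  have "ie (pedges (L1 @ a # b # L3) \<union> pedges T) \<subseteq> ie (pedges Q \<union> pedges T)"
    using th(3) by (auto simp: splits_def)
  moreover have "{a, b} \<notin> ie (pedges (L1 @ a # b # L3) \<union> pedges T)"
    using ie_disjoint[OF c] pedges_append2[of L1 a b L3] by blast
  ultimately show ?thesis using assms(3) by (intro psubset_card_mono finite_ie) blast
qed

text \<open>
  Filling the disc \<open>B1, T1\<close> first and \<open>B2, T2\<close> afterwards. The first filling must not place two vertices, not both
  old, that are joined by an edge belonging to the second disc only: \<open>nochord\<close> and \<open>outer\<close>. In the applications
  \<open>nochord\<close> is obtained by choosing the cut such that the second disc contains as few edges as possible.
\<close>

lemma combine:
  assumes fill: "fillable K S B T"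
    and sp: "splits (pedges B \<union> pedges T) (pedges B1 \<union> pedges T1) (pedges B2 \<union> pedges T2) P F"
    and c1: "cyc E B1 T1" and c2: "cyc E B2 T2"
    and B1: "set B1 \<subseteq> S" and T1: "S \<inter> set T1 = {hd T1, last T1}"
    and B2: "set B2 \<subseteq> S \<union> set T1" and T2: "(S \<union> set T1) \<inter> set T2 = {hd T2, last T2}"
    and F: "F \<noteq> {}" "F \<subseteq> pedges T1" "F \<subseteq> pedges B2"
    and PB2: "set P \<subseteq> set B2" and PT1: "set P \<subseteq> set T1"
    and sets: "set T \<union> set P \<subseteq> S \<union> set T1 \<union> set T2" "set T1 \<union> set T2 \<subseteq> S \<union> set T \<union> set P"
    and nochord: "\<And>e. e \<in> ie (pedges B2 \<union> pedges T2) \<Longrightarrow> e \<subseteq> set B2 \<Longrightarrow> e \<subseteq> S"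
    and outer: "\<And>e. e \<in> pedges T \<Longrightarrow> e \<subseteq> S \<or> e \<in> pedges B1 \<union> pedges T1 \<or> (e \<in> pedges B2 \<union> pedges T2 \<and> \<not> e \<subseteq> S \<union> set T1)"
    and IH: "\<And>S' B' T'. fillable K S' B' T' \<Longrightarrow>
      card (ie (pedges B' \<union> pedges T')) < card (ie (pedges B \<union> pedges T)) \<Longrightarrow> filled S' B' T'"
    and lists: "\<And>A D. \<exists>A1 D1. A @ B @ D = A1 @ B1 @ D1 \<and>
       (\<exists>A2 D2. A1 @ T1 @ D1 = A2 @ B2 @ D2 \<and> A2 @ T2 @ D2 = A @ T @ D)"
  shows "filled S B T"
proof -
  let ?Z = "pedges B \<union> pedges T" and ?Z1 = "pedges B1 \<union> pedges T1" and ?Z2 = "pedges B2 \<union> pedges T2"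
  have cyc: "cyc E B T" and BS: "set B \<subseteq> S" and Siv: "S \<inter> iv ?Z = {}" and Kiv: "K \<inter> iv ?Z = {}"
    and H: "\<And>e. e \<in> E \<Longrightarrow> e \<subseteq> S \<union> iv ?Z \<union> set T \<Longrightarrow> \<not> e \<subseteq> S \<Longrightarrow> e \<in> ie ?Z \<union> ?Z"
    using fill unfolding fillable_def by auto
  have iv: "iv ?Z = iv ?Z1 \<union> iv ?Z2 \<union> set P" and ie: "ie ?Z = ie ?Z1 \<union> ie ?Z2 \<union> F"
    and d12: "iv ?Z1 \<inter> iv ?Z2 = {}" using sp by (auto simp: splits_def)
  have i1: "iv ?Z1 \<inter> (set B1 \<union> set T1) = {}" and i2: "iv ?Z2 \<inter> (set B2 \<union> set T2) = {}"
    and i0: "iv ?Z \<inter> (set B \<union> set T) = {}"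
    using iv_disjoint c1 c2 cyc by auto
  have S1: "S \<inter> iv ?Z1 = {}" "S \<inter> iv ?Z2 = {}" "S \<inter> set P = {}" using Siv iv by auto
  have iv20: "iv ?Z2 \<inter> (set B \<union> set T) = {}" "iv ?Z1 \<inter> (set B \<union> set T) = {}" using i0 iv by auto
  have T1iv2: "set T1 \<inter> iv ?Z2 = {}" using sets(2) S1 iv20 i2 PB2 by blast
  have T2iv1: "set T2 \<inter> iv ?Z1 = {}" using sets(2) S1 iv20 i1 PT1 by blast
  have B2iv1: "set B2 \<inter> iv ?Z1 = {}" using B2 S1 i1 by blast
  have FZ: "F \<inter> ie ?Z1 = {}" "F \<inter> ie ?Z2 = {}" using ie_disjoint[OF c1] ie_disjoint[OF c2] F by auto
  have card1: "card (ie ?Z1) < card (ie ?Z)"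
    using F(1) FZ ie by (intro psubset_card_mono finite_ie) auto
  have card2: "card (ie ?Z2) < card (ie ?Z)"
    using F(1) FZ ie by (intro psubset_card_mono finite_ie) auto
  have ends2: "e \<subseteq> iv ?Z2 \<union> set B2 \<union> set T2" if "e \<in> ie ?Z2" for e
    using end_inside[OF c2 that] by blast
  have endsT2: "hd T2 \<in> set B2" "last T2 \<in> set B2"
    by (rule cycE[OF c2], simp)+
  have fill1: "fillable K S B1 T1"
    unfolding fillable_def
  proof (intro conjI ballI impI c1 B1 T1 S1(1))
    show "K \<inter> iv ?Z1 = {}" using Kiv iv by auto
    fix e assume e: "e \<in> E" "e \<subseteq> S \<union> iv ?Z1 \<union> set T1" "\<not> e \<subseteq> S"
    have "e \<subseteq> S \<union> iv ?Z \<union> set T" using e(2) iv sets(2) by blast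
    then have "e \<in> ie ?Z \<union> ?Z" using H e by blast
    then consider "e \<in> ie ?Z1 \<union> F" | "e \<in> ie ?Z2" | "e \<in> pedges B" | "e \<in> pedges T" using ie by blast
    then show "e \<in> ie ?Z1 \<union> ?Z1"
    proof cases
      case 1
      then show ?thesis using F by blast
    next
      \<comment> \<open>Edges inside the second disc could spoil the first filling. If both ends are
        old or placed by it, they lie on \<open>B2\<close>, and \<open>nochord\<close> then makes
        the edge an old one.\<close>
      case 2
      have eST: "e \<subseteq> S \<union> set T1"
      proof
        fix x assume x: "x \<in> e"
        then have "x \<in> iv ?Z2 \<union> set B2 \<union> set T2" using ends2[OF 2] by (rule set_mp[rotated])
        then have "x \<notin> iv ?Z1" using d12 T2iv1 B2iv1 by auto
        then show "x \<in> S \<union> set T1" using e(2) x by auto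
      qed
      have "e \<subseteq> set B2"
      proof
        fix x assume x: "x \<in> e"
        then have x2: "x \<in> iv ?Z2 \<union> set B2 \<union> set T2" using ends2[OF 2] by (rule set_mp[rotated])
        have xST: "x \<in> S \<union> set T1" using eST x by (rule set_mp)
        then have "x \<notin> iv ?Z2" using S1(2) T1iv2 by auto
        moreover have "x \<in> set B2" if "x \<in> set T2"
        proof -
          have "x \<in> {hd T2, last T2}" unfolding T2[symmetric] using that xST by simp
          then show ?thesis using endsT2 by auto
        qed
        ultimately show "x \<in> set B2" using x2 by auto
      qed
      then show ?thesis using nochord[OF 2] e(3) by blast
    next
      case 3
      then show ?thesis using pedges_subset BS e(3) by blast
    next
      case 4
      then have "e \<subseteq> S \<union> set T1" using pedges_subset[OF 4] e(2) iv20 by blast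
      then show ?thesis using outer[OF 4] e(3) by blast
    qed
  qed
  have fill2: "fillable K (S \<union> iv ?Z1 \<union> set T1) B2 T2"
    unfolding fillable_def
  proof (intro conjI ballI impI c2)
    show "set B2 \<subseteq> S \<union> iv ?Z1 \<union> set T1" using B2 by blast
    show "K \<inter> iv ?Z2 = {}" using Kiv iv by auto
    show "(S \<union> iv ?Z1 \<union> set T1) \<inter> iv ?Z2 = {}" using S1 d12 T1iv2 by blast
    show "(S \<union> iv ?Z1 \<union> set T1) \<inter> set T2 = {hd T2, last T2}" using T2 T2iv1 by blast
    fix e assume e: "e \<in> E" "e \<subseteq> S \<union> iv ?Z1 \<union> set T1 \<union> iv ?Z2 \<union> set T2" "\<not> e \<subseteq> S \<union> iv ?Z1 \<union> set T1"
    have "e \<subseteq> S \<union> iv ?Z \<union> set T" using e(2) iv sets(2) by blast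
    then have "e \<in> ie ?Z \<union> ?Z" using H e by blast
    then consider "e \<in> ie ?Z1" | "e \<in> F" | "e \<in> ie ?Z2" | "e \<in> pedges B" | "e \<in> pedges T" using ie by blast
    then show "e \<in> ie ?Z2 \<union> ?Z2"
    proof cases
      case 1
      then have "e \<subseteq> iv ?Z1 \<union> (set B1 \<union> set T1)" using end_inside[OF c1 1] by blast
      then show ?thesis using e(3) B1 by blast
    next
      case 4
      then show ?thesis using pedges_subset BS e(3) by blast
    next
      case 5
      have "e \<notin> pedges B1 \<union> pedges T1" using pedges_subset e(3) B1 by blast
      then show ?thesis using outer[OF 5] e(3) by blast
    qed (use F in auto)
  qed
  have total: "S \<union> iv ?Z1 \<union> set T1 \<union> iv ?Z2 \<union> set T2 = S \<union> iv ?Z \<union> set T"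
    using iv sets by blast
  show ?thesis
  proof (intro allI)
    fix A D
    obtain A1 D1 A2 D2 where l: "A @ B @ D = A1 @ B1 @ D1" "A1 @ T1 @ D1 = A2 @ B2 @ D2" "A2 @ T2 @ D2 = A @ T @ D"
      using lists by blast
    have "stacks E S (A @ B @ D) (S \<union> iv ?Z1 \<union> set T1) (A1 @ T1 @ D1)"
      using IH[OF fill1 card1] unfolding l(1) by blast
    moreover have "stacks E (S \<union> iv ?Z1 \<union> set T1) (A1 @ T1 @ D1) (S \<union> iv ?Z \<union> set T) (A @ T @ D)"
      using IH[OF fill2 card2, rule_format, of A2 D2] unfolding l(2) l(3) total .
    ultimately show "stacks E S (A @ B @ D) (S \<union> iv ?Z \<union> set T) (A @ T @ D)"
      by (blast intro: stacks_trans)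
  qed
qed

text \<open>The induction hypothesis on the number of inside edges, packaged so that each kind of
  cut can be treated in a lemma of its own.\<close>

definition IH :: "'a set \<Rightarrow> 'a list \<Rightarrow> 'a list \<Rightarrow> bool" where
  "IH K B T \<longleftrightarrow> (\<forall>S' B' T'. fillable K S' B' T' \<longrightarrow>
      card (ie (pedges B' \<union> pedges T')) < card (ie (pedges B \<union> pedges T)) \<longrightarrow> filled S' B' T')"

text \<open>An inside edge \<open>{p, q}\<close> at a vertex of a chord redirects the chord to
  \<open>q\<close>. This move, its mirror image and \<open>chord_shortcut\<close> produce the
  competitors in the minimality arguments.\<close>

lemma chord_prefix:
  assumes "chord Z x (P1 @ p # P2) y" "{p, q} \<in> ie Z"
  shows "chord Z x (P1 @ [p]) q"
proof -
  have "pedges (x # (P1 @ [p]) @ [q]) = insert {p, q} (pedges (x # P1 @ [p]))"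
    using pedges_append2[of "x # P1" p q "[]"] by simp
  moreover have "pedges (x # P1 @ [p]) \<subseteq> pedges (x # (P1 @ p # P2) @ [y])"
    using pedges_append[of "x # P1" p "P2 @ [y]"] by auto
  ultimately show ?thesis using assms unfolding chord_def by auto
qed

lemma chord_suffix:
  assumes "chord Z x (P1 @ p # P2) y" "{p, q} \<in> ie Z"
  shows "chord Z q (p # P2) y"
proof -
  have "chord Z y (rev P2 @ p # rev P1) x" using chord_rev[OF assms(1)] by simp
  from chord_rev[OF chord_prefix[OF this assms(2)]] show ?thesis by simp
qed

lemma chord_shortcut:
  assumes "chord Z x (P1 @ a # Pm @ b # P2) y" "{a, b} \<in> ie Z"
  shows "chord Z x (P1 @ a # b # P2) y"
proof -
  have "pedges (x # (P1 @ a # b # P2) @ [y]) \<subseteq> insert {a, b} (pedges (x # (P1 @ a # Pm @ b # P2) @ [y]))"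
    using pedges_shortcut[of "x # P1" a b "P2 @ [y]" Pm] by simp
  then show ?thesis using assms unfolding chord_def by auto
qed

lemma pedges_chord_ne: "pedges (x # P @ [y]) \<noteq> {}"
  by (cases P) auto

lemma distinct_split2_edge:
  assumes "e = {p, q}" "p \<in> set L" "q \<in> set L" "p \<noteq> q"
  shows "\<exists>a b X M Y. e = {a, b} \<and> L = X @ a # M @ b # Y"
  using distinct_split2[OF assms(2-4)] assms(1) by (metis insert_commute)

text \<open>The strip between \<open>B\<close> and the chord is filled first, the rest afterwards
  from the raised bottom \<open>Q\<close>. The chord is chosen such that the upper disc has fewest
  inside edges; an upper inside edge from the chord to \<open>Q\<close> would give a shortcut and
  hence a smaller disc.\<close>

lemma fill_bottom_chord:
  assumes fill: "fillable K S B T" and IHyp: "IH K B T"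
    and xy0: "x0 \<in> set B" "y0 \<in> set B" "x0 \<noteq> y0" and ch0: "chord (pedges B \<union> pedges T) x0 P0 y0"
  shows "filled S B T"
proof -
  let ?Z = "pedges B \<union> pedges T"
  \<comment> \<open>The family ranges over the ends as well, because a shortcut to a vertex of
    \<open>X\<close> or \<open>Y\<close> moves an end of the chord.\<close>
  define fam where "fam Q \<longleftrightarrow> (\<exists>X x M y Y P. B = X @ x # M @ y # Y \<and> chord ?Z x P y \<and> Q = X @ x # P @ y # Y)" for Q
  have cyc: "cyc E B T" using fill by (rule fillable_cyc)
  have BS: "set B \<subseteq> S" and Siv: "S \<inter> iv ?Z = {}" and ST: "S \<inter> set T = {hd T, last T}"
    using fill by (auto simp: fillable_def)
  have "\<exists>Q. fam Q"
    using distinct_split2[OF xy0] ch0 chord_rev[OF ch0] unfolding fam_def by blast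
  then obtain Q where Q: "fam Q" and min: "\<And>Q'. fam Q' \<Longrightarrow> card (ie (pedges Q \<union> pedges T)) \<le> card (ie (pedges Q' \<union> pedges T))"
    using ex_has_least_nat[of fam _ "\<lambda>Q. card (ie (pedges Q \<union> pedges T))"] by blast
  obtain X x M y Y P where B: "B = X @ x # M @ y # Y" and ch: "chord ?Z x P y" and Qd: "Q = X @ x # P @ y # Y"
    using Q unfolding fam_def by blast
  note th = theta_bottom[OF cyc B ch, folded Qd]
  have Piv: "set P \<subseteq> iv ?Z" and dP: "distinct P" using ch by (auto simp: chord_def)
  have PS: "set P \<inter> S = {}" using Piv Siv by blast
  have PT: "set P \<inter> set T = {}" using Piv iv_disjoint[OF cyc] by blast
  have ie2: "ie (pedges Q \<union> pedges T) \<subseteq> ie ?Z" using th(3) by (auto simp: splits_def)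
  \<comment> \<open>Wherever \<open>q\<close> lies on \<open>Q\<close>, skipping the stretch between
    \<open>p\<close> and \<open>q\<close> yields another member of \<open>fam\<close>, with a
    shorter chord or with a new left or right end.\<close>
  have noshort: False if e: "{p, q} \<in> ie (pedges Q \<union> pedges T)" "p \<in> set P" "q \<in> set Q" "p \<noteq> q" for p q
  proof -
    have eZ: "{p, q} \<in> ie ?Z" using e ie2 by blast
    have contra: False if "Q = L1 @ a # Lm @ b # L3" "{p, q} = {a, b}" "fam (L1 @ a # b # L3)" for L1 a Lm b L3
      using shortcut_smaller[OF th(2) that(1)] e(1) min[OF that(3)] that(2) by auto
    obtain P1 P2 where P12: "P = P1 @ p # P2" using e(2) by (meson split_list)
    consider "q \<in> set P" | "q \<in> set (X @ [x])" | "q \<in> set (y # Y)" using e(3) Qd by auto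
    then show False
    proof cases
      case 1
      then obtain a b L M' N where ab: "{p, q} = {a, b}" "P = L @ a # M' @ b # N"
        using distinct_split2_edge[OF refl e(2) _ e(4)] by blast
      have "fam (X @ x # (L @ a # b # N) @ y # Y)"
        using B chord_shortcut[of ?Z x L a M' b N y] ch ab eZ unfolding fam_def by metis
      then show ?thesis using contra[of "X @ x # L" a M' b "N @ y # Y"] ab Qd by simp
    next
      case 2
      then obtain X1 X2 where X12: "X @ [x] = X1 @ q # X2" by (meson split_list)
      have app: "X @ x # R = X1 @ q # X2 @ R" for R using arg_cong[OF X12, of "\<lambda>l. l @ R"] by simp
      have "fam (X1 @ q # (p # P2) @ y # Y)"
        unfolding fam_def using B app[of "M @ y # Y"] chord_suffix[of ?Z x P1 p P2 y q] ch P12 eZ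
        by (intro exI[of _ X1] exI[of _ q] exI[of _ "X2 @ M"] exI[of _ y] exI[of _ Y] exI[of _ "p # P2"]) simp
      then show ?thesis
        using contra[of X1 q "X2 @ P1" p "P2 @ y # Y"] Qd app[of "P @ y # Y"] P12 by (simp add: insert_commute)
    next
      case 3
      then obtain Y1 Y2 where Y12: "y # Y = Y1 @ q # Y2" by (meson split_list)
      have "fam (X @ x # (P1 @ [p]) @ q # Y2)"
        unfolding fam_def using B Y12 chord_prefix[of ?Z x P1 p P2 y q] ch P12 eZ
        by (intro exI[of _ X] exI[of _ x] exI[of _ "M @ Y1"] exI[of _ q] exI[of _ Y2] exI[of _ "P1 @ [p]"]) simp
      then show ?thesis
        using contra[of "X @ x # P1" p "P2 @ Y1" q Y2] Qd P12 Y12 by simp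
    qed
  qed
  show ?thesis
  proof (rule combine[OF fill th(3) th(1,2)])
    show "pedges (x # P @ [y]) \<noteq> {}" by (rule pedges_chord_ne)
    show "pedges (x # P @ [y]) \<subseteq> pedges Q"
      unfolding Qd using pedges_append[of X x "P @ y # Y"] pedges_append[of "x # P" y Y] by auto
    show "set (x # M @ [y]) \<subseteq> S" using BS B by auto
    show "S \<inter> set (x # P @ [y]) = {hd (x # P @ [y]), last (x # P @ [y])}" using BS B PS by auto
    show "set Q \<subseteq> S \<union> set (x # P @ [y])" using BS B Qd by auto
    show "(S \<union> set (x # P @ [y])) \<inter> set T = {hd T, last T}"
    proof -
      have "S \<union> set (x # P @ [y]) = S \<union> set P" using BS B by auto
      then show ?thesis using ST PT by (simp add: Int_Un_distrib2)
    qed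
    show "set P \<subseteq> set Q" "set P \<subseteq> set (x # P @ [y])" using Qd by auto
    show "set T \<union> set P \<subseteq> S \<union> set (x # P @ [y]) \<union> set T" by auto
    show "set (x # P @ [y]) \<union> set T \<subseteq> S \<union> set T \<union> set P" using BS B by auto
    show "e \<subseteq> S" if e: "e \<in> ie (pedges Q \<union> pedges T)" "e \<subseteq> set Q" for e
    proof (rule ccontr)
      assume "\<not> e \<subseteq> S"
      then obtain p where p: "p \<in> e" "p \<notin> S" by blast
      obtain u w where uw: "u \<noteq> w" "e = {u, w}" using edge ie_E e(1) by blast
      then obtain q where q: "e = {p, q}" "p \<noteq> q" using p(1) by auto
      have "p \<in> set P" using p e(2) Qd BS B by auto
      then show False using noshort[of p q] e q by auto
    qed
    show "e \<subseteq> S \<or> e \<in> pedges (x # M @ [y]) \<union> pedges (x # P @ [y]) \<or>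
         (e \<in> pedges Q \<union> pedges T \<and> \<not> e \<subseteq> S \<union> set (x # P @ [y]))" if "e \<in> pedges T" for e
    proof -
      have "e \<subseteq> set T" using that by (rule pedges_subset)
      then have "e \<subseteq> S" if "e \<subseteq> S \<union> set (x # P @ [y])" using that PT BS B by auto
      then show ?thesis using that by blast
    qed
    show "filled S' B' T'" if "fillable K S' B' T'"
      "card (ie (pedges B' \<union> pedges T')) < card (ie ?Z)" for S' B' T'
      using IHyp that unfolding IH_def by blast
    fix A D
    have "A @ B @ D = (A @ X) @ (x # M @ [y]) @ (Y @ D)" using B by simp
    moreover have "(A @ X) @ (x # P @ [y]) @ (Y @ D) = A @ Q @ D" using Qd by simp
    ultimately show "\<exists>A1 D1. A @ B @ D = A1 @ (x # M @ [y]) @ D1 \<and>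
       (\<exists>A2 D2. A1 @ (x # P @ [y]) @ D1 = A2 @ Q @ D2 \<and> A2 @ T @ D2 = A @ T @ D)" by blast
  qed simp
qed

text \<open>The part below the chord is filled first and the lens between the chord and
  \<open>M\<close> second. With its ends fixed, a chord with fewest edges inside the lens has no
  shortcut through the lens.\<close>

lemma fill_top_chord:
  assumes fill: "fillable K S B T" and IHyp: "IH K B T"
    and xy0: "x0 \<in> set T" "y0 \<in> set T" "x0 \<noteq> y0" and ch0: "chord (pedges B \<union> pedges T) x0 P0 y0"
    and nadj: "{x0, y0} \<notin> pedges T"
  shows "filled S B T"
proof -
  let ?Z = "pedges B \<union> pedges T"
  have cyc: "cyc E B T" using fill by (rule fillable_cyc)
  have BS: "set B \<subseteq> S" and Siv: "S \<inter> iv ?Z = {}" and ST: "S \<inter> set T = {hd T, last T}"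
    using fill by (auto simp: fillable_def)
  have dT: "distinct T" using cyc by (simp add: cyc_def)
  obtain X x M y Y P1 where T: "T = X @ x # M @ y # Y" and ch1: "chord ?Z x P1 y" and xy: "{x, y} = {x0, y0}"
    using distinct_split2[OF xy0] ch0 chord_rev[OF ch0] by (metis insert_commute)
  \<comment> \<open>Without an inner vertex, the only top edge of the lens would join two vertices
    that the first filling has already placed.\<close>
  have M: "M \<noteq> []"
  proof
    assume "M = []"
    then have "{x, y} \<in> pedges T" using T pedges_append2[of X x y Y] by auto
    then show False using nadj xy by simp
  qed
  define m where "m P = card (ie (pedges (x # P @ [y]) \<union> pedges (x # M @ [y])))" for P
  obtain P where ch: "chord ?Z x P y" and min: "\<And>P'. chord ?Z x P' y \<Longrightarrow> m P \<le> m P'"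
    using ex_has_least_nat[of "\<lambda>P. chord ?Z x P y" P1 m] ch1 by blast
  have Zc: "pedges T \<union> pedges B = ?Z" by (rule Un_commute)
  note th0 = theta_bottom[OF cyc_sym[OF cyc] T, of P, unfolded Zc, OF ch]
  define Q where "Q = X @ x # P @ y # Y"
  have c1: "cyc E B Q" and c2: "cyc E (x # P @ [y]) (x # M @ [y])"
    using th0(1,2)[THEN cyc_sym] by (simp_all add: Q_def)
  have sp: "splits ?Z (pedges B \<union> pedges Q) (pedges (x # P @ [y]) \<union> pedges (x # M @ [y])) P (pedges (x # P @ [y]))"
    using th0(3) unfolding splits_def Q_def by (simp add: Un_commute Int_commute Un_left_commute)
  have Piv: "set P \<subseteq> iv ?Z" and dP: "distinct P" using ch by (auto simp: chord_def)
  have PS: "set P \<inter> S = {}" using Piv Siv by blast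
  have PT: "set P \<inter> set T = {}" using Piv iv_disjoint[OF cyc] by blast
  have ie2: "ie (pedges (x # P @ [y]) \<union> pedges (x # M @ [y])) \<subseteq> ie ?Z" using sp by (auto simp: splits_def)
  have hdT: "hd T \<in> insert x (set X)" "last T \<in> insert y (set Y)" using T by (cases X; cases Y rule: rev_cases; auto)+
  have MS: "set M \<inter> S = {}" using ST hdT dT T by auto
  show ?thesis
  proof (rule combine[OF fill sp c1 c2])
    show "pedges (x # P @ [y]) \<noteq> {}" by (rule pedges_chord_ne)
    show "pedges (x # P @ [y]) \<subseteq> pedges Q"
      unfolding Q_def using pedges_append[of X x "P @ y # Y"] pedges_append[of "x # P" y Y] by auto
    show "set B \<subseteq> S" by (rule BS)
    have hdQ: "hd Q = hd T" "last Q = last T" unfolding Q_def T by (cases X; cases Y rule: rev_cases; simp)+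
    have "set Q \<subseteq> set P \<union> set T" unfolding Q_def T by auto
    then have "S \<inter> set Q \<subseteq> {hd T, last T}" using ST PS by blast
    moreover have "{hd T, last T} \<subseteq> S \<inter> set Q"
      using ST hdT unfolding Q_def by auto
    ultimately show "S \<inter> set Q = {hd Q, last Q}" unfolding hdQ by blast
    show "set (x # P @ [y]) \<subseteq> S \<union> set Q" unfolding Q_def by auto
    show "(S \<union> set Q) \<inter> set (x # M @ [y]) = {hd (x # M @ [y]), last (x # M @ [y])}"
      using MS PT dT unfolding Q_def T by auto
    show "set P \<subseteq> set (x # P @ [y])" "set P \<subseteq> set Q" unfolding Q_def by auto
    show "set T \<union> set P \<subseteq> S \<union> set Q \<union> set (x # M @ [y])" unfolding Q_def T by auto
    show "set Q \<union> set (x # M @ [y]) \<subseteq> S \<union> set T \<union> set P" unfolding Q_def T by auto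
    show "e \<subseteq> S" if e: "e \<in> ie (pedges (x # P @ [y]) \<union> pedges (x # M @ [y]))" "e \<subseteq> set (x # P @ [y])" for e
    proof -
      have eZ: "e \<in> ie ?Z" using e ie2 by blast
      obtain u w where uw: "u \<noteq> w" "e = {u, w}" using edge ie_E e(1) by blast
      then obtain a b L1 Lm L3 where ab: "e = {a, b}" "x # P @ [y] = L1 @ a # Lm @ b # L3"
        using distinct_split2_edge[of e u w "x # P @ [y]"] e(2) by auto
      have "\<exists>P'. L1 @ a # b # L3 = x # P' @ [y]"
      proof (rule list_ends)
        show "hd (L1 @ a # b # L3) = x" using arg_cong[OF ab(2), of hd] by (cases L1) auto
        show "last (L1 @ a # b # L3) = y" using arg_cong[OF ab(2), of last] by (cases L3 rule: rev_cases) auto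
      qed simp
      then obtain P' where P': "L1 @ a # b # L3 = x # P' @ [y]" by blast
      have "m P' < m P"
        unfolding m_def using shortcut_smaller[OF c2 ab(2)] e(1) ab(1) P' by simp
      moreover have "chord ?Z x P' y"
        unfolding chord_def
      proof (intro conjI)
        have d: "distinct (x # P @ [y])" using c2 by (simp add: cyc_def)
        then have d': "distinct (x # P' @ [y])" using ab(2) unfolding P'[symmetric] by auto
        then show "distinct P'" by simp
        have "set (x # P' @ [y]) \<subseteq> set (x # P @ [y])" unfolding P'[symmetric] ab(2) by auto
        then show "set P' \<subseteq> iv ?Z" using Piv d' by auto
        show "pedges (x # P' @ [y]) \<subseteq> ie ?Z"
          using pedges_shortcut[of L1 a b L3 Lm] ch eZ unfolding P' ab(2)[symmetric] ab(1) chord_def by blast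
      qed
      ultimately show ?thesis using min[of P'] by simp
    qed
    show "e \<subseteq> S \<or> e \<in> pedges B \<union> pedges Q \<or>
         (e \<in> pedges (x # P @ [y]) \<union> pedges (x # M @ [y]) \<and> \<not> e \<subseteq> S \<union> set Q)" if e: "e \<in> pedges T" for e
    proof -
      have "pedges T = pedges (X @ [x]) \<union> pedges (x # M @ [y]) \<union> pedges (y # Y)"
        unfolding T using pedges_append[of X x "M @ y # Y"] pedges_append[of "x # M" y Y] by auto
      then consider "e \<in> pedges (X @ [x]) \<union> pedges (y # Y)" | "e \<in> pedges (x # M @ [y])" using e by blast
      then show ?thesis
      proof cases
        case 1
        then show ?thesis unfolding Q_def using pedges_append[of X x "P @ y # Y"] pedges_append[of "x # P" y Y] by auto
      next
        case 2
        have dxy: "distinct (x # M @ [y])" using dT T by auto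
        have "\<not> e \<subseteq> {x, y}" by (rule pedges_not_ends[OF dxy M 2])
        moreover have "e \<subseteq> {x, y} \<union> set M" using pedges_subset[OF 2] by auto
        moreover have "set M \<inter> (S \<union> set Q) = {}" using MS PT dT unfolding Q_def T by auto
        ultimately have "\<not> e \<subseteq> S \<union> set Q" by blast
        then show ?thesis using 2 by blast
      qed
    qed
    show "filled S' B' T'" if "fillable K S' B' T'"
      "card (ie (pedges B' \<union> pedges T')) < card (ie ?Z)" for S' B' T'
      using IHyp that unfolding IH_def by blast
    fix A D
    have "A @ Q @ D = (A @ X) @ (x # P @ [y]) @ (Y @ D)" unfolding Q_def by simp
    moreover have "(A @ X) @ (x # M @ [y]) @ (Y @ D) = A @ T @ D" unfolding T by simp
    ultimately show "\<exists>A1 D1. A @ B @ D = A1 @ B @ D1 \<and>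
       (\<exists>A2 D2. A1 @ Q @ D1 = A2 @ (x # P @ [y]) @ D2 \<and> A2 @ (x # M @ [y]) @ D2 = A @ T @ D)" by blast
  qed simp
qed

text \<open>
  If \<open>W\<close> had length 1, the top edge from \<open>y\<close> to the right end of the disc would join two vertices of
  the first disc from outside. The mirror image then works unless \<open>T\<close> has a single inner vertex.
\<close>

lemma fill_cross_chord:
  assumes fill: "fillable K S B T" and IHyp: "IH K B T"
    and NB: "\<And>x y P. x \<in> set B \<Longrightarrow> y \<in> set B \<Longrightarrow> x \<noteq> y \<Longrightarrow> \<not> chord (pedges B \<union> pedges T) x P y"
    and NT: "\<And>x y P. x \<in> set T \<Longrightarrow> y \<in> set T \<Longrightarrow> x \<noteq> y \<Longrightarrow> chord (pedges B \<union> pedges T) x P y \<Longrightarrow> {x, y} \<in> pedges T"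
    and T: "T = U @ y # W" and ne: "U \<noteq> []" "W \<noteq> []" and W2: "length W \<ge> 2"
    and x0: "x0 \<in> set B" "x0 \<notin> set T" and ch0: "chord (pedges B \<union> pedges T) y P0 x0"
  shows "filled S B T"
proof -
  let ?Z = "pedges B \<union> pedges T"
  \<comment> \<open>\<open>y\<close> is fixed while \<open>x\<close> may move along
    \<open>B\<close>; nonempty \<open>X\<close> and \<open>Y\<close> keep it off the ends, as
    \<open>theta_cross\<close> requires.\<close>
  define fam where "fam Q \<longleftrightarrow> (\<exists>X x Y P. B = X @ x # Y \<and> X \<noteq> [] \<and> Y \<noteq> [] \<and> chord ?Z y P x \<and> Q = y # P @ x # Y)" for Q
  have cyc: "cyc E B T" using fill by (rule fillable_cyc)
  have BS: "set B \<subseteq> S" and Siv: "S \<inter> iv ?Z = {}" and ST: "S \<inter> set T = {hd T, last T}"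
    using fill by (auto simp: fillable_def)
  obtain s B' T' t where st: "B = s # B' @ [t]" "T = s # T' @ [t]" "set B \<inter> set T = {s, t}" "s \<noteq> t"
    using cycE[OF cyc] .
  have dT: "distinct T" and dB: "distinct B" using cyc by (simp_all add: cyc_def)
  have ex: "\<exists>Q. fam Q"
  proof -
    obtain X Y where XY: "B = X @ x0 # Y" using x0(1) by (meson split_list)
    have "X \<noteq> []" using XY st x0 by (cases X) auto
    moreover have "Y \<noteq> []" using XY st x0 by (cases Y rule: rev_cases) auto
    ultimately show ?thesis unfolding fam_def using XY ch0 by blast
  qed
  then obtain Q where Q: "fam Q"
    and min: "\<And>Q'. fam Q' \<Longrightarrow> card (ie (pedges Q \<union> pedges (y # W))) \<le> card (ie (pedges Q' \<union> pedges (y # W)))"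
    using ex_has_least_nat[of fam _ "\<lambda>Q. card (ie (pedges Q \<union> pedges (y # W)))"] by blast
  obtain X x Y P where B: "B = X @ x # Y" and neB: "X \<noteq> []" "Y \<noteq> []" and ch: "chord ?Z y P x"
    and Qd: "Q = y # P @ x # Y" using Q unfolding fam_def by blast
  note th = theta_cross[OF cyc B T neB ne ch, folded Qd]
  have Piv: "set P \<subseteq> iv ?Z" and dP: "distinct P" using ch by (auto simp: chord_def)
  have PS: "set P \<inter> S = {}" using Piv Siv by blast
  have PT: "set P \<inter> set T = {}" using Piv iv_disjoint[OF cyc] by blast
  have ie2: "ie (pedges Q \<union> pedges (y # W)) \<subseteq> ie ?Z" using th(3) by (auto simp: splits_def)
  have yT: "y \<in> set T" using T by simp
  obtain U1 where U1: "U = s # U1" using st(2) T ne by (cases U) auto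
  obtain W1 where W1: "W = W1 @ [t]" using st(2) T ne by (cases W rule: rev_cases) auto
  \<comment> \<open>By \<open>W2\<close> the right part of the top has an inner vertex, so each of
    its edges has an end that the first filling does not place.\<close>
  have W1ne: "W1 \<noteq> []" using W1 W2 by auto
  have tB: "t \<in> set B" "t \<in> set T" "s \<in> set B" using st by auto
  obtain X1 where X1: "X = s # X1" using st(1) B neB by (cases X) auto
  obtain Y1 where Y1: "Y = Y1 @ [t]" using st(1) B neB by (cases Y rule: rev_cases) auto
  have xT: "x \<notin> set T" using st(3) dB B X1 Y1 by auto
  have yS: "y \<notin> S" using ST st(2) dT T U1 W1 by auto
  have tW: "distinct (y # W1 @ [t])" using dT T W1 by auto
  have noshort: False
    if e: "{p, q} \<in> ie (pedges Q \<union> pedges (y # W))" "p \<in> set (y # P)" "q \<in> set Q" "p \<noteq> q" for p q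
  proof -
    have eZ: "{p, q} \<in> ie ?Z" using e ie2 by blast
    have contra: False if "Q = L1 @ a # Lm @ b # L3" "{p, q} = {a, b}" "fam (L1 @ a # b # L3)" for L1 a Lm b L3
      using shortcut_smaller[OF th(2) that(1)] e(1) min[OF that(3)] that(2) by auto
    obtain P1 P2 where P12: "y # P = P1 @ p # P2" using e(2) by (meson split_list)
    consider "q \<in> set (y # P)" | "q \<in> set (x # Y)" using e(3) Qd by auto
    then show False
    proof cases
      case 1
      then obtain a b L M' N where ab: "{p, q} = {a, b}" "y # P = L @ a # M' @ b # N"
        using distinct_split2_edge[OF refl e(2) _ e(4)] by blast
      have cheZ: "{a, b} \<in> ie ?Z" using eZ ab by simp
      have "\<exists>P'. L @ a # b # N = y # P' \<and> chord ?Z y P' x"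
      proof (cases L)
        case Nil
        then have yab: "y = a" "P = M' @ b # N" using ab by auto
        have "chord ?Z y (b # N) x" using chord_suffix[of ?Z y M' b N x y] ch cheZ yab by (simp add: insert_commute)
        then show ?thesis using Nil yab by auto
      next
        case (Cons c L')
        then have "y = c" "P = L' @ a # M' @ b # N" using ab by auto
        then show ?thesis using chord_shortcut[of ?Z y L' a M' b N x] ch cheZ Cons by auto
      qed
      then obtain P' where P': "L @ a # b # N = y # P'" "chord ?Z y P' x" by blast
      have f1: "fam (y # P' @ x # Y)" unfolding fam_def using B neB P' by blast
      have f2: "L @ a # b # (N @ x # Y) = y # P' @ x # Y" using arg_cong[OF P'(1), of "\<lambda>l. l @ x # Y"] by simp
      have f3: "Q = L @ a # M' @ b # (N @ x # Y)" using arg_cong[OF ab(2), of "\<lambda>l. l @ x # Y"] Qd by simp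
      show ?thesis by (rule contra[OF f3 ab(1)]) (simp only: f2 f1)
    next
      case 2
      then obtain Ya Yb where Yab: "x # Y = Ya @ q # Yb" by (meson split_list)
      have chq: "\<exists>P'. P1 @ p # q # Yb = y # P' @ q # Yb \<and> chord ?Z y P' q"
      proof (cases P1)
        case Nil
        then have "y = p" using P12 by auto
        then show ?thesis using edge_chord[OF eZ] Nil by (intro exI[of _ "[]"]) auto
      next
        case (Cons c P1')
        then have "y = c" "P = P1' @ p # P2" using P12 by auto
        then show ?thesis using chord_prefix[of ?Z y P1' p P2 x q] ch eZ Cons by (intro exI[of _ "P1' @ [p]"]) auto
      qed
      show False
      proof (cases Yb)
        \<comment> \<open>A shortcut to the right end \<open>t\<close> leaves the family, so it is
          refuted directly: from \<open>y\<close> it would be a chord between top vertices, hence by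
          \<open>NT\<close> an edge of \<open>T\<close> and not inside; from a vertex of
          \<open>P\<close> it would give a chord from \<open>t\<close> to \<open>x\<close>, against
          \<open>NB\<close>.\<close>
        case Nil
        then have qt: "q = t" using Yab Y1 by (metis last_ConsR last_snoc list.discI append_is_Nil_conv)
        have qx: "q \<noteq> x" using qt xT tB by auto
        show ?thesis
        proof (cases "p = y")
          case True
          have "{y, t} \<in> ie ?Z" using eZ True qt by simp
          then have "{y, t} \<in> pedges T" using NT[OF yT tB(2) _ edge_chord] tW by auto
          then have "{y, t} \<in> ?Z" by simp
          then show ?thesis using ie_disjoint[OF cyc] \<open>{y, t} \<in> ie ?Z\<close> by blast
        next
          case False
          then obtain P1' where "P = P1' @ p # P2" using P12 by (cases P1) auto
          then have "chord ?Z q (p # P2) x" using chord_suffix[of ?Z y P1' p P2 x q] ch eZ by simp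
          then show ?thesis using NB[of q x] qt tB B qx by auto
        qed
      next
        case (Cons z Yb')
        have "X @ x # Y = (X @ Ya) @ q # Yb" using Yab by simp
        then have "fam (P1 @ p # q # Yb)" using chq B neB Cons unfolding fam_def by (metis append_is_Nil_conv list.discI)
        moreover have "Q = P1 @ p # (P2 @ Ya) @ q # Yb" using Qd arg_cong[OF P12, of "\<lambda>l. l @ x # Y"] Yab by simp
        ultimately show ?thesis using contra[of P1 p "P2 @ Ya" q Yb] by simp
      qed
    qed
  qed
  have hl: "hd T = s" "last T = t" using st by auto
  show ?thesis
  proof (rule combine[OF fill th(3) th(1,2)])
    show "pedges (y # P @ [x]) \<noteq> {}" by (rule pedges_chord_ne)
    show "pedges (y # P @ [x]) \<subseteq> pedges (U @ y # P @ [x])"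
      using pedges_append[of U y "P @ [x]"] by auto
    show "pedges (y # P @ [x]) \<subseteq> pedges Q"
      unfolding Qd using pedges_append[of "y # P" x Y] by auto
    show "set (X @ [x]) \<subseteq> S" using BS B by auto
    show "S \<inter> set (U @ y # P @ [x]) = {hd (U @ y # P @ [x]), last (U @ y # P @ [x])}"
    proof -
      have "S \<inter> set U \<subseteq> {s}" using ST hl dT T W1 by auto
      then show ?thesis using PS BS B yS U1 tB(3) by auto
    qed
    show "set Q \<subseteq> S \<union> set (U @ y # P @ [x])" using BS B Qd by auto
    have "S \<inter> set W \<subseteq> {t}" using ST hl dT T U1 by auto
    then show "(S \<union> set (U @ y # P @ [x])) \<inter> set (y # W) = {hd (y # W), last (y # W)}"
      using PT xT dT tB BS unfolding T W1 by auto
    show "set P \<subseteq> set Q" "set P \<subseteq> set (U @ y # P @ [x])" using Qd by auto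
    show "set T \<union> set P \<subseteq> S \<union> set (U @ y # P @ [x]) \<union> set (y # W)" using T by auto
    show "set (U @ y # P @ [x]) \<union> set (y # W) \<subseteq> S \<union> set T \<union> set P" using BS B T by auto
    show "e \<subseteq> S" if e: "e \<in> ie (pedges Q \<union> pedges (y # W))" "e \<subseteq> set Q" for e
    proof (rule ccontr)
      assume "\<not> e \<subseteq> S"
      then obtain p where p: "p \<in> e" "p \<notin> S" by blast
      obtain u w where uw: "u \<noteq> w" "e = {u, w}" using edge ie_E e(1) by blast
      then obtain q where q: "e = {p, q}" "p \<noteq> q" using p(1) by auto
      have "p \<in> set (y # P)" using p e(2) Qd BS B by auto
      then show False using noshort[of p q] e q by auto
    qed
    show "e \<subseteq> S \<or> e \<in> pedges (X @ [x]) \<union> pedges (U @ y # P @ [x]) \<or>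
         (e \<in> pedges Q \<union> pedges (y # W) \<and> \<not> e \<subseteq> S \<union> set (U @ y # P @ [x]))" if e: "e \<in> pedges T" for e
    proof -
      have "pedges T = pedges (U @ [y]) \<union> pedges (y # W)" unfolding T by (rule pedges_append)
      then consider "e \<in> pedges (U @ [y])" | "e \<in> pedges (y # W)" using e by blast
      then show ?thesis
      proof cases
        case 1
        then show ?thesis using pedges_append[of U y "P @ [x]"] by auto
      next
        case 2
        have "\<not> e \<subseteq> {y, t}" using pedges_not_ends[OF tW W1ne] 2 W1 by simp
        moreover have "e \<subseteq> {y, t} \<union> set W1" using pedges_subset[OF 2] W1 by auto
        moreover have "set W1 \<inter> (S \<union> set (U @ y # P @ [x])) = {}"
        proof -
          have w: "set W1 \<subseteq> set T" "s \<notin> set W1" "t \<notin> set W1" "set W1 \<inter> set U = {}" "y \<notin> set W1"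
            using dT T U1 W1 by auto
          have "set W1 \<inter> S \<subseteq> {s, t}" unfolding ST[unfolded hl, symmetric] using w(1) by auto
          then have "set W1 \<inter> S = {}" using w(2,3) by auto
          moreover have "set W1 \<inter> set P = {}" using w(1) PT by auto
          moreover have "x \<notin> set W1" using w(1) xT by auto
          ultimately show ?thesis using w(4,5) by (simp add: Int_Un_distrib)
        qed
        ultimately show ?thesis using 2 by blast
      qed
    qed
    show "filled S' B' T'" if "fillable K S' B' T'"
      "card (ie (pedges B' \<union> pedges T')) < card (ie ?Z)" for S' B' T'
      using IHyp that unfolding IH_def by blast
    fix A D
    have "A @ B @ D = A @ (X @ [x]) @ (Y @ D)" using B by simp
    moreover have "A @ (U @ y # P @ [x]) @ (Y @ D) = (A @ U) @ Q @ D" using Qd by simp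
    moreover have "(A @ U) @ (y # W) @ D = A @ T @ D" using T by simp
    ultimately show "\<exists>A1 D1. A @ B @ D = A1 @ (X @ [x]) @ D1 \<and>
       (\<exists>A2 D2. A1 @ (U @ y # P @ [x]) @ D1 = A2 @ Q @ D2 \<and> A2 @ (y # W) @ D2 = A @ T @ D)" by blast
  qed
qed

lemma fillable_rev: "fillable K S (rev B) (rev T) \<longleftrightarrow> fillable K S B T"
proof -
  have "fillable K S (rev B) (rev T)" if "fillable K S B T" for B T
    using that cyc_rev[of E B T] unfolding fillable_def by (auto simp: hd_rev last_rev)
  from this[of B T] this[of "rev B" "rev T"] show ?thesis by auto
qed

lemma filled_rev: "filled S (rev B) (rev T) \<Longrightarrow> filled S B T"
proof (intro allI)
  fix A D
  assume "filled S (rev B) (rev T)"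
  then have "stacks E S (rev D @ rev B @ rev A) (S \<union> iv (pedges (rev B) \<union> pedges (rev T)) \<union> set (rev T)) (rev D @ rev T @ rev A)"
    by blast
  from stacks_rev[OF this] show "stacks E S (A @ B @ D) (S \<union> iv (pedges B \<union> pedges T) \<union> set T) (A @ T @ D)"
    by simp
qed

lemma IH_rev: "IH K B T \<Longrightarrow> IH K (rev B) (rev T)"
  unfolding IH_def by simp

text \<open>The top vertices are placed from left to right. The first one hides the inner bottom
  vertices and may be adjacent to any of them. A later one exists only if there are no inside edges,
  and its placed neighbours are its predecessor and possibly the right end.\<close>

lemma fill_empty:
  assumes fill: "fillable K S B T" and iv0: "iv (pedges B \<union> pedges T) = {}"
    and ie0: "ie (pedges B \<union> pedges T) = {} \<or> length T \<le> 3"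
  shows "filled S B T"
proof -
  let ?Z = "pedges B \<union> pedges T"
  have cyc: "cyc E B T" using fill by (rule fillable_cyc)
  have BS: "set B \<subseteq> S" and ST: "S \<inter> set T = {hd T, last T}"
    and H: "\<And>e. e \<in> E \<Longrightarrow> e \<subseteq> S \<union> set T \<Longrightarrow> \<not> e \<subseteq> S \<Longrightarrow> e \<in> ie ?Z \<union> ?Z"
    using fill iv0 by (auto simp: fillable_def)
  obtain s B' T' t where st: "B = s # B' @ [t]" "T = s # T' @ [t]" "set B \<inter> set T = {s, t}" "s \<noteq> t"
    using cycE[OF cyc] .
  have dT: "distinct T" and pTE: "pedges T \<subseteq> E" using cyc by (simp_all add: cyc_def)
  have hl: "hd T = s" "last T = t" using st by auto
  have TS: "set T' \<inter> S = {}" using ST dT st hl by auto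
  show ?thesis
  proof (intro allI)
    fix A D
    have "stacks E S (A @ B @ D) (S \<union> set us) (A @ s # us @ t # D)" if "T' = us @ vs" for us vs
      using that
    proof (induction us arbitrary: vs rule: rev_induct)
      case Nil
      \<comment> \<open>With no top vertex placed, the inner bottom vertices are merely forgotten;
        this is final when the top is a single edge.\<close>
      have "stacks E S (A @ B @ D) S ((A @ [s]) @ B' @ t # D)" using st(1) stacks_refl[of E S] by simp
      from stacks_drop[OF this] show ?case by simp
    next
      case (snoc u us)
      have prev: "stacks E S (A @ B @ D) (S \<union> set us) (A @ s # us @ t # D)" using snoc by simp
      have uT: "u \<in> set T'" "u \<notin> S" using snoc.prems TS by auto
      have uB: "u \<notin> set B" using uT BS by blast
      have uus: "u \<notin> set us" using dT st snoc.prems by auto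
      have nS: "u \<notin> S \<union> set us" using uT uus by auto
      define z where "z = last (s # us)"
      have Tz: "T = butlast (s # us) @ z # u # vs @ [t]"
        unfolding z_def st(2) snoc.prems by (metis append.assoc append_Cons append_Nil append_butlast_last_id list.distinct(1))
      have zu: "{u, z} \<in> E" using pTE pedges_append2[of "butlast (s # us)" z u "vs @ [t]"] Tz by (auto simp: insert_commute)
      have zS: "z \<in> S \<union> set us" unfolding z_def using BS st by (cases us rule: rev_cases) auto
      have ne: "nbrs E (S \<union> set us) u \<noteq> {}" using zu zS by (auto simp: nbrs_def)
      have nb: "{u, w} \<in> ie ?Z \<union> ?Z" if "w \<in> nbrs E (S \<union> set us) u" for w
        using that H[of "{u, w}"] uT st snoc.prems by (auto simp: nbrs_def)
      show ?case
      proof (cases us)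
        case Nil
        \<comment> \<open>The first vertex starts from the full bottom and not from the shortened
          one, because it may have neighbours in \<open>B'\<close>.\<close>
        have "nbrs E S u \<subseteq> set B"
        proof
          fix w assume w: "w \<in> nbrs E S u"
          then have wS: "w \<in> S" by (simp add: nbrs_def)
          have "{u, w} \<in> ie ?Z \<union> ?Z" using nb w Nil by simp
          then have "w \<in> set B \<union> set T"
          proof
            assume "{u, w} \<in> ie ?Z"
            from end_inside[OF cyc this, of w] iv0 show ?thesis by auto
          next
            assume "{u, w} \<in> ?Z"
            then show ?thesis using pedges_subset by blast
          qed
          then show "w \<in> set B" using wS ST hl st(3) by auto
        qed
        then have sub: "nbrs E S u \<subseteq> set (take 1 (rev (A @ [s]))) \<union> set B' \<union> set (take 1 (t # D))"
          using st(1) by auto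
        have "stacks E S (A @ B @ D) S ((A @ [s]) @ B' @ t # D)" using st(1) stacks_refl[of E S] by simp
        from stacks_add[OF this _ _ sub] show ?thesis using nS ne Nil by simp
      next
        case (Cons u0 us0)
        then have ie00: "ie ?Z = {}" using ie0 st(2) snoc.prems by auto
        have "nbrs E (S \<union> set us) u \<subseteq> {z, t}"
        proof
          fix w assume w: "w \<in> nbrs E (S \<union> set us) u"
          then have wS: "w \<in> S \<union> set us" by (simp add: nbrs_def)
          have "{u, w} \<in> pedges T" using nb[OF w] ie00 uB pedges_subset by blast
          also have "pedges T = insert {z, u} (pedges (butlast (s # us) @ [z]) \<union> pedges (u # vs @ [t]))"
            unfolding Tz by (rule pedges_append2)
          also have "butlast (s # us) @ [z] = s # us" unfolding z_def by simp
          finally consider "{u, w} = {z, u}" | "{u, w} \<in> pedges (s # us)" | "{u, w} \<in> pedges (u # vs @ [t])" by blast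
          then show "w \<in> {z, t}"
          proof cases
            case 1
            then show ?thesis by (auto simp: doubleton_eq_iff)
          next
            case 2
            then show ?thesis using pedges_subset[OF 2] uus uT BS st by auto
          next
            case 3
            then have "w \<in> set (u # vs @ [t])" using pedges_subset by blast
            moreover have "w \<noteq> u" using wS nS by auto
            moreover have "set vs \<inter> (S \<union> set us) = {}" using TS dT st(2) snoc.prems by auto
            ultimately show ?thesis using wS by auto
          qed
        qed
        moreover have "z \<in> set (take 1 (rev (A @ s # us)))"
          unfolding z_def by (cases us rule: rev_cases) auto
        ultimately have sub: "nbrs E (S \<union> set us) u \<subseteq> set (take 1 (rev (A @ s # us))) \<union> set [] \<union> set (take 1 (t # D))"
          by auto
        have "stacks E S (A @ B @ D) (S \<union> set us) ((A @ s # us) @ [] @ t # D)" using prev by simp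
        from stacks_add[OF this nS ne sub] show ?thesis by simp
      qed
    qed
    from this[of T' "[]"] have "stacks E S (A @ B @ D) (S \<union> set T') (A @ T @ D)" using st(2) by simp
    moreover have "S \<union> set T' = S \<union> iv ?Z \<union> set T" using iv0 ST hl st(2) by auto
    ultimately show "stacks E S (A @ B @ D) (S \<union> iv ?Z \<union> set T) (A @ T @ D)" by simp
  qed
qed

text \<open>\<open>attached\<close> is applied three times: avoiding an arbitrary cycle vertex, then
  the exit \<open>b1\<close>, then \<open>b1\<close> and \<open>b2\<close>. The three exits leave
  the same component of the inside, so chords join them pairwise.\<close>

lemma three_chords:
  assumes cyc: "cyc E B T" and K: "K \<inter> iv (pedges B \<union> pedges T) = {}" and att: "attached K"
    and w: "w \<in> iv (pedges B \<union> pedges T)"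
  shows "\<exists>a b c. distinct [a, b, c] \<and> {a, b, c} \<subseteq> set B \<union> set T \<and>
     (\<exists>P. chord (pedges B \<union> pedges T) a P b) \<and> (\<exists>P. chord (pedges B \<union> pedges T) a P c) \<and>
     (\<exists>P. chord (pedges B \<union> pedges T) b P c)"
proof -
  let ?I = "iv (pedges B \<union> pedges T)"
  have ex: "\<exists>a b. (w, a) \<in> (step E ?I)\<^sup>* \<and> a \<in> ?I \<and> {a, b} \<in> E \<and> b \<in> set B \<union> set T \<and> b \<notin> {x, y}"
    if xy: "x \<notin> ?I" "y \<notin> ?I" "x \<in> V" "y \<in> V" for x y
  proof -
    have "w \<noteq> x" "w \<noteq> y" "w \<in> V" using xy w subsetD[OF iv_V] by blast+
    then obtain k where k: "k \<in> K" "(w, k) \<in> (step E (- {x, y}))\<^sup>*" 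
      using att[unfolded attached_def, rule_format, of w x y] xy(3,4) by blast
    have "k \<notin> ?I" using k K by blast
    from exit_inside[OF cyc w k(2) this] show ?thesis .
  qed
  obtain s where s: "s \<in> set B" using cycE[OF cyc] by (metis list.set_intros(1))
  have J: "z \<notin> ?I" if "z \<in> set B \<union> set T" for z using iv_disjoint[OF cyc] that by blast
  have sI: "s \<notin> ?I" using J s by blast
  have JV: "z \<in> V" if "z \<in> set B \<union> set T" for z using cyc_in_V[OF cyc] that by blast
  have sV: "s \<in> V" using JV s by blast
  obtain a1 b1 where 1: "(w, a1) \<in> (step E ?I)\<^sup>*" "a1 \<in> ?I" "{a1, b1} \<in> E" "b1 \<in> set B \<union> set T"
    using ex[OF sI sI sV sV] by blast
  obtain a2 b2 where 2: "(w, a2) \<in> (step E ?I)\<^sup>*" "a2 \<in> ?I" "{a2, b2} \<in> E" "b2 \<in> set B \<union> set T" "b2 \<noteq> b1"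
    using ex[OF J[OF 1(4)] J[OF 1(4)] JV[OF 1(4)] JV[OF 1(4)]] by blast
  obtain a3 b3 where 3: "(w, a3) \<in> (step E ?I)\<^sup>*" "a3 \<in> ?I" "{a3, b3} \<in> E" "b3 \<in> set B \<union> set T" "b3 \<noteq> b1" "b3 \<noteq> b2"
    using ex[OF J[OF 1(4)] J[OF 2(4)] JV[OF 1(4)] JV[OF 2(4)]] by blast
  show ?thesis
    using chord_from_exits[OF cyc 1(2,1,3) 2(2,1,3)] chord_from_exits[OF cyc 1(2,1,3) 3(2,1,3)]
      chord_from_exits[OF cyc 2(2,1,3) 3(2,1,3)] 1(4) 2(4,5) 3(4-6)
    by (intro exI[of _ b1] exI[of _ b2] exI[of _ b3]) auto
qed

text \<open>A path contains no triangle, since its first vertex has only one neighbour on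
  it.\<close>

lemma three_on_path:
  assumes "distinct T" "a \<in> set T" "b \<in> set T" "c \<in> set T" "distinct [a, b, c]"
  shows "{a, b} \<notin> pedges T \<or> {a, c} \<notin> pedges T \<or> {b, c} \<notin> pedges T"
  using assms
proof (induction T rule: pedges.induct)
  case (1 x y L)
  have *: "z = y" if "{x, z} \<in> pedges (x # y # L)" "z \<noteq> x" for z
  proof -
    have "{x, z} \<notin> pedges (y # L)" using 1(2) pedges_subset[of "{x, z}" "y # L"] by auto
    then have "{x, z} = {x, y}" using that by simp
    then show ?thesis using that by (auto simp: doubleton_eq_iff)
  qed
  have d: "a \<noteq> b" "a \<noteq> c" "b \<noteq> c" using 1(6) by auto
  show ?case
  proof (rule ccontr)
    assume "\<not> ?case"
    then have h: "{a, b} \<in> pedges (x # y # L)" "{a, c} \<in> pedges (x # y # L)" "{b, c} \<in> pedges (x # y # L)"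
      by auto
    consider "x = a" | "x = b" | "x = c" | "x \<noteq> a" "x \<noteq> b" "x \<noteq> c" by blast
    then show False
    proof cases
      case 1
      then show False using *[of b] *[of c] h(1,2) d by simp
    next
      case 2
      then show False using *[of a] *[of c] h(1,3) d by (simp add: insert_commute)
    next
      case 3
      then show False using *[of a] *[of b] h(2,3) d by (simp add: insert_commute)
    next
      case 4
      then have "{a, b} \<noteq> {x, y}" "{a, c} \<noteq> {x, y}" "{b, c} \<noteq> {x, y}" by (auto simp: doubleton_eq_iff)
      then have "{a, b} \<in> pedges (y # L)" "{a, c} \<in> pedges (y # L)" "{b, c} \<in> pedges (y # L)"
        using h by simp_all
      moreover have "a \<in> set (y # L)" "b \<in> set (y # L)" "c \<in> set (y # L)" "distinct (y # L)"
        using 4 "1.prems" by auto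
      ultimately show False using "1.IH" "1.prems"(5) by blast
    qed
  qed
qed auto

text \<open>Induction on the number of inside edges. The disc is cut along a chord between bottom
  vertices, a chord between nonadjacent top vertices, or a crossing chord if the top has at least
  two inner vertices. Without any of these there are no vertices inside.\<close>

theorem fillable_filled:
  assumes att: "attached K" and fill: "fillable K S B T"
  shows "filled S B T"
  using fill
proof (induction "card (ie (pedges B \<union> pedges T))" arbitrary: S B T rule: less_induct)
  case less
  let ?Z = "pedges B \<union> pedges T"
  have IHyp: "IH K B T" unfolding IH_def using less.hyps by blast
  have cyc: "cyc E B T" using less.prems by (rule fillable_cyc)
  have Kiv: "K \<inter> iv ?Z = {}" using less.prems by (simp add: fillable_def)
  obtain s B' T' t where st: "B = s # B' @ [t]" "T = s # T' @ [t]" "set B \<inter> set T = {s, t}" "s \<noteq> t"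
    using cycE[OF cyc] .
  have dT: "distinct T" using cyc by (simp add: cyc_def)
  show ?case
  proof (cases "\<exists>x\<in>set B. \<exists>y\<in>set B. \<exists>P. x \<noteq> y \<and> chord ?Z x P y")
    case True
    then show ?thesis using fill_bottom_chord[OF less.prems IHyp] by blast
  next
    case NB: False
    show ?thesis
    proof (cases "\<exists>x\<in>set T. \<exists>y\<in>set T. \<exists>P. x \<noteq> y \<and> chord ?Z x P y \<and> {x, y} \<notin> pedges T")
      case True
      then show ?thesis using fill_top_chord[OF less.prems IHyp] by blast
    next
      case NT: False
      show ?thesis
      proof (cases "length T \<ge> 4 \<and> (\<exists>y\<in>set T - set B. \<exists>x\<in>set B - set T. \<exists>P. chord ?Z y P x)")
        case True
        then obtain y x P where yx: "y \<in> set T" "y \<notin> set B" "x \<in> set B" "x \<notin> set T" "chord ?Z y P x" by blast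
        obtain U W where T: "T = U @ y # W" using yx(1) by (meson split_list)
        have ne: "U \<noteq> []" "W \<noteq> []" using T st yx by (cases U; cases W rule: rev_cases; auto)+
        show ?thesis
        proof (cases "length W \<ge> 2")
          case True
          show ?thesis by (rule fill_cross_chord[OF less.prems IHyp _ _ T ne True yx(3,4,5)]) (use NB NT in blast)+
        next
          case False
          \<comment> \<open>\<open>T\<close> has at least four vertices, so if its right part is too
            short, the right part of the mirror image is long enough.\<close>
          then have U2: "length U \<ge> 2" using \<open>length T \<ge> 4 \<and> _\<close> T by auto
          have T': "rev T = rev W @ y # rev U" using T by simp
          have "filled S (rev B) (rev T)"
          proof (rule fill_cross_chord[OF _ IH_rev[OF IHyp] _ _ T'])
            show "fillable K S (rev B) (rev T)" using less.prems by (simp add: fillable_rev)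
            show "chord (pedges (rev B) \<union> pedges (rev T)) y P x" using yx by simp
            show "\<not> chord (pedges (rev B) \<union> pedges (rev T)) a Q b"
              if "a \<in> set (rev B)" "b \<in> set (rev B)" "a \<noteq> b" for a b Q
              using NB that unfolding pedges_rev set_rev by blast
            show "{a, b} \<in> pedges (rev T)"
              if "a \<in> set (rev T)" "b \<in> set (rev T)" "a \<noteq> b" "chord (pedges (rev B) \<union> pedges (rev T)) a Q b" for a b Q
              using NT that unfolding pedges_rev set_rev by blast
          qed (use ne U2 yx in auto)
          then show ?thesis by (rule filled_rev)
        qed
      next
        case NC: False
        have pair: "a \<in> set T - set B \<and> b \<in> set B - set T \<or> b \<in> set T - set B \<and> a \<in> set B - set T \<or> {a, b} \<in> pedges T"
          if "chord ?Z a P b" "a \<noteq> b" "a \<in> set B \<union> set T" "b \<in> set B \<union> set T" for a b P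
          using that NB NT by blast
        have cr: "\<not> (4 \<le> length T \<and> a \<in> set T - set B \<and> b \<in> set B - set T)"
          if "chord ?Z a P b \<or> chord ?Z b P a" for a b P
          using that NC chord_rev by blast
        \<comment> \<open>An inside vertex has three attachments, pairwise joined by chords, no two
          of them on \<open>B\<close>. If one were off \<open>T\<close>, the other two would be
          inner top vertices, so \<open>T\<close> would be long and a crossing chord would exist. So
          all three lie on \<open>T\<close> and are pairwise adjacent there, which is
          impossible.\<close>
        have iv0: "iv ?Z = {}"
        proof (rule ccontr)
          assume "iv ?Z \<noteq> {}"
          then obtain w where "w \<in> iv ?Z" by blast
          from three_chords[OF cyc Kiv att this] obtain a b c P1 P2 P3 where
            abc: "distinct [a, b, c]" "a \<in> set B \<union> set T" "b \<in> set B \<union> set T" "c \<in> set B \<union> set T"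
            and ch: "chord ?Z a P1 b" "chord ?Z a P2 c" "chord ?Z b P3 c" by auto
          have NB': "\<not> (a \<in> set B \<and> b \<in> set B)" "\<not> (a \<in> set B \<and> c \<in> set B)" "\<not> (b \<in> set B \<and> c \<in> set B)"
            using NB ch abc(1) by auto
          have long: "length T \<ge> 4" if "u \<in> set T - set B" "v \<in> set T - set B" "u \<noteq> v" for u v
          proof -
            have "u \<in> set T'" "v \<in> set T'" using that st by auto
            then show ?thesis using that(3) st(2) by (cases T'; cases "tl T'") auto
          qed
          have allT': "u \<in> set T"
            if "u \<in> set B \<union> set T" "v \<in> set B \<union> set T" "w \<in> set B \<union> set T" "v \<noteq> w"
              "\<not> (u \<in> set B \<and> v \<in> set B)" "\<not> (u \<in> set B \<and> w \<in> set B)" "chord ?Z v P u \<or> chord ?Z u P v" for u v w P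
          proof (rule ccontr)
            assume "u \<notin> set T"
            then have u: "u \<in> set B - set T" "v \<in> set T - set B" "w \<in> set T - set B" using that by auto
            show False using cr[OF that(7)] long[OF u(2,3) that(4)] u by simp
          qed
          have d: "a \<noteq> b" "a \<noteq> c" "b \<noteq> c" using abc(1) by auto
          have "a \<in> set T" by (rule allT'[of a b c P1]) (use abc d NB' ch in auto)
          moreover have "b \<in> set T" by (rule allT'[of b a c P1]) (use abc d NB' ch in auto)
          moreover have "c \<in> set T" by (rule allT'[of c a b P2]) (use abc d NB' ch in auto)
          ultimately have allT: "a \<in> set T" "b \<in> set T" "c \<in> set T" by auto
          have "{a, b} \<in> pedges T" "{a, c} \<in> pedges T" "{b, c} \<in> pedges T"
            using NT allT ch d by blast+
          then show False using three_on_path[OF dT allT abc(1)] by blast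
        qed
        \<comment> \<open>Without inside vertices an inside edge is itself a chord between cycle
          vertices, and for long \<open>T\<close> all positions of it are excluded.\<close>
        have "ie ?Z = {} \<or> length T \<le> 3"
        proof (rule ccontr)
          assume "\<not> ?thesis"
          then obtain e where e: "e \<in> ie ?Z" and L: "length T \<ge> 4" by auto
          obtain a b where ab: "a \<noteq> b" "e = {a, b}" using edge e ie_E by blast
          have abJ: "a \<in> set B \<union> set T" "b \<in> set B \<union> set T" using end_inside[OF cyc e] iv0 ab by auto
          have ch: "chord ?Z a [] b" using e ab by (simp add: edge_chord)
          from pair[OF ch ab(1) abJ] show False
            using cr[of a "[]" b] cr[of b "[]" a] ch L ie_disjoint[OF cyc] e ab(2) by blast
        qed
        then show ?thesis by (rule fill_empty[OF less.prems iv0])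
      qed
    qed
  qed
qed

end

section \<open>Plane drawings by arcs\<close>

lemma connected_subset_inside:
  assumes "connected S" "S \<inter> J = {}" "closed (J :: complex set)" "S \<inter> inside J \<noteq> {}"
  shows "S \<subseteq> inside J"
proof (rule ccontr)
  assume "\<not> S \<subseteq> inside J"
  have cov: "S \<subseteq> inside J \<union> outside J" unfolding inside_Un_outside using assms(2) by auto
  then have "S \<inter> outside J \<noteq> {}" using \<open>\<not> S \<subseteq> inside J\<close> by blast
  moreover have "inside J \<inter> outside J \<inter> S = {}" by simp
  ultimately show False
    using connectedD[OF assms(1) open_inside[OF assms(3)] open_outside[OF assms(3)] _ cov] assms(4) by blast
qed

text \<open>With infinity sent to 0, the image of the outside is bounded, because the outside keeps
  away from \<open>z0\<close>. The images of inside and outside are open and cover the complement of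
  the image of \<open>J\<close>, so the component of the image of \<open>w\<close> stays in the
  bounded set.\<close>

lemma inversion_inside:
  fixes J :: "complex set"
  assumes J: "compact J" and z0: "z0 \<in> inside J" and w: "w \<in> outside J"
  shows "inverse (w - z0) \<in> inside ((\<lambda>z. inverse (z - z0)) ` J)"
proof -
  define h where "h z = inverse (z - z0)" for z
  have cJ: "closed J" using J by (rule compact_imp_closed)
  \<comment> \<open>0 is the image of infinity; it must be included for \<open>Out\<close> and
    \<open>Inn\<close> to cover the complement of the image of \<open>J\<close>.\<close>
  define Out where "Out = {y. y = 0 \<or> z0 + inverse y \<in> outside J}"
  define Inn where "Inn = {y. y \<noteq> 0 \<and> z0 + inverse y \<in> inside J}"
  have contg: "continuous_on (- {0}) (\<lambda>y. z0 + inverse y)" by (intro continuous_intros) auto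
  have opre: "open {y. y \<noteq> 0 \<and> z0 + inverse y \<in> U}" if "open U" for U
  proof -
    have "open (- {0} \<inter> (\<lambda>y. z0 + inverse y) -` U)"
      using continuous_open_preimage[OF contg _ that] by auto
    moreover have "- {0} \<inter> (\<lambda>y. z0 + inverse y) -` U = {y. y \<noteq> 0 \<and> z0 + inverse y \<in> U}" by auto
    ultimately show ?thesis by simp
  qed
  have openI: "open Inn" unfolding Inn_def by (rule opre) (rule open_inside[OF cJ])
  have "bounded (J \<union> inside J)" using J by (simp add: bounded_inside compact_imp_bounded)
  then obtain R where R: "\<And>z. z \<in> J \<union> inside J \<Longrightarrow> norm z \<le> R" by (auto simp: bounded_iff)
  have far: "z \<in> outside J" if "norm z > R" for z
  proof -
    have "z \<notin> J" "z \<notin> inside J" using R[of z] that by auto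
    then show ?thesis using inside_Un_outside[of J] by blast
  qed
  \<comment> \<open>For nonzero \<open>y\<close>, \<open>norm y < d\<close> forces
    \<open>norm (inverse y) > \<bar>R\<bar> + norm z0 + 1\<close>, hence
    \<open>norm (z0 + inverse y) > R\<close>, beyond \<open>J\<close> and its inside.\<close>
  define d where "d = 1 / (\<bar>R\<bar> + norm z0 + 1)"
  have d: "d > 0" unfolding d_def by (auto intro: add_nonneg_pos)
  have ballO: "ball 0 d \<subseteq> Out"
  proof
    fix y assume y: "y \<in> ball (0::complex) d"
    show "y \<in> Out"
    proof (cases "y = 0")
      case False
      then have "norm y * (\<bar>R\<bar> + norm z0 + 1) < 1"
        using y unfolding d_def by (simp add: pos_less_divide_eq add_nonneg_pos)
      then have "\<bar>R\<bar> + norm z0 + 1 < 1 / norm y"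
        using False by (simp add: pos_less_divide_eq mult.commute)
      then have "\<bar>R\<bar> + norm z0 + 1 < norm (inverse y)"
        by (simp add: norm_inverse divide_inverse)
      moreover have "norm (inverse y) \<le> norm (z0 + inverse y) + norm z0"
        using norm_triangle_ineq4[of "z0 + inverse y" z0] by simp
      ultimately have "norm (z0 + inverse y) > R" by linarith
      then show ?thesis unfolding Out_def using far by blast
    qed (simp add: Out_def)
  qed
  have "Out = {y. y \<noteq> 0 \<and> z0 + inverse y \<in> outside J} \<union> ball 0 d"
    using ballO unfolding Out_def using d by auto
  then have openO: "open Out" using opre[OF open_outside[OF cJ]] by (metis open_Un open_ball)
  obtain r where r: "r > 0" "ball z0 r \<subseteq> inside J"
    using open_inside[OF cJ] z0 open_contains_ball by blast
  have bO: "norm y \<le> 1 / r" if "y \<in> Out" for y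
  proof (cases "y = 0")
    case False
    then have "z0 + inverse y \<in> outside J" using that by (simp add: Out_def)
    then have "z0 + inverse y \<notin> ball z0 r" using r(2) inside_Int_outside[of J] by blast
    then have "r \<le> norm (inverse y)" by (simp add: dist_norm)
    then have "r \<le> 1 / norm y" by (simp add: norm_inverse divide_inverse)
    then show ?thesis using False r(1) by (simp add: pos_le_divide_eq mult.commute)
  qed (use r in simp)
  have hinv: "z0 + inverse (h z) = z" for z unfolding h_def by simp
  have cov: "- h ` J \<subseteq> Out \<union> Inn"
  proof
    fix y assume y: "y \<in> - h ` J"
    show "y \<in> Out \<union> Inn"
    proof (rule ccontr)
      assume n: "y \<notin> Out \<union> Inn"
      then have y0: "y \<noteq> 0" "z0 + inverse y \<notin> outside J" "z0 + inverse y \<notin> inside J"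
        unfolding Out_def Inn_def by auto
      then have "z0 + inverse y \<in> J" using inside_Un_outside[of J] by blast
      moreover have "h (z0 + inverse y) = y" unfolding h_def by simp
      ultimately show False using y by force
    qed
  qed
  have disj: "Out \<inter> Inn = {}" unfolding Out_def Inn_def using inside_Int_outside[of J] by blast
  have wO: "h w \<in> Out" unfolding Out_def using w by (simp add: hinv)
  have wJ: "h w \<notin> h ` J"
  proof
    assume "h w \<in> h ` J"
    then obtain z where "z \<in> J" "h w = h z" by blast
    then have "w = z" by (metis hinv)
    then show False using \<open>z \<in> J\<close> w outside_no_overlap[of J] by blast
  qed
  let ?C = "connected_component_set (- h ` J) (h w)"
  have "?C \<subseteq> Out"
  proof (rule ccontr)
    assume "\<not> ?C \<subseteq> Out"
    moreover have sub: "?C \<subseteq> Out \<union> Inn" using connected_component_subset[of "- h ` J" "h w"] cov by (rule subset_trans)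
    ultimately have C1: "Inn \<inter> ?C \<noteq> {}" by blast
    have wC: "h w \<in> ?C" using wJ by simp
    have C2: "Out \<inter> ?C \<noteq> {}" using wO wC by blast
    have "Out \<inter> Inn \<inter> ?C = {}" using disj by blast
    from connectedD[OF connected_connected_component openO openI this sub] show False
      using C1 C2 by blast
  qed
  then have "bounded ?C" using bO by (auto simp: bounded_iff)
  then have "h w \<in> inside (h ` J)" unfolding inside_def using wJ by simp
  then show ?thesis unfolding h_def by simp
qed

text \<open>The inverse of an arc is continuous and injective on the image; on a nonempty interior
  it would embed an open set of the plane into the line, against invariance of dimension.\<close>

lemma interior_arc_image:
  fixes c :: "real \<Rightarrow> complex"
  assumes "arc c"
  shows "interior (path_image c) = {}"
proof (rule ccontr)
  assume ne: "interior (path_image c) \<noteq> {}"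
  have cont: "continuous_on {0..1} c" and inj: "inj_on c {0..1}" using assms by (auto simp: arc_def path_def)
  have pc: "path_image c = c ` {0..1}" by (simp add: path_image_def)
  have "continuous_on (path_image c) (inv_into {0..1} c)"
    unfolding pc by (rule continuous_on_inv[OF cont]) (auto simp: inj)
  then have "continuous_on (interior (path_image c)) (inv_into {0..1} c)"
    by (rule continuous_on_subset) (rule interior_subset)
  moreover have "inj_on (inv_into {0..1} c) (interior (path_image c))"
    by (rule inj_on_inv_into) (use interior_subset pc in blast)
  ultimately have "DIM(complex) \<le> DIM(real)" using invariance_of_dimension[of "interior (path_image c)"] ne by blast
  then show False by simp
qed

text \<open>
  The last condition is automatic for planar drawings without isolated vertices.
\<close>

definition plane :: "'a set \<Rightarrow> 'a set set \<Rightarrow> ('a \<Rightarrow> complex) \<Rightarrow> ('a set \<Rightarrow> real \<Rightarrow> complex) \<Rightarrow> bool" where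
  "plane V E p \<gamma> \<longleftrightarrow> finite V \<and> inj_on p V \<and>
     (\<forall>e\<in>E. \<exists>u w. u \<in> V \<and> w \<in> V \<and> u \<noteq> w \<and> e = {u, w} \<and> arc (\<gamma> e) \<and> pathstart (\<gamma> e) = p u \<and> pathfinish (\<gamma> e) = p w) \<and>
     (\<forall>e\<in>E. \<forall>f\<in>E. e \<noteq> f \<longrightarrow> path_image (\<gamma> e) \<inter> path_image (\<gamma> f) \<subseteq> p ` (e \<inter> f)) \<and>
     (\<forall>e\<in>E. \<forall>w\<in>V. p w \<in> path_image (\<gamma> e) \<longrightarrow> w \<in> e)"

locale plane_drawing =
  fixes V :: "'a set" and E p \<gamma>
  assumes plane: "plane V E p \<gamma>"
begin

section \<open>Vertices and edges inside a cycle of a plane drawing\<close>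

definition im :: "'a set set \<Rightarrow> complex set" where
  "im Z = (\<Union>e\<in>Z. path_image (\<gamma> e))"

definition ivp :: "'a set set \<Rightarrow> 'a set" where
  "ivp Z = {x \<in> V. p x \<in> inside (im Z)}"

text \<open>The ends are removed because an inside edge may end on the cycle itself.\<close>

definition oe :: "'a set \<Rightarrow> complex set" where
  "oe e = path_image (\<gamma> e) - p ` e"

definition iep :: "'a set set \<Rightarrow> 'a set set" where
  "iep Z = {e \<in> E. oe e \<subseteq> inside (im Z)}"

lemma finV: "finite V" and inj: "inj_on p V"
  using plane by (simp_all add: plane_def)

lemma edgeE:
  assumes "e \<in> E"
  obtains u w where "u \<in> V" "w \<in> V" "u \<noteq> w" "e = {u, w}" "arc (\<gamma> e)" "pathstart (\<gamma> e) = p u" "pathfinish (\<gamma> e) = p w"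
proof -
  have "\<exists>u w. u \<in> V \<and> w \<in> V \<and> u \<noteq> w \<and> e = {u, w} \<and> arc (\<gamma> e) \<and> pathstart (\<gamma> e) = p u \<and> pathfinish (\<gamma> e) = p w"
    by (rule plane[unfolded plane_def, THEN conjunct2, THEN conjunct2, THEN conjunct1, rule_format, OF assms])
  then show ?thesis using that by (elim exE conjE)
qed

lemma cross: "e \<in> E \<Longrightarrow> f \<in> E \<Longrightarrow> e \<noteq> f \<Longrightarrow> path_image (\<gamma> e) \<inter> path_image (\<gamma> f) \<subseteq> p ` (e \<inter> f)"
  by (rule plane[unfolded plane_def, THEN conjunct2, THEN conjunct2, THEN conjunct2, THEN conjunct1, rule_format])

lemma vertex_on: "e \<in> E \<Longrightarrow> w \<in> V \<Longrightarrow> p w \<in> path_image (\<gamma> e) \<Longrightarrow> w \<in> e"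
  by (rule plane[unfolded plane_def, THEN conjunct2, THEN conjunct2, THEN conjunct2, THEN conjunct2, rule_format])

lemma edge_sub: "e \<in> E \<Longrightarrow> e \<subseteq> V"
  by (erule edgeE) auto

lemma finE: "finite E"
proof -
  have "E \<subseteq> Pow V" using edge_sub by blast
  then show ?thesis by (rule finite_subset) (simp add: finV)
qed

lemma end_on: "e \<in> E \<Longrightarrow> x \<in> e \<Longrightarrow> p x \<in> path_image (\<gamma> e)"
  by (erule edgeE) (metis insertE pathfinish_in_path_image pathstart_in_path_image singletonD)

text \<open>Connectedness places an open edge that avoids a cycle on one side of it; the closure
  carries this over to its ends.\<close>

lemma oe_facts:
  assumes "e \<in> E"
  shows "connected (oe e)" "oe e \<noteq> {}" "path_image (\<gamma> e) \<subseteq> closure (oe e)"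
proof -
  obtain u w where e: "e = {u, w}" "arc (\<gamma> e)" "pathstart (\<gamma> e) = p u" "pathfinish (\<gamma> e) = p w"
    using edgeE[OF assms] by metis
  have o: "oe e = path_image (\<gamma> e) - {pathstart (\<gamma> e), pathfinish (\<gamma> e)}" unfolding oe_def using e by auto
  have sp: "simple_path (\<gamma> e)" using e(2) by (rule arc_imp_simple_path)
  show "connected (oe e)" unfolding o by (rule connected_simple_path_endless[OF sp])
  show "oe e \<noteq> {}" unfolding o by (rule nonempty_simple_path_endless[OF sp])
  have o2: "oe e = \<gamma> e ` {0<..<1}" unfolding o by (rule simple_path_endless[OF sp])
  have "continuous_on {0..1} (\<gamma> e)" using sp by (simp add: simple_path_def path_def)
  then have "continuous_on (closure {0<..<1::real}) (\<gamma> e)" by simp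
  from image_closure_subset[OF this closed_closure, of "oe e"] show "path_image (\<gamma> e) \<subseteq> closure (oe e)"
    unfolding path_image_def o2 by (simp add: closure_subset)
qed

lemma arc_image: "e \<in> E \<Longrightarrow> arc (\<gamma> e)" by (erule edgeE)

lemma compact_im: "F \<subseteq> E \<Longrightarrow> compact (im F)"
  unfolding im_def using finE by (intro compact_UN) (auto intro: finite_subset compact_arc_image arc_image)

lemma closed_im: "F \<subseteq> E \<Longrightarrow> closed (im F)"
  using compact_im compact_imp_closed by blast

lemma im_meet:
  assumes "F \<subseteq> E" "G \<subseteq> E" "F \<inter> G = {}"
  shows "im F \<inter> im G \<subseteq> p ` (\<Union>F \<inter> \<Union>G)"
proof
  fix z assume "z \<in> im F \<inter> im G"
  then obtain e f where ef: "e \<in> F" "f \<in> G" "z \<in> path_image (\<gamma> e) \<inter> path_image (\<gamma> f)"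
    unfolding im_def by blast
  then have "z \<in> p ` (e \<inter> f)" using cross[of e f] assms by blast
  then show "z \<in> p ` (\<Union>F \<inter> \<Union>G)" using ef by blast
qed

lemma vertex_im:
  assumes "F \<subseteq> E" "x \<in> V" shows "p x \<in> im F \<longleftrightarrow> x \<in> \<Union>F"
  using assms vertex_on end_on unfolding im_def by blast

lemma oe_im_disjoint:
  assumes "F \<subseteq> E" "e \<in> E" "e \<notin> F" shows "oe e \<inter> im F = {}"
proof -
  have "path_image (\<gamma> e) \<inter> path_image (\<gamma> f) \<subseteq> p ` e" if "f \<in> F" for f
    using cross[of e f] assms that by blast
  then show ?thesis unfolding oe_def im_def by blast
qed

lemma im_Un: "im (F \<union> G) = im F \<union> im G" by (simp add: im_def)

text \<open>Successive edge arcs are joined, reversed where they run the wrong way. The pieces share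
  only the joint because distinct edges meet only in common ends.\<close>

lemma path_arc:
  assumes "distinct L" "length L \<ge> 2" "pedges L \<subseteq> E"
  shows "\<exists>c. arc c \<and> path_image c = im (pedges L) \<and> pathstart c = p (hd L) \<and> pathfinish c = p (last L)"
  using assms
proof (induction L rule: pedges.induct)
  case (1 x y L)
  have e: "{x, y} \<in> E" using 1 by simp
  have "\<exists>g. arc g \<and> path_image g = path_image (\<gamma> {x, y}) \<and> pathstart g = p x \<and> pathfinish g = p y"
  proof -
    obtain u w where *: "{x, y} = {u, w}" "arc (\<gamma> {x, y})" "pathstart (\<gamma> {x, y}) = p u" "pathfinish (\<gamma> {x, y}) = p w"
      using edgeE[OF e] by metis
    consider "u = x" "w = y" | "u = y" "w = x" using *(1) by (auto simp: doubleton_eq_iff)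
    then show ?thesis
    proof cases
      case 1
      then show ?thesis using * by blast
    next
      case 2
      then show ?thesis using * by (intro exI[of _ "reversepath (\<gamma> {x, y})"]) (simp add: arc_reversepath)
    qed
  qed
  then obtain g where g: "arc g" "path_image g = path_image (\<gamma> {x, y})" "pathstart g = p x" "pathfinish g = p y" by blast
  show ?case
  proof (cases "L = []")
    case True
    then show ?thesis using g by (intro exI[of _ g]) (simp add: im_def)
  next
    case False
    then have "length (y # L) \<ge> 2" by (cases L) auto
    then obtain c where c: "arc c" "path_image c = im (pedges (y # L))" "pathstart c = p y" "pathfinish c = p (last (y # L))"
      using 1 by fastforce
    have nin: "{x, y} \<notin> pedges (y # L)" using pedges_subset[of "{x, y}" "y # L"] 1(2) by auto
    have "im {{x, y}} \<inter> im (pedges (y # L)) \<subseteq> p ` (\<Union>{{x, y}} \<inter> \<Union>(pedges (y # L)))"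
      using im_meet[of "{{x, y}}" "pedges (y # L)"] nin e 1(4) by auto
    also have "\<dots> \<subseteq> {p y}"
    proof -
      have "\<Union>(pedges (y # L)) \<subseteq> set (y # L)" using pedges_subset by (rule Union_least)
      then have "x \<notin> \<Union>(pedges (y # L))" using 1(2) by auto
      then show ?thesis by auto
    qed
    finally have "path_image g \<inter> path_image c \<subseteq> {pathstart c}" unfolding g c by (simp add: im_def)
    then have "arc (g +++ c)" using arc_join[OF g(1) c(1)] g c by simp
    moreover have "path_image (g +++ c) = im (pedges (x # y # L))"
      using path_image_join[of g c] g c by (simp add: im_def)
    ultimately show ?thesis using g c by (intro exI[of _ "g +++ c"]) simp
  qed
qed auto

lemma cyc_V: assumes "cyc E B T" shows "set B \<subseteq> V" "set T \<subseteq> V"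
  using cyc_Union[OF assms] assms edge_sub unfolding cyc_def by blast+

lemma cyc_im:
  assumes "cyc E B T"
  shows "im (pedges B) \<inter> im (pedges T) = {p (hd B), p (last B)}"
proof -
  obtain s B' T' t where st: "B = s # B' @ [t]" "T = s # T' @ [t]" "set B \<inter> set T = {s, t}" "s \<noteq> t"
    using cycE[OF assms] .
  have U: "\<Union>(pedges B) = set B" "\<Union>(pedges T) = set T" by (rule Union_pedges, simp add: st)+
  have sub: "pedges B \<subseteq> E" "pedges T \<subseteq> E" "pedges B \<inter> pedges T = {}" using assms by (auto simp: cyc_def)
  have "im (pedges B) \<inter> im (pedges T) \<subseteq> {p s, p t}"
    using im_meet[OF sub] unfolding U st(3) by simp
  moreover have "p s \<in> im (pedges B)" "p t \<in> im (pedges B)" "p s \<in> im (pedges T)" "p t \<in> im (pedges T)"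
    using vertex_im[OF sub(1)] vertex_im[OF sub(2)] cyc_V[OF assms] st unfolding U by auto
  ultimately show ?thesis using st by auto
qed

text \<open>The three paths become arcs with common ends, and the splitting theorem for simple
  closed curves divides the inside as a point set. An open edge off \<open>L\<close> is connected
  and therefore falls into one half.\<close>

lemma disc_theta:
  assumes c12: "cyc E L1 L2" and c1: "cyc E L1 L" and c2: "cyc E L2 L"
    and ne: "pedges L \<inter> iep (pedges L1 \<union> pedges L2) \<noteq> {}"
  shows "ivp (pedges L1 \<union> pedges L2) = ivp (pedges L1 \<union> pedges L) \<union> ivp (pedges L2 \<union> pedges L) \<union> (set L - {hd L, last L}) \<and>
       iep (pedges L1 \<union> pedges L2) = iep (pedges L1 \<union> pedges L) \<union> iep (pedges L2 \<union> pedges L) \<union> pedges L \<and>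
       ivp (pedges L1 \<union> pedges L) \<inter> ivp (pedges L2 \<union> pedges L) = {} \<and>
       iep (pedges L1 \<union> pedges L) \<inter> iep (pedges L2 \<union> pedges L) = {}"
proof -
  obtain a A1 A t where l1: "L1 = a # A1 @ [t]" "L = a # A @ [t]" "a \<noteq> t" using cycE[OF c1] by metis
  obtain A2 where l2: "L2 = a # A2 @ [t]" using cycE[OF c2] l1 by (metis append1_eq_conv append_Cons list.inject)
  have ds: "distinct L1" "distinct L2" "distinct L" and es: "pedges L1 \<subseteq> E" "pedges L2 \<subseteq> E" "pedges L \<subseteq> E"
    using c12 c1 by (auto simp: cyc_def)
  obtain g1 where g1: "arc g1" "path_image g1 = im (pedges L1)" "pathstart g1 = p a" "pathfinish g1 = p t"
    using path_arc[OF ds(1) _ es(1)] l1 by auto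
  obtain g2 where g2: "arc g2" "path_image g2 = im (pedges L2)" "pathstart g2 = p a" "pathfinish g2 = p t"
    using path_arc[OF ds(2) _ es(2)] l2 by auto
  obtain g where g: "arc g" "path_image g = im (pedges L)" "pathstart g = p a" "pathfinish g = p t"
    using path_arc[OF ds(3) _ es(3)] l1 by auto
  have aV: "a \<in> V" "t \<in> V" using cyc_V[OF c1] l1 by auto
  have pat: "p a \<noteq> p t" using inj aV l1(3) by (simp add: inj_on_eq_iff)
  let ?J12 = "im (pedges L1 \<union> pedges L2)" and ?J1 = "im (pedges L1 \<union> pedges L)" and ?J2 = "im (pedges L2 \<union> pedges L)"
  \<comment> \<open>This edge witnesses that the middle arc enters the inside, as the splitting
    theorem requires.\<close>
  obtain e0 where e0: "e0 \<in> pedges L" "oe e0 \<subseteq> inside ?J12" using ne by (auto simp: iep_def)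
  have e0': "oe e0 \<noteq> {}" "oe e0 \<subseteq> im (pedges L)"
    using oe_facts(2)[of e0] e0 es(3) by (auto simp: oe_def im_def)
  have sp: "inside ?J1 \<inter> inside ?J2 = {} \<and> inside ?J1 \<union> inside ?J2 \<union> (im (pedges L) - {p a, p t}) = inside ?J12"
  proof (rule split_inside_simple_closed_curve[where ?c1.0 = g1 and ?c2.0 = g2 and c = g and a = "p a" and b = "p t"])
    show "path_image g \<inter> inside (path_image g1 \<union> path_image g2) \<noteq> {}"
      unfolding g(2) g1(2) g2(2) im_Un[symmetric] using e0(2) e0' by blast
    show "path_image g1 \<inter> path_image g2 = {p a, p t}" unfolding g1(2) g2(2) using cyc_im[OF c12] l1 by simp
    show "path_image g1 \<inter> path_image g = {p a, p t}" unfolding g1(2) g(2) using cyc_im[OF c1] l1 by simp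
    show "path_image g2 \<inter> path_image g = {p a, p t}" unfolding g2(2) g(2) using cyc_im[OF c2] l2 by simp
  qed (use g g1 g2 pat arc_imp_simple_path in \<open>auto simp: im_Un\<close>)
  have I12: "inside ?J12 = inside ?J1 \<union> inside ?J2 \<union> (im (pedges L) - {p a, p t})" and dis: "inside ?J1 \<inter> inside ?J2 = {}"
    using sp by auto
  have UL: "\<Union>(pedges L) = set L" by (rule Union_pedges) (simp add: l1)
  have iv: "ivp (pedges L1 \<union> pedges L2) = ivp (pedges L1 \<union> pedges L) \<union> ivp (pedges L2 \<union> pedges L) \<union> (set L - {hd L, last L})"
  proof -
    have "p x \<in> im (pedges L) - {p a, p t} \<longleftrightarrow> x \<in> set L - {a, t}" if "x \<in> V" for x
      using vertex_im[OF es(3) that] UL inj_on_eq_iff[OF inj that aV(1)] inj_on_eq_iff[OF inj that aV(2)] by auto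
    moreover have "set L \<subseteq> V" using cyc_V[OF c1] by simp
    ultimately show ?thesis unfolding ivp_def I12 using l1(2) by auto
  qed
  have opn: "open (inside ?J1)" "open (inside ?J2)" using es by (auto intro!: open_inside closed_im)
  have ie: "iep (pedges L1 \<union> pedges L2) = iep (pedges L1 \<union> pedges L) \<union> iep (pedges L2 \<union> pedges L) \<union> pedges L"
  proof
    show "iep (pedges L1 \<union> pedges L) \<union> iep (pedges L2 \<union> pedges L) \<union> pedges L \<subseteq> iep (pedges L1 \<union> pedges L2)"
    proof -
      have "oe e \<subseteq> im (pedges L) - {p a, p t}" if e: "e \<in> pedges L" for e
      proof -
        have "p x \<notin> oe e" if "x \<in> V" for x
          using vertex_on[of e x] e es(3) that by (auto simp: oe_def)
        then show ?thesis using e aV unfolding oe_def im_def by blast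
      qed
      then show ?thesis unfolding iep_def I12 using es(3) by blast
    qed
    show "iep (pedges L1 \<union> pedges L2) \<subseteq> iep (pedges L1 \<union> pedges L) \<union> iep (pedges L2 \<union> pedges L) \<union> pedges L"
    proof
      fix e assume "e \<in> iep (pedges L1 \<union> pedges L2)"
      then have e: "e \<in> E" "oe e \<subseteq> inside ?J12" by (auto simp: iep_def)
      show "e \<in> iep (pedges L1 \<union> pedges L) \<union> iep (pedges L2 \<union> pedges L) \<union> pedges L"
      proof (cases "e \<in> pedges L")
        case False
        have sub: "oe e \<subseteq> inside ?J1 \<union> inside ?J2" using e(2) oe_im_disjoint[OF es(3) e(1) False] unfolding I12 by blast
        then have "oe e \<inter> inside ?J1 = {} \<or> oe e \<inter> inside ?J2 = {}"
          using connectedD[OF oe_facts(1)[OF e(1)] opn _ sub] dis by blast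
        then have "oe e \<subseteq> inside ?J1 \<or> oe e \<subseteq> inside ?J2" using sub by blast
        then show ?thesis using e(1) by (auto simp: iep_def)
      qed simp
    qed
  qed
  have "ivp (pedges L1 \<union> pedges L) \<inter> ivp (pedges L2 \<union> pedges L) = {}" using dis by (auto simp: ivp_def)
  moreover have "iep (pedges L1 \<union> pedges L) \<inter> iep (pedges L2 \<union> pedges L) = {}"
    using dis oe_facts(2) unfolding iep_def by fastforce
  ultimately show ?thesis using iv ie by blast
qed

lemma cyc_sub: "cyc E B T \<Longrightarrow> pedges B \<union> pedges T \<subseteq> E"
  by (simp add: cyc_def)

sublocale disc_system V E ivp iep
proof
  show "finite E" by (rule finE)
  show "\<exists>u w. u \<in> V \<and> w \<in> V \<and> u \<noteq> w \<and> e = {u, w}" if "e \<in> E" for e using edgeE[OF that] by metis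
  show "ivp Z \<subseteq> V" "iep Z \<subseteq> E" for Z by (auto simp: ivp_def iep_def)
  fix B T assume c: "cyc E B T"
  let ?Z = "pedges B \<union> pedges T"
  have Z: "?Z \<subseteq> E" using c by (rule cyc_sub)
  note cl = closed_im[OF Z]
  have UZ: "\<Union>?Z = set B \<union> set T" using c by (rule cyc_Union)
  show ivd: "ivp ?Z \<inter> (set B \<union> set T) = {}"
    using vertex_im[OF Z] UZ inside_no_overlap[of "im ?Z"] unfolding ivp_def by blast
  show "iep ?Z \<inter> ?Z = {}"
  proof -
    have "oe e \<subseteq> im ?Z" if "e \<in> ?Z" for e using that by (auto simp: oe_def im_def)
    then show ?thesis using oe_facts(2) Z inside_no_overlap[of "im ?Z"] unfolding iep_def by blast
  qed
  show "{x, y} \<in> iep ?Z" if x: "x \<in> ivp ?Z" "{x, y} \<in> E" for x y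
  proof -
    have "{x, y} \<notin> ?Z" using ivd x(1) UZ by blast
    note d = oe_im_disjoint[OF Z x(2) this]
    \<comment> \<open>An inside end is a limit of its open edge, so the open edge meets the open set
      \<open>inside\<close> and, being connected and off the cycle, lies in it.\<close>
    have "p x \<in> closure (oe {x, y})" using oe_facts(3)[OF x(2)] end_on[OF x(2), of x] by auto
    then have "oe {x, y} \<inter> inside (im ?Z) \<noteq> {}"
      using x(1) open_Int_closure_eq_empty[OF open_inside[OF cl], of "oe {x, y}"] unfolding ivp_def by blast
    then show ?thesis using connected_subset_inside[OF oe_facts(1)[OF x(2)] d cl] x(2) by (simp add: iep_def)
  qed
  show "x \<in> ivp ?Z \<union> (set B \<union> set T)" if e: "e \<in> iep ?Z" "x \<in> e" for e x
  proof -
    have eE: "e \<in> E" "oe e \<subseteq> inside (im ?Z)" using e by (auto simp: iep_def)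
    have xV: "x \<in> V" using edge_sub eE e by blast
    have "p x \<in> closure (oe e)" using oe_facts(3)[OF eE(1)] end_on[OF eE(1) e(2)] by auto
    also have "\<dots> \<subseteq> closure (inside (im ?Z))" by (rule closure_mono[OF eE(2)])
    also have "\<dots> \<subseteq> im ?Z \<union> inside (im ?Z)" by (rule closure_inside_subset[OF cl])
    finally show ?thesis using vertex_im[OF Z xV] UZ xV by (auto simp: ivp_def)
  qed
qed (rule disc_theta)

end

section \<open>Subgraphs, virtual edges and inversion\<close>

lemma plane_subgraph:
  assumes pl: "plane V E p \<gamma>" and sub: "V' \<subseteq> V" "E' \<subseteq> E" "\<And>e. e \<in> E' \<Longrightarrow> e \<subseteq> V'"
  shows "plane V' E' p \<gamma>"
proof -
  interpret plane_drawing V E p \<gamma> by standard (rule pl)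
  show ?thesis unfolding plane_def
  proof (intro conjI ballI impI)
    show "finite V'" using finV sub(1) by (rule finite_subset[rotated])
    show "inj_on p V'" using inj sub(1) by (rule inj_on_subset)
    show "\<exists>u w. u \<in> V' \<and> w \<in> V' \<and> u \<noteq> w \<and> e = {u, w} \<and> arc (\<gamma> e) \<and> pathstart (\<gamma> e) = p u \<and> pathfinish (\<gamma> e) = p w"
      if e: "e \<in> E'" for e
    proof -
      have "e \<in> E" using e sub by blast
      then obtain u w where uw: "u \<in> V" "w \<in> V" "u \<noteq> w" "e = {u, w}" "arc (\<gamma> e)" "pathstart (\<gamma> e) = p u" "pathfinish (\<gamma> e) = p w"
        by (rule edgeE)
      have "{u, w} \<subseteq> V'" using sub(3)[OF e] unfolding uw(4) .
      then have "u \<in> V'" "w \<in> V'" by auto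
      then show ?thesis using uw(3-7) by (intro exI[of _ u] exI[of _ w] conjI)
    qed
    show "path_image (\<gamma> e) \<inter> path_image (\<gamma> f) \<subseteq> p ` (e \<inter> f)" if "e \<in> E'" "f \<in> E'" "e \<noteq> f" for e f
      by (rule cross) (use that sub in auto)
    show "w \<in> e" if "e \<in> E'" "w \<in> V'" "p w \<in> path_image (\<gamma> e)" for e w
      by (rule vertex_on) (use that sub in auto)
  qed
qed

text \<open>This draws a virtual edge: the path \<open>L\<close> meets the kept part
  \<open>V1\<close> only in its ends, so its joined arc can serve as the edge \<open>{x, y}\<close>.
  If that edge is already present, it is redrawn along \<open>L\<close>.\<close>

lemma plane_path_edge:
  assumes pl: "plane V E p \<gamma>" and V1: "V1 \<subseteq> V" and E1: "E1 \<subseteq> E" "\<And>e. e \<in> E1 \<Longrightarrow> e \<subseteq> V1"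
    and L: "distinct L" "length L \<ge> 2" "pedges L \<subseteq> E" "set L \<inter> V1 = {x, y}" "hd L = x" "last L = y"
  shows "\<exists>\<gamma>'. plane V1 (insert {x, y} E1) p \<gamma>'"
proof -
  interpret plane_drawing V E p \<gamma> by standard (rule pl)
  obtain c where c: "arc c" "path_image c = im (pedges L)" "pathstart c = p x" "pathfinish c = p y"
    using path_arc[OF L(1-3)] L(5,6) by auto
  have xy: "x \<noteq> y" using L(1,2,5,6) by (cases L; cases "tl L" rule: rev_cases) auto
  have xyV: "x \<in> V1" "y \<in> V1" using L(4) by auto
  have U: "\<Union>(pedges L) = set L" using L(2) by (rule Union_pedges)
  have meet: "im (pedges L) \<inter> path_image (\<gamma> e) \<subseteq> p ` ({x, y} \<inter> e)" if e: "e \<in> E1" "e \<noteq> {x, y}" for e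
  proof -
    \<comment> \<open>A kept edge on \<open>L\<close> has both ends in \<open>V1\<close>, so it
      could only be \<open>{x, y}\<close> itself.\<close>
    have nin: "e \<notin> pedges L"
    proof
      assume eL: "e \<in> pedges L"
      then have "e \<subseteq> {x, y}" using pedges_subset[OF eL] E1(2)[OF e(1)] L(4) by blast
      moreover obtain a b where "a \<noteq> b" "e = {a, b}" using pedges_pair[OF eL L(1)] by blast
      ultimately show False using e(2) by auto
    qed
    have "im (pedges L) \<inter> im {e} \<subseteq> p ` (\<Union>(pedges L) \<inter> \<Union>{e})"
      by (rule im_meet) (use L(3) e E1(1) nin in auto)
    also have "\<Union>(pedges L) \<inter> \<Union>{e} \<subseteq> {x, y} \<inter> e" unfolding U using E1(2)[OF e(1)] L(4) by auto
    finally show ?thesis by (simp add: im_def image_mono)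
  qed
  define \<gamma>' where "\<gamma>' = \<gamma>({x, y} := c)"
  have g0: "\<gamma>' {x, y} = c" and g1: "\<And>e. e \<noteq> {x, y} \<Longrightarrow> \<gamma>' e = \<gamma> e" by (auto simp: \<gamma>'_def)
  have sub: "plane V1 E1 p \<gamma>" by (rule plane_subgraph[OF pl V1 E1])
  interpret S: plane_drawing V1 E1 p \<gamma> by standard (rule sub)
  have "plane V1 (insert {x, y} E1) p \<gamma>'"
    unfolding plane_def
  proof (intro conjI ballI impI)
    show "finite V1" by (rule S.finV)
    show "inj_on p V1" by (rule S.inj)
    show "\<exists>u w. u \<in> V1 \<and> w \<in> V1 \<and> u \<noteq> w \<and> e = {u, w} \<and> arc (\<gamma>' e) \<and> pathstart (\<gamma>' e) = p u \<and> pathfinish (\<gamma>' e) = p w"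
      if e: "e \<in> insert {x, y} E1" for e
    proof (cases "e = {x, y}")
      case True
      then show ?thesis using c xy xyV g0 by auto
    next
      case False
      then have "e \<in> E1" using e by simp
      then obtain u w where "u \<in> V1" "w \<in> V1" "u \<noteq> w" "e = {u, w}" "arc (\<gamma> e)" "pathstart (\<gamma> e) = p u" "pathfinish (\<gamma> e) = p w"
        by (rule S.edgeE)
      then show ?thesis unfolding g1[OF False] by (intro exI[of _ u] exI[of _ w] conjI)
    qed
    show "path_image (\<gamma>' e) \<inter> path_image (\<gamma>' f) \<subseteq> p ` (e \<inter> f)"
      if e: "e \<in> insert {x, y} E1" "f \<in> insert {x, y} E1" "e \<noteq> f" for e f
    proof -
      consider "e = {x, y}" "f \<noteq> {x, y}" "f \<in> E1" | "f = {x, y}" "e \<noteq> {x, y}" "e \<in> E1" | "e \<noteq> {x, y}" "f \<noteq> {x, y}" "e \<in> E1" "f \<in> E1"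
        using e by auto
      then show ?thesis
      proof cases
        case 1
        then show ?thesis using meet[OF 1(3,2)] g0 g1[OF 1(2)] c(2) by simp
      next
        case 2
        then show ?thesis using meet[OF 2(3,2)] g0 g1[OF 2(2)] c(2) by (simp add: Int_commute)
      next
        case 3
        then show ?thesis using S.cross[OF 3(3,4) e(3)] g1 by simp
      qed
    qed
    show "w \<in> e" if e: "e \<in> insert {x, y} E1" "w \<in> V1" "p w \<in> path_image (\<gamma>' e)" for e w
    proof (cases "e = {x, y}")
      case True
      then have "w \<in> set L" using e vertex_im[OF L(3), of w] V1 U g0 c(2) by auto
      then show ?thesis using True e(2) L(4) by auto
    next
      case False
      then show ?thesis using e S.vertex_on[of e w] g1[OF False] by auto
    qed
  qed
  then show ?thesis by blast
qed

text \<open>As \<open>inverse 0 = 0\<close>, the map is injective on the whole plane; only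
  continuity fails, at \<open>z0\<close>.\<close>

definition invert :: "complex \<Rightarrow> complex \<Rightarrow> complex" where
  "invert z0 z = inverse (z - z0)"

lemma inj_invert: "inj_on (invert z0) A"
  by (auto simp: inj_on_def invert_def)

lemma plane_invert:
  assumes pl: "plane V E p \<gamma>" and z0: "\<And>e. e \<in> E \<Longrightarrow> z0 \<notin> path_image (\<gamma> e)"
  shows "plane V E (invert z0 \<circ> p) (\<lambda>e. invert z0 \<circ> \<gamma> e)"
proof -
  interpret plane_drawing V E p \<gamma> by standard (rule pl)
  have inv_eq: "invert z0 a = invert z0 b \<longleftrightarrow> a = b" for a b by (simp add: invert_def)
  show ?thesis unfolding plane_def
  proof (intro conjI ballI impI)
    show "finite V" by (rule finV)
    show "inj_on (invert z0 \<circ> p) V" using inj inj_invert by (rule comp_inj_on)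
    show "\<exists>u w. u \<in> V \<and> w \<in> V \<and> u \<noteq> w \<and> e = {u, w} \<and> arc (invert z0 \<circ> \<gamma> e) \<and>
        pathstart (invert z0 \<circ> \<gamma> e) = (invert z0 \<circ> p) u \<and> pathfinish (invert z0 \<circ> \<gamma> e) = (invert z0 \<circ> p) w"
      if e: "e \<in> E" for e
    proof -
      obtain u w where uw: "u \<in> V" "w \<in> V" "u \<noteq> w" "e = {u, w}" "arc (\<gamma> e)" "pathstart (\<gamma> e) = p u" "pathfinish (\<gamma> e) = p w"
        using e by (rule edgeE)
      have "continuous_on (path_image (\<gamma> e)) (invert z0)"
        unfolding invert_def using z0[OF e] by (intro continuous_intros) auto
      then have "path (invert z0 \<circ> \<gamma> e)" using uw(5) by (intro path_continuous_image) (auto simp: arc_def)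
      moreover have "inj_on (invert z0 \<circ> \<gamma> e) {0..1}"
        using uw(5) inj_invert by (intro comp_inj_on) (auto simp: arc_def)
      ultimately have "arc (invert z0 \<circ> \<gamma> e)" by (simp add: arc_def)
      moreover have "pathstart (invert z0 \<circ> \<gamma> e) = (invert z0 \<circ> p) u" "pathfinish (invert z0 \<circ> \<gamma> e) = (invert z0 \<circ> p) w"
        using uw(6,7) by (simp_all add: pathstart_compose pathfinish_compose)
      ultimately show ?thesis using uw(1-4) by (intro exI[of _ u] exI[of _ w] conjI)
    qed
    show "path_image (invert z0 \<circ> \<gamma> e) \<inter> path_image (invert z0 \<circ> \<gamma> f) \<subseteq> (invert z0 \<circ> p) ` (e \<inter> f)"
      if "e \<in> E" "f \<in> E" "e \<noteq> f" for e f
      unfolding path_image_compose image_comp[symmetric] inj_on_image_Int[OF inj_invert[of z0 UNIV] subset_UNIV subset_UNIV, symmetric]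
      by (rule image_mono) (rule cross[OF that])
    show "w \<in> e" if "e \<in> E" "w \<in> V" "(invert z0 \<circ> p) w \<in> path_image (invert z0 \<circ> \<gamma> e)" for e w
      using that vertex_on[of e w] unfolding path_image_compose by (auto simp: inv_eq)
  qed
qed

text \<open>A finite union of closed sets with empty interior has empty interior, so the arcs cannot
  cover a nonempty open set.\<close>

lemma (in plane_drawing) point_off_drawing:
  assumes "open U" "U \<noteq> {}"
  shows "\<exists>z\<in>U. \<forall>e\<in>E. z \<notin> path_image (\<gamma> e)"
proof -
  have "interior (\<Union>e\<in>F. path_image (\<gamma> e)) = {} \<and> closed (\<Union>e\<in>F. path_image (\<gamma> e))" if "finite F" "F \<subseteq> E" for F
    using that
  proof (induction F rule: finite_induct)
    case (insert e F)
    have "arc (\<gamma> e)" using insert arc_image by simp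
    then have "interior (path_image (\<gamma> e)) = {}" "closed (path_image (\<gamma> e))"
      using interior_arc_image closed_arc_image by blast+
    then show ?case using insert interior_closed_Un_empty_interior[of "path_image (\<gamma> e)" "\<Union>e\<in>F. path_image (\<gamma> e)"] by auto
  qed simp
  from this[OF finE] have i: "interior (\<Union>e\<in>E. path_image (\<gamma> e)) = {}" by simp
  show ?thesis
  proof (rule ccontr)
    assume "\<not> ?thesis"
    then have "U \<subseteq> (\<Union>e\<in>E. path_image (\<gamma> e))" by blast
    then have "U \<subseteq> interior (\<Union>e\<in>E. path_image (\<gamma> e))" using assms(1) by (rule interior_maximal)
    then show False using i assms(2) by simp
  qed
qed

lemma inversion_inside':
  fixes J :: "complex set"
  assumes "compact J" "z0 \<in> inside J" "w \<in> outside J"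
  shows "invert z0 w \<in> inside (invert z0 ` J)"
proof -
  have "invert z0 = (\<lambda>z. inverse (z - z0))" by (rule ext) (simp add: invert_def)
  then show ?thesis using inversion_inside[OF assms] by simp
qed

text \<open>One path joined with the reverse of the other is a simple closed curve, to which the
  Jordan curve theorem applies.\<close>

lemma disc_nonempty:
  assumes pl: "plane V E p \<gamma>" and cyc: "cyc E B T"
  shows "inside (plane_drawing.im \<gamma> (pedges B \<union> pedges T)) \<noteq> {}"
proof -
  interpret plane_drawing V E p \<gamma> by standard (rule pl)
  obtain s B' T' t where st: "B = s # B' @ [t]" "T = s # T' @ [t]" "set B \<inter> set T = {s, t}" "s \<noteq> t"
    using cycE[OF cyc] .
  have ds: "distinct B" "distinct T" and es: "pedges B \<subseteq> E" "pedges T \<subseteq> E" using cyc by (auto simp: cyc_def)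
  obtain g1 where g1: "arc g1" "path_image g1 = im (pedges B)" "pathstart g1 = p s" "pathfinish g1 = p t"
    using path_arc[OF ds(1) _ es(1)] st by auto
  obtain g2 where g2: "arc g2" "path_image g2 = im (pedges T)" "pathstart g2 = p s" "pathfinish g2 = p t"
    using path_arc[OF ds(2) _ es(2)] st by auto
  have "simple_path (g1 +++ reversepath g2)"
  proof (rule simple_path_join_loop)
    show "path_image g1 \<inter> path_image (reversepath g2) \<subseteq> {pathstart g1, pathstart (reversepath g2)}"
      using cyc_im[OF cyc] g1 g2 st by simp
  qed (use g1 g2 in \<open>auto simp: arc_reversepath\<close>)
  then have "inside (path_image (g1 +++ reversepath g2)) \<noteq> {}"
    using Jordan_inside_outside[of "g1 +++ reversepath g2"] g1 g2 by simp
  moreover have "path_image (g1 +++ reversepath g2) = im (pedges B \<union> pedges T)"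
    using g1 g2 by (simp add: path_image_join im_Un)
  ultimately show ?thesis by simp
qed

section \<open>Three-connected graphs\<close>

text \<open>Demanded of \<open>{x, y}\<close> for all vertices \<open>x\<close> and
  \<open>y\<close>, equal ones included, this is three-connectivity once there are four
  vertices.\<close>

definition conn_avoiding :: "'a set \<Rightarrow> 'a set set \<Rightarrow> 'a set \<Rightarrow> bool" where
  "conn_avoiding V E X \<longleftrightarrow> (\<forall>a\<in>V - X. \<forall>b\<in>V - X. (a, b) \<in> (step E (- X))\<^sup>*)"

lemma step_delete_vertex: "step E (- insert v X) \<subseteq> step {e \<in> E. v \<notin> e} (- X)"
  by (auto simp: step_def)

lemma cyc_restrict: "cyc E B T \<Longrightarrow> pedges B \<union> pedges T \<subseteq> F \<Longrightarrow> cyc F B T"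
  unfolding cyc_def by simp

lemma neighbour_exists:
  assumes "(a, b) \<in> (step E W)\<^sup>*" "a \<noteq> b"
  shows "\<exists>c. {a, c} \<in> E \<and> a \<in> W \<and> c \<in> W"
  using assms(1)
proof (cases rule: converse_rtranclE)
  case base
  then show ?thesis using assms(2) by simp
next
  case (step y)
  then show ?thesis by (auto simp: step_def)
qed

text \<open>Without \<open>v\<close>, the vertex \<open>c\<close> still has two neighbours
  \<open>w1\<close> and \<open>w2\<close>, and a path avoiding \<open>c\<close> joins them. Four
  vertices ensure that each time something is left to be reached from \<open>c\<close>.\<close>

lemma three_conn_cycle:
  assumes EH: "EH = {e \<in> E. v \<notin> e}" and doub: "\<And>e. e \<in> E \<Longrightarrow> \<exists>u w. u \<noteq> w \<and> e = {u, w}" and three: "\<And>x y. x \<in> V \<Longrightarrow> y \<in> V \<Longrightarrow> conn_avoiding V E {x, y}"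
    and EV: "\<And>e. e \<in> E \<Longrightarrow> e \<subseteq> V" and card: "card V \<ge> 4" and v: "v \<in> V" and c: "c \<in> V" "c \<noteq> v"
  shows "\<exists>B T. cyc EH B T"
proof -
  have fin: "finite V" using card by (metis card.infinite not_numeral_le_zero)
  have big: "\<exists>d\<in>V. d \<notin> X" if "finite X" "card X < 4" for X
    using card that card_mono[of X V] by (metis fin leD le_trans not_le subsetI)
  have d3: "\<exists>d\<in>V. d \<notin> {a, b, f}" for a b f
    by (rule big) (auto simp: card_insert_if)
  obtain d where d: "d \<in> V" "d \<notin> {c, v, v}" using d3 by blast
  have "(c, d) \<in> (step E (- {v, v}))\<^sup>*"
    using three[OF v v] d c unfolding conn_avoiding_def by blast
  then obtain w1 where w1: "{c, w1} \<in> E" "w1 \<noteq> v" using neighbour_exists[of c d] d by blast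
  have w1V: "w1 \<in> V" using EV[OF w1(1)] by simp
  have w1c: "w1 \<noteq> c" using doub[OF w1(1)] by auto
  obtain d2 where d2: "d2 \<in> V" "d2 \<notin> {c, w1, v}" using d3 by blast
  have "(c, d2) \<in> (step E (- {w1, v}))\<^sup>*"
    using three[OF w1V v] d2 c w1c unfolding conn_avoiding_def by blast
  then obtain w2 where w2: "{c, w2} \<in> E" "w2 \<notin> {w1, v}" using neighbour_exists[of c d2] d2 by blast
  have w2c: "w2 \<noteq> c" using doub[OF w2(1)] by auto
  have w2V: "w2 \<in> V" using EV[OF w2(1)] by simp
  have "(w2, w1) \<in> (step E (- {c, v}))\<^sup>*"
    using three[OF c(1) v] w1 w2 w1V w2V w1c w2c unfolding conn_avoiding_def by blast
  moreover have "w2 \<in> - {c, v}" using w2 w2c by simp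
  ultimately obtain P where P: "distinct P" "P \<noteq> []" "hd P = w2" "last P = w1" "set P \<subseteq> - {c, v}" "pedges P \<subseteq> E"
    using step_rtrancl_path by metis
  have PE: "pedges P \<subseteq> EH" unfolding EH using P(5,6) pedges_subset by fastforce
  obtain P' where P': "P = w2 # P'" using P(2,3) by (cases P) auto
  have pcP: "pedges (c # P) = insert {c, w2} (pedges P)" using P' by simp
  have cP: "c \<notin> set P" using P(5) by blast
  have "cyc EH [c, w1] (c # P)"
  proof (rule cycI[where s = c and t = w1])
    show "pedges [c, w1] \<subseteq> EH" "pedges (c # P) \<subseteq> EH" unfolding pcP using PE w1 w2 c unfolding EH by auto
    show "set [c, w1] \<inter> set (c # P) = {c, w1}" using P(2,4) by auto
    have "{c, w1} \<notin> pedges P" using pedges_subset[of "{c, w1}" P] cP by blast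
    moreover have "{c, w1} \<noteq> {c, w2}" using w2(2) by (auto simp: doubleton_eq_iff)
    ultimately show "pedges [c, w1] \<inter> pedges (c # P) = {}" unfolding pcP by simp
  qed (use P cP w1c in auto)
  then show ?thesis by blast
qed

text \<open>If \<open>v\<close> lies outside the cycle, an inversion at a point inside brings
  \<open>v\<close> inside. The centre must be off all edges so that they remain arcs.\<close>

lemma inverted_side:
  assumes pl: "plane V E p \<gamma>" and v: "v \<in> V" and cyc: "cyc {e \<in> E. v \<notin> e} B T" and vJ: "v \<notin> set B \<union> set T"
  shows "\<exists>p \<gamma>. plane V E p \<gamma> \<and> v \<in> plane_drawing.ivp V p \<gamma> (pedges B \<union> pedges T)"
proof -
  interpret D: plane_drawing V E p \<gamma> by standard (rule pl)
  let ?Z = "pedges B \<union> pedges T"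
  have cycE': "cyc E B T" using cyc unfolding cyc_def by auto
  have Z: "?Z \<subseteq> E" using cycE' by (rule D.cyc_sub)
  show ?thesis
  proof (cases "v \<in> D.ivp ?Z")
    case False
    have "p v \<notin> D.im ?Z" using D.vertex_im[OF Z v] cyc_Union[OF cycE'] vJ by blast
    moreover have "p v \<notin> inside (D.im ?Z)" using False v by (simp add: D.ivp_def)
    ultimately have out: "p v \<in> outside (D.im ?Z)" using inside_Un_outside[of "D.im ?Z"] by blast
    have opn: "open (inside (D.im ?Z))" by (rule open_inside) (rule D.closed_im[OF Z])
    obtain z0 where z0: "z0 \<in> inside (D.im ?Z)" "\<forall>e\<in>E. z0 \<notin> path_image (\<gamma> e)"
      using D.point_off_drawing[OF opn disc_nonempty[OF pl cycE']] by blast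
    have pl': "plane V E (invert z0 \<circ> p) (\<lambda>e. invert z0 \<circ> \<gamma> e)" by (rule plane_invert[OF pl]) (use z0 in blast)
    interpret I: plane_drawing V E "invert z0 \<circ> p" "\<lambda>e. invert z0 \<circ> \<gamma> e" by standard (rule pl')
    have im: "I.im F = invert z0 ` D.im F" for F unfolding I.im_def D.im_def by (auto simp: path_image_compose)
    have "invert z0 (p v) \<in> inside (invert z0 ` D.im ?Z)"
      by (rule inversion_inside'[OF D.compact_im[OF Z] z0(1) out])
    then have "v \<in> I.ivp ?Z" using v by (simp add: I.ivp_def im)
    then show ?thesis using pl' by blast
  qed (use pl in blast)
qed

theorem three_conn_stack:
  assumes pl0: "plane V E p0 \<gamma>0" and cv: "{c, v} \<in> E" "c \<noteq> v" and card: "card V \<ge> 4"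
    and three: "\<And>x y. x \<in> V \<Longrightarrow> y \<in> V \<Longrightarrow> conn_avoiding V E {x, y}"
  shows "\<exists>C. stacks E {c} [c] (V - {v}) (c # C) \<and> nbrs E V v \<subseteq> set (c # C)"
proof -
  define EH where "EH = {e \<in> E. v \<notin> e}"
  define VH where "VH = V - {v}"
  interpret D0: plane_drawing V E p0 \<gamma>0 by standard (rule pl0)
  have EV: "e \<subseteq> V" if "e \<in> E" for e using that by (rule D0.edge_sub)
  have doub: "\<exists>u w. u \<noteq> w \<and> e = {u, w}" if "e \<in> E" for e using D0.edge[OF that] by blast
  have cV: "c \<in> V" "v \<in> V" using EV[OF cv(1)] by auto
  have EHsub: "EH \<subseteq> E" by (auto simp: EH_def)
  have EHV: "e \<subseteq> VH" if "e \<in> EH" for e using that EV by (auto simp: EH_def VH_def)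
  obtain B0 T0 where cyc0: "cyc EH B0 T0"
    using three_conn_cycle[OF EH_def doub three EV card cV(2,1) cv(2)] by blast
  have cycV: "v \<notin> set B \<union> set T" if "cyc EH B T" for B T
    using cyc_Union[OF that] that EHV unfolding cyc_def VH_def by blast
  obtain p \<gamma> where pl: "plane V E p \<gamma>" and v0: "v \<in> plane_drawing.ivp V p \<gamma> (pedges B0 \<union> pedges T0)"
    using inverted_side[OF pl0 cV(2) cyc0[unfolded EH_def] cycV[OF cyc0]] by blast
  interpret D: plane_drawing V E p \<gamma> by standard (rule pl)
  have plH: "plane VH EH p \<gamma>" by (rule plane_subgraph[OF pl _ EHsub EHV]) (auto simp: VH_def)
  interpret H: plane_drawing VH EH p \<gamma> by standard (rule plH)
  have ivH: "H.ivp Z = D.ivp Z - {v}" for Z by (simp only: H.ivp_def D.ivp_def) (auto simp: VH_def)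
  have ieH: "H.iep Z = D.iep Z \<inter> EH" for Z unfolding H.iep_def D.iep_def using EHsub by auto
  \<comment> \<open>A cycle avoiding \<open>v\<close> that has \<open>v\<close> inside and as few
    edges inside as possible bounds the face of the remaining graph that contains
    \<open>v\<close>.\<close>
  define good where "good BT \<longleftrightarrow> cyc EH (fst BT) (snd BT) \<and> v \<in> D.ivp (pedges (fst BT) \<union> pedges (snd BT))" for BT
  have "good (B0, T0)" using cyc0 v0 by (simp add: good_def)
  then obtain BT where BT: "good BT" and min: "\<And>BT'. good BT' \<Longrightarrow>
      card (D.iep (pedges (fst BT) \<union> pedges (snd BT))) \<le> card (D.iep (pedges (fst BT') \<union> pedges (snd BT')))"
    using ex_has_least_nat[of good "(B0, T0)" "\<lambda>BT. card (D.iep (pedges (fst BT) \<union> pedges (snd BT)))"] by blast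
  define B where "B = fst BT"
  define T where "T = snd BT"
  let ?Z = "pedges B \<union> pedges T"
  have cycH: "cyc EH B T" and vin: "v \<in> D.ivp ?Z" using BT by (auto simp: good_def B_def T_def)
  have cycD: "cyc E B T" using cycH EHsub unfolding cyc_def by auto
  have ZE: "?Z \<subseteq> E" and ZEH: "?Z \<subseteq> EH" using cycH EHsub by (auto simp: cyc_def)
  have UZ: "\<Union>?Z = set B \<union> set T" by (rule cyc_Union[OF cycH])
  \<comment> \<open>A chord avoiding \<open>v\<close> would split the disc, and the half containing
    \<open>v\<close> would be a better choice.\<close>
  have nochord: False if ch: "H.chord ?Z x P y" and xy: "x \<in> set B \<union> set T" "y \<in> set B \<union> set T" "x \<noteq> y" for x P y
  proof -
    have chD: "D.chord ?Z x P y" using ch unfolding H.chord_def D.chord_def ivH ieH by blast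
    have vP: "v \<notin> set P" using ch unfolding H.chord_def ivH by blast
    obtain B1 T1 B2 T2 Q F where sp: "cyc E B1 T1" "cyc E B2 T2" "set Q = set P" "F \<noteq> {}" "F = pedges (x # P @ [y])"
      "D.splits ?Z (pedges B1 \<union> pedges T1) (pedges B2 \<union> pedges T2) Q F"
      "F \<subseteq> pedges B1 \<union> pedges T1" "F \<subseteq> pedges B2 \<union> pedges T2"
      "pedges B1 \<union> pedges T1 \<union> pedges B2 \<union> pedges T2 \<subseteq> ?Z \<union> F"
      using D.chord_splits[OF cycD xy chD] by metis
    have FH: "F \<subseteq> EH" using ch unfolding sp(5) H.chord_def ieH by blast
    have c1: "cyc EH B1 T1" by (rule cyc_restrict[OF sp(1)]) (use sp(9) FH ZEH in blast)
    have c2: "cyc EH B2 T2" by (rule cyc_restrict[OF sp(2)]) (use sp(9) FH ZEH in blast)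
    have iv: "D.ivp ?Z = D.ivp (pedges B1 \<union> pedges T1) \<union> D.ivp (pedges B2 \<union> pedges T2) \<union> set P"
      and ie: "D.iep ?Z = D.iep (pedges B1 \<union> pedges T1) \<union> D.iep (pedges B2 \<union> pedges T2) \<union> F"
      using sp(6)[unfolded D.splits_def sp(3)] by blast+
    have l1: "card (D.iep (pedges B1 \<union> pedges T1)) < card (D.iep ?Z)"
      using D.ie_disjoint[OF sp(1)] sp(4,7) ie by (intro psubset_card_mono D.finite_ie) blast
    have l2: "card (D.iep (pedges B2 \<union> pedges T2)) < card (D.iep ?Z)"
      using D.ie_disjoint[OF sp(2)] sp(4,8) ie by (intro psubset_card_mono D.finite_ie) blast
    have "v \<in> D.ivp (pedges B1 \<union> pedges T1) \<or> v \<in> D.ivp (pedges B2 \<union> pedges T2)" using vin iv vP by blast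
    then show False
    proof
      assume "v \<in> D.ivp (pedges B1 \<union> pedges T1)"
      then show False using min[of "(B1, T1)"] c1 l1 by (simp add: good_def B_def T_def)
    next
      assume "v \<in> D.ivp (pedges B2 \<union> pedges T2)"
      then show False using min[of "(B2, T2)"] c2 l2 by (simp add: good_def B_def T_def)
    qed
  qed
  have JV: "set B \<union> set T \<subseteq> VH" using H.cyc_in_V[OF cycH] .
  have Jout: "x \<notin> D.ivp ?Z" if "x \<in> set B \<union> set T" for x using D.iv_disjoint[OF cycD] that by blast
  have reachH: "(a, b) \<in> (step EH (- {x}))\<^sup>*" if "a \<in> VH" "b \<in> VH" "a \<noteq> x" "b \<noteq> x" "x \<in> V" for a b x
  proof -
    have "(a, b) \<in> (step E (- {v, x}))\<^sup>*" using three[OF cV(2) that(5)] that(1-4) unfolding conn_avoiding_def VH_def by blast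
    then show ?thesis using rtrancl_mono[OF step_delete_vertex[of E v "{x}"]] unfolding EH_def by blast
  qed
  obtain s t where st: "s \<in> set B \<union> set T" "t \<in> set B \<union> set T" "s \<noteq> t" by (rule cycE[OF cycH]) auto
  \<comment> \<open>Another inside vertex would have two different exits, since deleting
    \<open>v\<close> and one more vertex leaves the graph connected, and two exits give a
    chord.\<close>
  have ivZ: "D.ivp ?Z = {v}"
  proof (rule ccontr)
    assume "D.ivp ?Z \<noteq> {v}"
    then obtain w where w: "w \<in> D.ivp ?Z" "w \<noteq> v" using vin by blast
    then have wH: "w \<in> H.ivp ?Z" by (simp add: ivH)
    have wV: "w \<in> VH" using w subsetD[OF D.iv_V w(1)] by (simp add: VH_def)
    have ex: "\<exists>a b. (w, a) \<in> (step EH (H.ivp ?Z))\<^sup>* \<and> a \<in> H.ivp ?Z \<and> {a, b} \<in> EH \<and> b \<in> set B \<union> set T \<and> b \<notin> {x}"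
      if "x \<in> V" "x \<noteq> w" "k \<in> set B \<union> set T" "k \<noteq> x" for x k
    proof (rule H.exit_inside[OF cycH wH])
      show "(w, k) \<in> (step EH (- {x}))\<^sup>*" by (rule reachH) (use that wV JV in auto)
      show "k \<notin> H.ivp ?Z" using Jout[OF that(3)] by (simp add: ivH)
    qed
    have vs: "v \<noteq> s" using cycV[OF cycH] st by blast
    obtain a1 b1 where 1: "(w, a1) \<in> (step EH (H.ivp ?Z))\<^sup>*" "a1 \<in> H.ivp ?Z" "{a1, b1} \<in> EH" "b1 \<in> set B \<union> set T"
      using ex[of v s] cV(2) w(2) st(1) vs by blast
    have "b1 \<in> V" "b1 \<noteq> w" using 1(4) JV w(1) Jout[OF 1(4)] by (auto simp: VH_def)
    moreover obtain k where "k \<in> set B \<union> set T" "k \<noteq> b1" using st by metis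
    ultimately obtain a2 b2 where 2: "(w, a2) \<in> (step EH (H.ivp ?Z))\<^sup>*" "a2 \<in> H.ivp ?Z" "{a2, b2} \<in> EH"
      "b2 \<in> set B \<union> set T" "b2 \<noteq> b1" using ex[of b1 k] by blast
    obtain P where "H.chord ?Z b1 P b2"
      using H.chord_from_exits[OF cycH 1(2,1,3) 2(2,1,3)] by blast
    then show False using nochord[of b1 P b2] 1(4) 2(4,5) by blast
  qed
  have ieZ: "v \<in> e" if e: "e \<in> D.iep ?Z" for e
  proof (rule ccontr)
    assume v: "v \<notin> e"
    have eE: "e \<in> E" using e subsetD[OF D.ie_E] by blast
    obtain a b where ab: "a \<noteq> b" "e = {a, b}" using doub[OF eE] by blast
    have "a \<in> set B \<union> set T" "b \<in> set B \<union> set T"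
      using D.end_inside[OF cycD e] ab v unfolding ivZ by auto
    moreover have abH: "{a, b} \<in> EH" using eE v ab by (simp add: EH_def)
    have "{a, b} \<in> H.iep ?Z" unfolding ieH using e ab(2) abH by blast
    then have "H.chord ?Z a [] b" by (rule H.edge_chord)
    ultimately show False using nochord[of a "[]" b] ab(1) by blast
  qed
  have nbJ: "w \<in> set B \<union> set T" if "{v, w} \<in> E" for w
    using D.end_inside[OF cycD D.edge_inside[OF cycD vin that], of w] doub[OF that] ivZ by auto
  have cJ: "c \<in> set B \<union> set T" by (rule nbJ) (use cv in \<open>simp add: insert_commute\<close>)
  \<comment> \<open>This inversion is centred at \<open>v\<close> itself, which is possible because
    \<open>v\<close> and its edges are absent from \<open>VH\<close> and \<open>EH\<close>.\<close>
  define z0 where "z0 = p v"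
  have z0: "z0 \<in> inside (D.im ?Z)" using vin by (simp add: D.ivp_def z0_def)
  have z0off: "z0 \<notin> path_image (\<gamma> e)" if "e \<in> EH" for e
    using D.vertex_on[of e v] that cV(2) unfolding z0_def EH_def by blast
  have plI: "plane VH EH (invert z0 \<circ> p) (\<lambda>e. invert z0 \<circ> \<gamma> e)" by (rule plane_invert[OF plH z0off])
  interpret I: plane_drawing VH EH "invert z0 \<circ> p" "\<lambda>e. invert z0 \<circ> \<gamma> e" by standard (rule plI)
  have imI: "I.im F = invert z0 ` D.im F" for F unfolding I.im_def D.im_def by (auto simp: path_image_compose)
  have inv_in: "invert z0 z \<in> inside (I.im ?Z)" if "z \<in> outside (D.im ?Z)" for z
    unfolding imI by (rule inversion_inside'[OF D.compact_im[OF ZE] z0 that])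
  have ivI: "I.ivp ?Z = VH - (set B \<union> set T)"
  proof
    show "I.ivp ?Z \<subseteq> VH - (set B \<union> set T)" using I.iv_disjoint[OF cycH] I.iv_V by blast
    show "VH - (set B \<union> set T) \<subseteq> I.ivp ?Z"
    proof
      fix w assume w: "w \<in> VH - (set B \<union> set T)"
      then have "w \<notin> D.ivp ?Z" "w \<in> V" by (auto simp: ivZ VH_def)
      then have "p w \<notin> inside (D.im ?Z)" by (simp add: D.ivp_def)
      moreover have "p w \<notin> D.im ?Z" using D.vertex_im[OF ZE \<open>w \<in> V\<close>] UZ w by blast
      ultimately have "p w \<in> outside (D.im ?Z)" using inside_Un_outside[of "D.im ?Z"] by blast
      then show "w \<in> I.ivp ?Z" using inv_in[of "p w"] w by (simp add: I.ivp_def)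
    qed
  qed
  have ieI: "e \<in> I.iep ?Z \<union> ?Z" if e: "e \<in> EH" for e
  proof (cases "e \<in> ?Z")
    case False
    have eE: "e \<in> E" using e EHsub by blast
    have d: "D.oe e \<inter> D.im ?Z = {}" by (rule D.oe_im_disjoint[OF ZE eE False])
    have "e \<notin> D.iep ?Z" using ieZ e by (auto simp: EH_def)
    then have "\<not> D.oe e \<subseteq> inside (D.im ?Z)" using eE by (simp add: D.iep_def)
    then have "D.oe e \<inter> inside (D.im ?Z) = {}"
      using connected_subset_inside[OF D.oe_facts(1)[OF eE] d D.closed_im[OF ZE]] by blast
    then have out: "D.oe e \<subseteq> outside (D.im ?Z)" using d inside_Un_outside[of "D.im ?Z"] by blast
    have "I.oe e = invert z0 ` D.oe e"
      unfolding I.oe_def D.oe_def path_image_compose image_comp[symmetric]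
      by (rule inj_on_image_set_diff[OF inj_invert[of z0 UNIV] subset_UNIV subset_UNIV, symmetric])
    then have "I.oe e \<subseteq> inside (I.im ?Z)" using inv_in out by auto
    then show ?thesis using e by (simp add: I.iep_def)
  qed simp
  obtain w T' where cw: "cyc EH [c, w] T'" and Zeq: "pedges [c, w] \<union> pedges T' = ?Z"
    using cyc_rotate[OF cycH cJ] by blast
  have UZ': "set [c, w] \<union> set T' = set B \<union> set T" using cyc_Union[OF cw] unfolding Zeq UZ by simp
  obtain M where M: "T' = c # M @ [w]" "c \<noteq> w" by (rule cycE[OF cw]) auto
  have setT': "set T' = set B \<union> set T" using UZ' M by auto
  have dT': "distinct T'" using cw by (simp add: cyc_def)
  \<comment> \<open>A walk from \<open>u\<close> to \<open>v\<close> avoiding \<open>x\<close> and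
    \<open>y\<close> enters \<open>v\<close> through one of its neighbours, and these all lie on the
    cycle.\<close>
  have attK: "I.attached (set T')"
    unfolding I.attached_def
  proof (intro ballI impI)
    fix u x y assume u: "u \<in> VH" "x \<in> VH" "y \<in> VH" "u \<noteq> x" "u \<noteq> y"
    have "(z \<noteq> v \<and> (u, z) \<in> (step EH (- {x, y}))\<^sup>*) \<or> (\<exists>k\<in>set T'. (u, k) \<in> (step EH (- {x, y}))\<^sup>*)"
      if "(u, z) \<in> (step E (- {x, y}))\<^sup>*" for z
      using that
    proof (induction rule: rtrancl_induct)
      case base
      then show ?case using u by (auto simp: VH_def)
    next
      case (step y' z)
      then show ?case
      proof (cases "\<exists>k\<in>set T'. (u, k) \<in> (step EH (- {x, y}))\<^sup>*")
        case False
        then have y': "y' \<noteq> v" "(u, y') \<in> (step EH (- {x, y}))\<^sup>*" using step.IH by blast+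
        have yz: "{y', z} \<in> E" "y' \<notin> {x, y}" "z \<notin> {x, y}" using step(2) by (auto simp: step_def)
        have "z \<noteq> v"
        proof
          assume "z = v"
          then have "y' \<in> set T'" using nbJ[of y'] yz(1) setT' by (simp add: insert_commute)
          then show False using False y' by blast
        qed
        then have "(y', z) \<in> step EH (- {x, y})" using yz y' by (auto simp: step_def EH_def)
        then show ?thesis using y' \<open>z \<noteq> v\<close> rtrancl_into_rtrancl by metis
      qed blast
    qed
    moreover have "(u, v) \<in> (step E (- {x, y}))\<^sup>*"
      using three[of x y] u cV(2) unfolding conn_avoiding_def VH_def by blast
    ultimately show "\<exists>k\<in>set T'. (u, k) \<in> (step EH (- {x, y}))\<^sup>*" by blast
  qed
  have iv2: "I.ivp (pedges [c, w] \<union> pedges T') = VH - set T'" unfolding Zeq ivI setT' ..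
  have fill: "I.fillable (set T') {c, w} [c, w] T'"
    unfolding I.fillable_def
  proof (intro conjI ballI impI cw)
    show "set [c, w] \<subseteq> {c, w}" by simp
    show "{c, w} \<inter> I.ivp (pedges [c, w] \<union> pedges T') = {}" unfolding iv2 using M by auto
    show "{c, w} \<inter> set T' = {hd T', last T'}" using M by auto
    show "set T' \<inter> I.ivp (pedges [c, w] \<union> pedges T') = {}" unfolding iv2 by blast
    show "e \<in> I.iep (pedges [c, w] \<union> pedges T') \<union> (pedges [c, w] \<union> pedges T')" if "e \<in> EH" for e
      unfolding Zeq using ieI[OF that] by blast
  qed
  have TVH: "set T' \<subseteq> VH" using setT' JV by simp
  have "{c, w} \<union> I.ivp (pedges [c, w] \<union> pedges T') \<union> set T' = VH" unfolding iv2 using TVH M by auto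
  with I.fillable_filled[OF attK fill, rule_format, of "[]" "[]"]
  have s1: "stacks EH {c, w} [c, w] VH T'" by simp
  have cw': "{c, w} \<in> EH" using cw by (simp add: cyc_def)
  have "stacks EH {c} [c] (insert w {c}) ([c] @ w # [])"
  proof (rule stacks_add[where B = "[]"])
    show "stacks EH {c} [c] {c} ([c] @ [] @ [])" using stacks_refl[of EH "{c}" "[c]"] by simp
  qed (use M(2) cw' in \<open>auto simp: nbrs_def insert_commute\<close>)
  then have s2: "stacks EH {c} [c] {c, w} [c, w]" by (simp add: insert_commute)
  have "stacks EH {c} [c] VH T'" by (rule stacks_trans[OF s1 s2])
  \<comment> \<open>\<open>E\<close> and \<open>EH\<close> differ only in the edges at
    \<open>v\<close>, and \<open>v\<close> is not placed.\<close>
  then have "stacks E ({c} \<union> {}) ([] @ [c] @ []) (VH \<union> {}) ([] @ T' @ [])"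
  proof (rule stacks_frame)
    show "{x, y} \<in> E \<longleftrightarrow> {x, y} \<in> EH \<and> y \<in> VH" if "x \<in> VH - {c}" "y \<in> VH \<union> {}" for x y
      using that by (auto simp: EH_def VH_def)
  qed simp
  then have "stacks E {c} [c] (V - {v}) (c # (M @ [w]))" using M by (simp add: VH_def)
  moreover have "nbrs E V v \<subseteq> set (c # M @ [w])" using nbJ setT' M by (auto simp: nbrs_def)
  ultimately show ?thesis by blast
qed

section \<open>Separation pairs\<close>

definition graph_plane :: "'a set \<Rightarrow> 'a set set \<Rightarrow> bool" where
  "graph_plane V E \<longleftrightarrow> (\<exists>p \<gamma>. plane V E p \<gamma>)"

definition two_conn :: "'a set \<Rightarrow> 'a set set \<Rightarrow> bool" where
  "two_conn V E \<longleftrightarrow> (\<forall>x\<in>V. conn_avoiding V E {x})"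

lemma graph_plane_edge:
  assumes "graph_plane V E" "e \<in> E"
  obtains u w where "u \<in> V" "w \<in> V" "u \<noteq> w" "e = {u, w}"
proof -
  obtain p \<gamma> where "plane V E p \<gamma>" using assms(1) unfolding graph_plane_def by blast
  then interpret plane_drawing V E p \<gamma> by (rule plane_drawing.intro)
  show ?thesis using edge[OF assms(2)] that by blast
qed

lemma graph_plane_finite: "graph_plane V E \<Longrightarrow> finite V"
  unfolding graph_plane_def plane_def by blast

definition sep :: "'a set \<Rightarrow> 'a set set \<Rightarrow> 'a \<Rightarrow> 'a \<Rightarrow> 'a set \<Rightarrow> 'a set \<Rightarrow> bool" where
  "sep V E x y U1 U2 \<longleftrightarrow> x \<noteq> y \<and> V = U1 \<union> U2 \<union> {x, y} \<and> U1 \<inter> U2 = {} \<and> x \<notin> U1 \<union> U2 \<and> y \<notin> U1 \<union> U2 \<and>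
     U1 \<noteq> {} \<and> U2 \<noteq> {} \<and> (\<forall>r\<in>U1. \<forall>s\<in>U2. {r, s} \<notin> E)"

text \<open>
  One side of a separation pair, with the pair itself as virtual edge.
\<close>

definition side :: "'a set set \<Rightarrow> 'a \<Rightarrow> 'a \<Rightarrow> 'a set \<Rightarrow> 'a set set" where
  "side E x y U = insert {x, y} {e \<in> E. e \<subseteq> U \<union> {x, y}}"

lemma sep_swap_sides:
  assumes "sep V E x y U1 U2" shows "sep V E x y U2 U1"
proof -
  have a: "\<forall>r\<in>U1. \<forall>s\<in>U2. {r, s} \<notin> E" using assms by (simp add: sep_def)
  have "{r, s} \<notin> E" if "r \<in> U2" "s \<in> U1" for r s
    using bspec[OF bspec[OF a that(2)] that(1)] by (simp add: insert_commute)
  then show ?thesis using assms unfolding sep_def by auto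
qed

lemma sep_swap_ends: "sep V E x y U1 U2 \<Longrightarrow> sep V E y x U1 U2"
  unfolding sep_def by (auto simp: insert_commute)

lemma side_swap: "side E x y U = side E y x U"
  unfolding side_def by (simp add: insert_commute)

lemma sep_neighbour:
  assumes sep: "sep V E x y U1 U2" and pl: "graph_plane V E" and e: "{r, s} \<in> E" "r \<in> U2"
  shows "s \<in> U2 \<union> {x, y}"
proof -
  have "s \<in> V" by (rule graph_plane_edge[OF pl e(1)]) (auto simp: doubleton_eq_iff)
  moreover have "s \<notin> U1" using sep e unfolding sep_def by (auto simp: insert_commute)
  ultimately show ?thesis using sep unfolding sep_def by blast
qed

text \<open>By two-connectivity a walk leads from \<open>u\<close> to \<open>y\<close> avoiding
  \<open>x\<close>, and it cannot leave \<open>U2\<close> before reaching \<open>y\<close>.\<close>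

lemma sep_exit:
  assumes sep: "sep V E x y U1 U2" and pl: "graph_plane V E" and two: "two_conn V E" and u: "u \<in> U2"
  shows "\<exists>d\<in>U2. (u, d) \<in> (step E U2)\<^sup>* \<and> {d, y} \<in> E"
proof -
  have V: "x \<in> V" "y \<in> V" "u \<in> V" "u \<noteq> x" "y \<noteq> x" using sep u unfolding sep_def by blast+
  have "(z \<in> U2 \<and> (u, z) \<in> (step E U2)\<^sup>*) \<or> (\<exists>d\<in>U2. (u, d) \<in> (step E U2)\<^sup>* \<and> {d, y} \<in> E)"
    if "(u, z) \<in> (step E (- {x}))\<^sup>*" for z
    using that
  proof (induction rule: rtrancl_induct)
    case (step r s)
    have rs: "{r, s} \<in> E" "s \<noteq> x" using step(2) by (auto simp: step_def)
    show ?case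
    proof (cases "r \<in> U2 \<and> (u, r) \<in> (step E U2)\<^sup>*")
      case True
      then have "s \<in> U2 \<or> s = y" using sep_neighbour[OF sep pl rs(1)] rs(2) by blast
      then show ?thesis
      proof
        assume "s \<in> U2"
        then have "(r, s) \<in> step E U2" using True rs by (simp add: step_def)
        then show ?thesis using True \<open>s \<in> U2\<close> rtrancl_into_rtrancl by metis
      next
        assume "s = y"
        then show ?thesis using True rs by blast
      qed
    qed (use step.IH in blast)
  qed (use u in simp)
  moreover have "(u, y) \<in> (step E (- {x}))\<^sup>*"
    using two V unfolding two_conn_def conn_avoiding_def by blast
  moreover have "y \<notin> U2" using sep unfolding sep_def by blast
  ultimately show ?thesis by blast
qed

text \<open>The component of \<open>u\<close> in \<open>U2\<close> has exits to both
  \<open>x\<close> and \<open>y\<close>, which yields the path along which the virtual edge is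
  drawn. Two-connectivity passes to the side because that edge replaces excursions through
  \<open>U2\<close>.\<close>

lemma sep_side:
  assumes sep: "sep V E x y U1 U2" and pl: "graph_plane V E" and two: "two_conn V E"
  shows "graph_plane (U1 \<union> {x, y}) (side E x y U1)" "two_conn (U1 \<union> {x, y}) (side E x y U1)"
    "card (U1 \<union> {x, y}) < card V"
proof -
  let ?V1 = "U1 \<union> {x, y}" and ?E1 = "side E x y U1"
  have s: "x \<noteq> y" "V = U1 \<union> U2 \<union> {x, y}" "U1 \<inter> U2 = {}" "x \<notin> U1 \<union> U2" "y \<notin> U1 \<union> U2" "U2 \<noteq> {}"
    "\<And>r t. r \<in> U1 \<Longrightarrow> t \<in> U2 \<Longrightarrow> {r, t} \<notin> E"
    using sep unfolding sep_def by blast+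
  obtain u where u: "u \<in> U2" using s(6) by blast
  obtain d where d: "d \<in> U2" "(u, d) \<in> (step E U2)\<^sup>*" "{d, y} \<in> E" using sep_exit[OF sep pl two u] by blast
  obtain d' where d': "d' \<in> U2" "(u, d') \<in> (step E U2)\<^sup>*" "{d', x} \<in> E"
    using sep_exit[OF sep_swap_ends[OF sep] pl two u] by blast
  have "(d', d) \<in> (step E U2)\<^sup>*" using step_rtrancl_sym[OF d'(2)] d(2) by (rule rtrancl_trans)
  from step_rtrancl_path[OF this d'(1)] obtain P where P: "distinct P" "P \<noteq> []" "hd P = d'" "last P = d" "set P \<subseteq> U2" "pedges P \<subseteq> E"
    by blast
  obtain p \<gamma> where plane: "plane V E p \<gamma>" using pl unfolding graph_plane_def by blast
  have "\<exists>\<gamma>'. plane ?V1 (insert {x, y} {e \<in> E. e \<subseteq> ?V1}) p \<gamma>'"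
  proof (rule plane_path_edge[OF plane, where L = "x # P @ [y]"])
    show "?V1 \<subseteq> V" using s by blast
    show "distinct (x # P @ [y])" using P s by auto
    obtain P1 where P1: "P = d' # P1" using P by (cases P) auto
    obtain P2 where P2: "P = P2 @ [d]" using P by (cases P rule: rev_cases) auto
    have "pedges (x # P @ [y]) = insert {x, d'} (pedges (P @ [y]))" using P1 by simp
    also have "pedges (P @ [y]) = insert {d, y} (pedges P)" using pedges_append2[of P2 d y "[]"] P2 by simp
    finally show "pedges (x # P @ [y]) \<subseteq> E" using P(6) d(3) d'(3) by (simp add: insert_commute)
    show "set (x # P @ [y]) \<inter> ?V1 = {x, y}" using P(5) s by auto
  qed auto
  then show "graph_plane ?V1 ?E1" unfolding graph_plane_def side_def by blast
  show "two_conn ?V1 ?E1"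
    unfolding two_conn_def conn_avoiding_def
  proof (intro ballI)
    fix z a b assume z: "z \<in> ?V1" and a: "a \<in> ?V1 - {z}" and b: "b \<in> ?V1 - {z}"
    \<comment> \<open>While the walk is in \<open>U2\<close>, the invariant remembers a separator
      \<open>q\<close> already reached on the side; if the walk returns through the other one, the
      virtual edge leads there from \<open>q\<close>.\<close>
    have "(r \<in> ?V1 \<and> (a, r) \<in> (step ?E1 (- {z}))\<^sup>*) \<or> (r \<in> U2 \<and> (\<exists>q\<in>{x, y} - {z}. (a, q) \<in> (step ?E1 (- {z}))\<^sup>*))"
      if "(a, r) \<in> (step E (- {z}))\<^sup>*" for r
      using that
    proof (induction rule: rtrancl_induct)
      case base
      then show ?case using a by blast
    next
      case (step r r')
      have rr: "{r, r'} \<in> E" "r \<noteq> z" "r' \<noteq> z" using step(2) by (auto simp: step_def)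
      have r'V: "r' \<in> V" by (rule graph_plane_edge[OF pl rr(1)]) (auto simp: doubleton_eq_iff)
      show ?case
        using step.IH
      proof
        assume r: "r \<in> ?V1 \<and> (a, r) \<in> (step ?E1 (- {z}))\<^sup>*"
        show ?thesis
        proof (cases "r' \<in> U2")
          case True
          then have "r \<in> {x, y} - {z}" using r rr s(7)[of r r'] by blast
          then show ?thesis using True r by blast
        next
          case False
          then have "r' \<in> ?V1" using r'V s(2) by blast
          then have "{r, r'} \<in> ?E1" using r rr(1) unfolding side_def by blast
          then have "(r, r') \<in> step ?E1 (- {z})" using rr by (simp add: step_def)
          then have "(a, r') \<in> (step ?E1 (- {z}))\<^sup>*" using r rtrancl_into_rtrancl by metis
          then show ?thesis using \<open>r' \<in> ?V1\<close> by blast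
        qed
      next
        assume r: "r \<in> U2 \<and> (\<exists>q\<in>{x, y} - {z}. (a, q) \<in> (step ?E1 (- {z}))\<^sup>*)"
        then obtain q where q: "q \<in> {x, y}" "q \<noteq> z" "(a, q) \<in> (step ?E1 (- {z}))\<^sup>*" by blast
        show ?thesis
        proof (cases "r' \<in> U2")
          case False
          then have r': "r' \<in> {x, y}" using sep_neighbour[OF sep pl rr(1)] r by blast
          have "(a, r') \<in> (step ?E1 (- {z}))\<^sup>*"
          proof (cases "q = r'")
            case False
            then have "{q, r'} = {x, y}" using q(1) r' by blast
            then have "{q, r'} \<in> ?E1" unfolding side_def by blast
            then have "(q, r') \<in> step ?E1 (- {z})" using q(2) rr(3) by (simp add: step_def)
            then show ?thesis using q(3) rtrancl_into_rtrancl by metis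
          qed (use q in simp)
          then show ?thesis using r' by blast
        qed (use q in blast)
      qed
    qed
    moreover have "(a, b) \<in> (step E (- {z}))\<^sup>*"
      using two z a b s(2) unfolding two_conn_def conn_avoiding_def by blast
    moreover have "b \<notin> U2" using b s by blast
    ultimately show "(a, b) \<in> (step ?E1 (- {z}))\<^sup>*" by blast
  qed
  show "card ?V1 < card V"
    using graph_plane_finite[OF pl] u s by (intro psubset_card_mono) blast+
qed

text \<open>
  Everything except \<open>v\<close> is placed, starting from \<open>c\<close>, and all neighbours of \<open>v\<close> are visible.
\<close>

definition apex_stack :: "'a set \<Rightarrow> 'a set set \<Rightarrow> 'a \<Rightarrow> 'a \<Rightarrow> 'a list \<Rightarrow> bool" where
  "apex_stack V E c v C \<longleftrightarrow> stacks E {c} [c] (V - {v}) (c # C) \<and> nbrs E V v \<subseteq> set (c # C)"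

text \<open>As long as \<open>y\<close> is absent, vertices of \<open>U2\<close> have no placed
  neighbours but \<open>x\<close> and each other, so their stacking from \<open>x\<close> fits
  beside \<open>x\<close> in any contour.\<close>

lemma insert_side_stack:
  assumes sep: "sep V E x y U1 U2" and ap: "apex_stack (U2 \<union> {x, y}) (side E x y U2) x y C"
    and S: "x \<in> S" "S \<subseteq> insert x U1"
  shows "stacks E S (A @ [x] @ D) (S \<union> U2) (A @ (x # C) @ D)"
proof -
  have s: "x \<noteq> y" "U1 \<inter> U2 = {}" "x \<notin> U1 \<union> U2" "y \<notin> U1 \<union> U2" "\<And>r t. r \<in> U1 \<Longrightarrow> t \<in> U2 \<Longrightarrow> {r, t} \<notin> E"
    using sep unfolding sep_def by blast+
  have V2: "U2 \<union> {x, y} - {y} = insert x U2" using s by blast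
  have st: "stacks (side E x y U2) {x} [x] (insert x U2) (x # C)" using ap V2 unfolding apex_stack_def by simp
  have "stacks E ({x} \<union> (S - {x})) (A @ [x] @ D) (insert x U2 \<union> (S - {x})) (A @ (x # C) @ D)"
  proof (rule stacks_frame[OF st])
    show "(S - {x}) \<inter> insert x U2 = {}" using S s by blast
    fix r t assume r: "r \<in> insert x U2 - {x}" and t: "t \<in> insert x U2 \<union> (S - {x})"
    show "{r, t} \<in> E \<longleftrightarrow> {r, t} \<in> side E x y U2 \<and> t \<in> insert x U2"
    proof (cases "t \<in> insert x U2")
      case True
      have "{r, t} \<noteq> {x, y}" using r s True by (auto simp: doubleton_eq_iff)
      then show ?thesis using True r unfolding side_def by auto
    next
      case False
      then have "t \<in> U1" using t S by blast
      then show ?thesis using False r s(5)[of t r] by (auto simp: insert_commute)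
    qed
  qed
  moreover have "{x} \<union> (S - {x}) = S" "insert x U2 \<union> (S - {x}) = S \<union> U2" using S by auto
  ultimately show ?thesis by simp
qed

text \<open>Here the last vertex is itself a separator. The side of \<open>c\<close> is stacked
  first, then the other side next to \<open>x\<close>.\<close>

lemma apex_separator_stack:
  assumes sep: "sep V E x v U1 U2" and pl: "graph_plane V E" and c: "c \<in> insert x U1"
    and ap1: "apex_stack (U1 \<union> {x, v}) (side E x v U1) c v C1"
    and ap2: "apex_stack (U2 \<union> {x, v}) (side E x v U2) x v C2"
  shows "\<exists>C. apex_stack V E c v C"
proof -
  have s: "x \<noteq> v" "V = U1 \<union> U2 \<union> {x, v}" "U1 \<inter> U2 = {}" "x \<notin> U1 \<union> U2" "v \<notin> U1 \<union> U2"
    using sep unfolding sep_def by blast+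
  have V1: "U1 \<union> {x, v} - {v} = insert x U1" using s by blast
  have st1: "stacks (side E x v U1) {c} [c] (insert x U1) (c # C1)"
    and nb1: "nbrs (side E x v U1) (U1 \<union> {x, v}) v \<subseteq> set (c # C1)"
    using ap1 V1 unfolding apex_stack_def by simp_all
  have nb2: "nbrs (side E x v U2) (U2 \<union> {x, v}) v \<subseteq> set (x # C2)" using ap2 unfolding apex_stack_def by simp
  have "stacks E ({c} \<union> {}) ([] @ [c] @ []) (insert x U1 \<union> {}) ([] @ (c # C1) @ [])"
  proof (rule stacks_frame[OF st1])
    fix r t assume r: "r \<in> insert x U1 - {c}" and t: "t \<in> insert x U1 \<union> {}"
    have "{r, t} \<noteq> {x, v}" using r t s by (auto simp: doubleton_eq_iff)
    then show "{r, t} \<in> E \<longleftrightarrow> {r, t} \<in> side E x v U1 \<and> t \<in> insert x U1" using r t unfolding side_def by auto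
  qed simp
  then have s1: "stacks E {c} [c] (insert x U1) (c # C1)" by simp
  \<comment> \<open>The virtual edge makes \<open>x\<close> a neighbour of \<open>v\<close>, which
    forces \<open>x\<close> onto the contour.\<close>
  have "x \<in> nbrs (side E x v U1) (U1 \<union> {x, v}) v" by (auto simp: nbrs_def side_def)
  then have "x \<in> set (c # C1)" using nb1 by blast
  then obtain A D where AD: "c # C1 = A @ x # D" by (meson split_list)
  have s2: "stacks E (insert x U1) (A @ [x] @ D) (insert x U1 \<union> U2) (A @ (x # C2) @ D)"
    by (rule insert_side_stack[OF sep ap2]) auto
  have s1': "stacks E {c} [c] (insert x U1) (A @ [x] @ D)" using s1 AD by simp
  have s12: "stacks E {c} [c] (insert x U1 \<union> U2) (A @ (x # C2) @ D)" by (rule stacks_trans[OF s2 s1'])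
  have Vv: "insert x U1 \<union> U2 = V - {v}" using s by blast
  obtain C where C: "A @ (x # C2) @ D = c # C" using AD by (cases A) auto
  have "nbrs E V v \<subseteq> set (c # C)"
  proof
    fix w assume w: "w \<in> nbrs E V v"
    then have e: "{v, w} \<in> E" "w \<in> V" by (auto simp: nbrs_def)
    have sC: "set (c # C) = set A \<union> set (x # C2) \<union> set D" using arg_cong[OF C, of set] by auto
    have sC1: "set (c # C1) = set A \<union> {x} \<union> set D" using arg_cong[OF AD, of set] by auto
    consider "w \<in> U1 \<union> {x, v}" | "w \<in> U2" using e(2) s(2) by blast
    then show "w \<in> set (c # C)"
    proof cases
      case 1
      then have "w \<in> nbrs (side E x v U1) (U1 \<union> {x, v}) v" using e(1) unfolding nbrs_def side_def by auto
      then show ?thesis using nb1 sC sC1 by auto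
    next
      case 2
      then have "w \<in> nbrs (side E x v U2) (U2 \<union> {x, v}) v" using e(1) unfolding nbrs_def side_def by auto
      then show ?thesis using nb2 sC by auto
    qed
  qed
  then show ?thesis using s12 unfolding Vv C apex_stack_def by blast
qed

text \<open>This replaces the step of the first side that places \<open>y\<close> after
  \<open>x\<close>. The other side is stacked beside \<open>x\<close> immediately before, within the
  stretch that \<open>y\<close> hides, so that \<open>y\<close> can be joined to its neighbours in
  \<open>U2\<close> as well.\<close>

lemma place_second_separator:
  assumes sep: "sep V E x y U1 U2" and pl: "graph_plane V E" and two: "two_conn V E"
    and ap: "apex_stack (U2 \<union> {x, y}) (side E x y U2) x y C"
    and S: "x \<in> S" "S \<subseteq> insert x U1" and st: "stacks E {c} [c] S (A @ B @ D)"
    and nb: "nbrs (side E x y U1) S y \<subseteq> set (take 1 (rev A)) \<union> set B \<union> set (take 1 D)"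
  shows "stacks E {c} [c] (insert y S \<union> U2) (A @ y # D)"
proof -
  have s: "x \<noteq> y" "U1 \<inter> U2 = {}" "x \<notin> U1 \<union> U2" "y \<notin> U1 \<union> U2"
    using sep unfolding sep_def by blast+
  have ins: "stacks E S (A' @ [x] @ D') (S \<union> U2) (A' @ (x # C) @ D')" for A' D'
    by (rule insert_side_stack[OF sep ap S])
  have ins': "stacks E S (A' @ [x] @ D') (S \<union> U2) (A' @ (rev C @ [x]) @ D')" for A' D'
    using stacks_rev[OF ins[of "rev D'" "rev A'"]] by simp
  \<comment> \<open>The virtual edge makes \<open>x\<close> a neighbour of \<open>y\<close>, so
    \<open>x\<close> lies in the replaced stretch or next to it.\<close>
  have "x \<in> nbrs (side E x y U1) S y" using S by (auto simp: nbrs_def side_def)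
  then consider "x \<in> set (take 1 (rev A))" | "x \<in> set B" | "x \<in> set (take 1 D)" using nb by blast
  then obtain B' where B': "stacks E S (A @ B @ D) (S \<union> U2) (A @ B' @ D)"
    "set B \<union> set C \<subseteq> set B'"
  proof cases
    case 1
    then obtain A0 where "A = A0 @ [x]" by (cases A rule: rev_cases) auto
    then show ?thesis using ins[of A0 "B @ D"] by (intro that[of "C @ B"]) auto
  next
    case 2
    then obtain B1 B2 where "B = B1 @ x # B2" by (meson split_list)
    then show ?thesis using ins[of "A @ B1" "B2 @ D"] by (intro that[of "B1 @ x # C @ B2"]) auto
  next
    case 3
    \<comment> \<open>If \<open>x\<close> bounds the stretch on the right, the mirrored block puts
      \<open>U2\<close> to the left of \<open>x\<close>.\<close>
    then obtain D0 where "D = x # D0" by (cases D) auto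
    then show ?thesis using ins'[of "A @ B" D0] by (intro that[of "B @ rev C"]) auto
  qed
  have "stacks E {c} [c] (insert y (S \<union> U2)) (A @ y # D)"
  proof (rule stacks_add[OF stacks_trans[OF B'(1) st]])
    show "y \<notin> S \<union> U2" using S s by blast
    obtain u where "u \<in> U2" using sep unfolding sep_def by blast
    then obtain d where "d \<in> U2" "{d, y} \<in> E" using sep_exit[OF sep pl two] by blast
    then show "nbrs E (S \<union> U2) y \<noteq> {}" by (auto simp: nbrs_def insert_commute)
    have nb2: "nbrs (side E x y U2) (U2 \<union> {x, y}) y \<subseteq> set (x # C)" using ap by (simp add: apex_stack_def)
    have xin: "x \<in> set (take 1 (rev A)) \<union> set B \<union> set (take 1 D)"
      using nb \<open>x \<in> nbrs (side E x y U1) S y\<close> by blast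
    show "nbrs E (S \<union> U2) y \<subseteq> set (take 1 (rev A)) \<union> set B' \<union> set (take 1 D)"
    proof
      fix w assume "w \<in> nbrs E (S \<union> U2) y"
      then have w: "{y, w} \<in> E" "w \<in> S \<or> w \<in> U2" by (auto simp: nbrs_def)
      from w(2) show "w \<in> set (take 1 (rev A)) \<union> set B' \<union> set (take 1 D)"
      proof
        assume "w \<in> S"
        then have "w \<in> nbrs (side E x y U1) S y" using w(1) S unfolding nbrs_def side_def by auto
        then show ?thesis using nb B'(2) by blast
      next
        assume "w \<in> U2"
        then have "w \<in> nbrs (side E x y U2) (U2 \<union> {x, y}) y" using w(1) unfolding nbrs_def side_def by auto
        then have "w \<in> set (x # C)" using nb2 by blast
        then show ?thesis using xin B'(2) by auto
      qed
    qed
  qed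
  then show ?thesis by simp
qed

text \<open>The stacking of the first side is replayed, and the other side is added when the pair
  becomes complete. Either separator may come second, so the other side must be stackable from
  \<open>x\<close> towards \<open>y\<close> and from \<open>y\<close> towards
  \<open>x\<close>.\<close>

lemma inner_separator_stack:
  assumes sep: "sep V E x y U1 U2" and pl: "graph_plane V E" and two: "two_conn V E"
    and v: "v \<in> U1" and c: "c \<in> U1 \<union> {x, y}" "c \<noteq> v"
    and ap1: "apex_stack (U1 \<union> {x, y}) (side E x y U1) c v C1"
    and ap2: "apex_stack (U2 \<union> {x, y}) (side E x y U2) x y C2"
    and ap3: "apex_stack (U2 \<union> {x, y}) (side E x y U2) y x C3"
  shows "\<exists>C. apex_stack V E c v C"
proof -
  have s: "x \<noteq> y" "V = U1 \<union> U2 \<union> {x, y}" "U1 \<inter> U2 = {}" "x \<notin> U1 \<union> U2" "y \<notin> U1 \<union> U2"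
    "\<And>r t. r \<in> U1 \<Longrightarrow> t \<in> U2 \<Longrightarrow> {r, t} \<notin> E"
    using sep unfolding sep_def by blast+
  let ?E1 = "side E x y U1"
  define W where "W S = (if x \<in> S \<and> y \<in> S then U2 else {})" for S
  have main: "stacks E {c} [c] (S \<union> W S) C" if "stacks ?E1 {c} [c] S C" "S \<subseteq> U1 \<union> {x, y}" for S C
    using that
  proof induction
    case stacks_refl
    have "W {c} = {}" using s(1) by (auto simp: W_def)
    then show ?case using stacks.stacks_refl[of E "{c}" "[c]"] by simp
  next
    case (stacks_drop S A B D)
    then show ?case using stacks.stacks_drop by blast
  next
    case (stacks_add S A B D z)
    have IHs: "stacks E {c} [c] (S \<union> W S) (A @ B @ D)" using stacks_add by blast
    have zV: "z \<in> U1 \<union> {x, y}" "S \<subseteq> U1 \<union> {x, y}" using stacks_add.prems by auto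
    \<comment> \<open>Steps that do not complete the pair are copied; the virtual edge does not
      occur in them.\<close>
    have simple: ?case if same: "W (insert z S) = W S" and nz: "\<And>w. w \<in> S \<union> W S \<Longrightarrow> {z, w} \<in> E \<longleftrightarrow> {z, w} \<in> ?E1 \<and> w \<in> S"
      and zW: "z \<notin> W S"
    proof -
      have nn: "nbrs E (S \<union> W S) z = nbrs ?E1 S z" using nz unfolding nbrs_def by blast
      have "stacks E {c} [c] (insert z (S \<union> W S)) (A @ z # D)"
        by (rule stacks.stacks_add[OF IHs]) (use stacks_add nn zW in auto)
      then show ?thesis using same by simp
    qed
    consider "z \<in> U1" | "z = y" "x \<notin> S" | "z = x" "y \<notin> S" | "z = y" "x \<in> S" | "z = x" "y \<in> S" using zV(1) by blast
    then show ?case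
    proof cases
      case 1
      show ?thesis
      proof (rule simple)
        show "W (insert z S) = W S" using 1 s by (auto simp: W_def)
        show "z \<notin> W S" using 1 s by (auto simp: W_def)
        fix w assume w: "w \<in> S \<union> W S"
        show "{z, w} \<in> E \<longleftrightarrow> {z, w} \<in> ?E1 \<and> w \<in> S"
        proof (cases "w \<in> S")
          case True
          have "{z, w} \<noteq> {x, y}" using 1 s by (auto simp: doubleton_eq_iff)
          then show ?thesis using True 1 zV unfolding side_def by auto
        next
          case False
          then have "w \<in> U2" using w by (auto simp: W_def split: if_splits)
          then show ?thesis using False s(6)[OF 1] by blast
        qed
      qed
    next
      case 2
      have W0: "W S = {}" "W (insert z S) = {}" using 2 s(1) by (auto simp: W_def)
      show ?thesis
      proof (rule simple)
        fix w assume "w \<in> S \<union> W S"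
        then have w: "w \<in> S" using W0 by simp
        have "{z, w} \<noteq> {x, y}" using 2 s w by (auto simp: doubleton_eq_iff)
        then show "{z, w} \<in> E \<longleftrightarrow> {z, w} \<in> ?E1 \<and> w \<in> S" using w zV unfolding side_def by auto
      qed (use W0 in auto)
    next
      case 3
      have W0: "W S = {}" "W (insert z S) = {}" using 3 s(1) by (auto simp: W_def)
      show ?thesis
      proof (rule simple)
        fix w assume "w \<in> S \<union> W S"
        then have w: "w \<in> S" using W0 by simp
        have "{z, w} \<noteq> {x, y}" using 3 s w by (auto simp: doubleton_eq_iff)
        then show "{z, w} \<in> E \<longleftrightarrow> {z, w} \<in> ?E1 \<and> w \<in> S" using w zV unfolding side_def by auto
      qed (use W0 in auto)
    next
      case 4
      have yS: "y \<notin> S" using 4 stacks_add.hyps by blast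
      then have W0: "W S = {}" "W (insert z S) = U2" using 4 by (auto simp: W_def)
      have "stacks E {c} [c] (insert y S \<union> U2) (A @ y # D)"
        by (rule place_second_separator[OF sep pl two ap2 4(2)])
          (use zV yS IHs W0 stacks_add.hyps 4 in auto)
      then show ?thesis using 4 W0 by simp
    next
      case 5
      have xS: "x \<notin> S" using 5 stacks_add.hyps by blast
      then have W0: "W S = {}" "W (insert z S) = U2" using 5 by (auto simp: W_def)
      have ap3': "apex_stack (U2 \<union> {y, x}) (side E y x U2) y x C3" using ap3 by (simp add: side_swap[of E y x] insert_commute)
      have "stacks E {c} [c] (insert x S \<union> U2) (A @ x # D)"
        by (rule place_second_separator[OF sep_swap_ends[OF sep] pl two ap3' 5(2)])
          (use zV xS IHs W0 stacks_add.hyps 5 in \<open>auto simp: side_swap[of E y x]\<close>)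
      then show ?thesis using 5 W0 by simp
    qed
  qed
  have st1: "stacks ?E1 {c} [c] (U1 \<union> {x, y} - {v}) (c # C1)"
    and nb1: "nbrs ?E1 (U1 \<union> {x, y}) v \<subseteq> set (c # C1)" using ap1 by (simp_all add: apex_stack_def)
  have vxy: "v \<noteq> x" "v \<noteq> y" "v \<notin> U2" using v s by blast+
  have Wf: "W (U1 \<union> {x, y} - {v}) = U2" using vxy by (auto simp: W_def)
  have "stacks E {c} [c] (U1 \<union> {x, y} - {v} \<union> U2) (c # C1)" using main[OF st1] unfolding Wf by blast
  moreover have "U1 \<union> {x, y} - {v} \<union> U2 = V - {v}" using s(2) vxy by blast
  moreover have "nbrs E V v \<subseteq> set (c # C1)"
  proof
    fix w assume "w \<in> nbrs E V v"
    then have w: "{v, w} \<in> E" "w \<in> V" by (auto simp: nbrs_def)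
    have "w \<notin> U2" using s(6)[OF v] w by blast
    then have "w \<in> nbrs ?E1 (U1 \<union> {x, y}) v" using w v s(2) unfolding nbrs_def side_def by auto
    then show "w \<in> set (c # C1)" using nb1 by blast
  qed
  ultimately show ?thesis unfolding apex_stack_def by auto
qed

section \<open>Connected planar graphs\<close>

lemma disconnected_sep:
  assumes pl: "graph_plane V E" and two: "two_conn V E" and x: "x \<in> V" and y: "y \<in> V"
    and dis: "\<not> conn_avoiding V E {x, y}"
  shows "\<exists>U1 U2. sep V E x y U1 U2"
proof -
  obtain a b where ab: "a \<in> V - {x, y}" "b \<in> V - {x, y}" "(a, b) \<notin> (step E (- {x, y}))\<^sup>*"
    using dis unfolding conn_avoiding_def by blast
  have xy: "x \<noteq> y"
  proof
    assume "x = y"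
    then have "conn_avoiding V E {x, y}" using two x unfolding two_conn_def by simp
    then show False using dis by blast
  qed
  define A where "A = {r. (a, r) \<in> (step E (- {x, y}))\<^sup>*}"
  have AV: "A \<subseteq> V - {x, y}"
  proof
    fix r assume "r \<in> A"
    then have "(a, r) \<in> (step E (- {x, y}))\<^sup>*" by (simp add: A_def)
    then show "r \<in> V - {x, y}"
    proof (induction rule: rtrancl_induct)
      case (step q r)
      then have qr: "{q, r} \<in> E" "r \<notin> {x, y}" by (auto simp: step_def)
      have "r \<in> V" by (rule graph_plane_edge[OF pl qr(1)]) (auto simp: doubleton_eq_iff)
      then show ?case using qr(2) by blast
    qed (use ab in simp)
  qed
  have noedge: "{r, s} \<notin> E" if "r \<in> A" "s \<in> V - {x, y} - A" for r s
  proof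
    assume "{r, s} \<in> E"
    then have "(r, s) \<in> step E (- {x, y})" using that AV by (auto simp: step_def)
    then have "s \<in> A" using that(1) unfolding A_def by (auto intro: rtrancl_into_rtrancl)
    then show False using that by blast
  qed
  have "a \<in> A" "b \<notin> A" using ab(3) by (auto simp: A_def)
  then have "sep V E x y A (V - {x, y} - A)"
    unfolding sep_def using xy x y AV ab noedge by blast
  then show ?thesis by blast
qed

lemma side_edge: "{x, y} \<in> side E x y U"
  by (simp add: side_def)

text \<open>Induction on the number of vertices: by \<open>sep_side\<close> both sides of a
  separation pair inherit the hypotheses. Fewer than four vertices are stacked by hand.\<close>

theorem two_conn_stack:
  assumes "graph_plane V E" "two_conn V E" "{c, v} \<in> E"
  shows "\<exists>C. apex_stack V E c v C"
  using assms
proof (induction "card V" arbitrary: V E c v rule: less_induct)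
  case less
  note pl = less.prems(1) and two = less.prems(2) and cv = less.prems(3)
  have fin: "finite V" using pl by (rule graph_plane_finite)
  have cvV: "c \<in> V" "v \<in> V" "c \<noteq> v"
    by (rule graph_plane_edge[OF pl cv], auto simp: doubleton_eq_iff)+
  have doub: "w \<noteq> u" if "{u, w} \<in> E" for u w
    by (rule graph_plane_edge[OF pl that]) (auto simp: doubleton_eq_iff)
  have IHs: "\<exists>C. apex_stack (U1 \<union> {x, y}) (side E x y U1) d u C"
    if "sep V E x y U1 U2" "{d, u} \<in> side E x y U1" for x y U1 U2 d u
    using less.hyps[OF sep_side(3,1,2)[OF that(1) pl two] that(2)] .
  show ?case
  proof (cases "\<forall>x\<in>V. \<forall>y\<in>V. conn_avoiding V E {x, y}")
    case three: True
    show ?thesis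
    proof (cases "card V \<ge> 4")
      case True
      obtain p \<gamma> where "plane V E p \<gamma>" using pl unfolding graph_plane_def by blast
      from three_conn_stack[OF this cv cvV(3) True] three show ?thesis unfolding apex_stack_def by blast
    next
      case small: False
      show ?thesis
      proof (cases "V = {c, v}")
        case True
        then have "V - {v} = {c}" using cvV by blast
        moreover have "nbrs E V v \<subseteq> {c}" using True doub by (auto simp: nbrs_def)
        ultimately have "apex_stack V E c v []" unfolding apex_stack_def by (simp add: stacks_refl)
        then show ?thesis by blast
      next
        case False
        then obtain w where w: "w \<in> V" "w \<noteq> c" "w \<noteq> v" using cvV by blast
        have "{c, v, w} = V"
        proof (rule card_subset_eq[OF fin])
          show "{c, v, w} \<subseteq> V" using cvV w by blast
          have "card {c, v, w} = 3" using cvV w by simp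
          moreover have "card {c, v, w} \<le> card V" by (rule card_mono[OF fin]) (use cvV w in blast)
          ultimately show "card {c, v, w} = card V" using small by simp
        qed
        then have V3: "V = {c, v, w}" by simp
        have "(c, w) \<in> (step E (- {v}))\<^sup>*"
          using two cvV w unfolding two_conn_def conn_avoiding_def by blast
        then obtain u where u: "{c, u} \<in> E" "u \<noteq> v" using neighbour_exists[of c w] w by blast
        have "u \<in> V" by (rule graph_plane_edge[OF pl u(1)]) (auto simp: doubleton_eq_iff)
        then have cw: "{c, w} \<in> E" using u doub[OF u(1)] V3 by auto
        have "stacks E {c} [c] (insert w {c}) ([c] @ w # [])"
        proof (rule stacks_add[where B = "[]"])
          show "stacks E {c} [c] {c} ([c] @ [] @ [])" using stacks_refl[of E "{c}" "[c]"] by simp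
        qed (use w cw in \<open>auto simp: nbrs_def insert_commute\<close>)
        moreover have "insert w {c} = V - {v}" using V3 cvV w by auto
        moreover have "nbrs E V v \<subseteq> set (c # [w])" using V3 doub by (auto simp: nbrs_def)
        ultimately have "apex_stack V E c v [w]" unfolding apex_stack_def by simp
        then show ?thesis by blast
      qed
    qed
  next
    case False
    then obtain x y where xy: "x \<in> V" "y \<in> V" "\<not> conn_avoiding V E {x, y}" by blast
    obtain U1 U2 where sep: "sep V E x y U1 U2" using disconnected_sep[OF pl two xy] by blast
    have VU: "V = U1 \<union> U2 \<union> {x, y}" using sep unfolding sep_def by blast
    have on_v: "\<exists>C. apex_stack V E c v C" if sp: "sep V E z v W1 W2" for z W1 W2
    proof -
      have use: "\<exists>C. apex_stack V E c v C" if sp': "sep V E z v Y1 Y2" and c: "c \<in> insert z Y1" for Y1 Y2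
      proof -
        have "{c, v} \<in> side E z v Y1" using cv c unfolding side_def by auto
        then obtain C1 where C1: "apex_stack (Y1 \<union> {z, v}) (side E z v Y1) c v C1" using IHs[OF sp'] by blast
        obtain C2 where C2: "apex_stack (Y2 \<union> {z, v}) (side E z v Y2) z v C2"
          using IHs[OF sep_swap_sides[OF sp'] side_edge] by blast
        show ?thesis by (rule apex_separator_stack[OF sp' pl c C1 C2])
      qed
      have "c \<in> insert z W1 \<or> c \<in> insert z W2" using sp cvV unfolding sep_def by blast
      then show ?thesis using use[OF sp] use[OF sep_swap_sides[OF sp]] by blast
    qed
    have off_v: "\<exists>C. apex_stack V E c v C" if sp: "sep V E x y W1 W2" and v: "v \<in> W1" for W1 W2
    proof -
      have "{v, c} \<in> E" using cv by (simp add: insert_commute)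
      \<comment> \<open>As a neighbour of \<open>v\<close>, the first vertex \<open>c\<close> is on
        the side of \<open>v\<close> or in the pair.\<close>
      then have c: "c \<in> W1 \<union> {x, y}" using sep_neighbour[OF sep_swap_sides[OF sp] pl _ v] by blast
      then have "{c, v} \<in> side E x y W1" using cv v unfolding side_def by auto
      then obtain C1 where C1: "apex_stack (W1 \<union> {x, y}) (side E x y W1) c v C1" using IHs[OF sp] by blast
      obtain C2 where C2: "apex_stack (W2 \<union> {x, y}) (side E x y W2) x y C2"
        using IHs[OF sep_swap_sides[OF sp] side_edge] by blast
      have "{y, x} \<in> side E x y W2" using side_edge[of x y E W2] by (simp add: insert_commute)
      then obtain C3 where C3: "apex_stack (W2 \<union> {x, y}) (side E x y W2) y x C3"
        using IHs[OF sep_swap_sides[OF sp]] by blast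
      show ?thesis by (rule inner_separator_stack[OF sp pl two v c cvV(3) C1 C2 C3])
    qed
    consider "v = x" | "v = y" | "v \<in> U1" | "v \<in> U2" using cvV VU by blast
    then show ?thesis
    proof cases
      case 1
      then show ?thesis using on_v sep_swap_ends[OF sep] by blast
    next
      case 2
      then show ?thesis using on_v sep by blast
    next
      case 3
      then show ?thesis using off_v[OF sep] by blast
    next
      case 4
      then show ?thesis using off_v[OF sep_swap_sides[OF sep]] by blast
    qed
  qed
qed

lemma cut_side_connected:
  assumes con: "conn_avoiding V E {}" and V: "V = U1 \<union> U2 \<union> {x}" and dis: "U1 \<inter> U2 = {}" "x \<notin> U1 \<union> U2"
    and EV: "\<And>e. e \<in> E \<Longrightarrow> e \<subseteq> V" and noedge: "\<And>r s. r \<in> U1 \<Longrightarrow> s \<in> U2 \<Longrightarrow> {r, s} \<notin> E"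
  shows "conn_avoiding (insert x U1) {e \<in> E. e \<subseteq> insert x U1} {}"
  unfolding conn_avoiding_def
proof (intro ballI)
  let ?V1 = "insert x U1" and ?E1 = "{e \<in> E. e \<subseteq> insert x U1}"
  fix a b assume a: "a \<in> ?V1 - {}" and b: "b \<in> ?V1 - {}"
  have "(r \<in> ?V1 \<and> (a, r) \<in> (step ?E1 (- {}))\<^sup>*) \<or> (r \<in> U2 \<and> (a, x) \<in> (step ?E1 (- {}))\<^sup>*)"
    if "(a, r) \<in> (step E (- {}))\<^sup>*" for r
    using that
  proof (induction rule: rtrancl_induct)
    case (step r s)
    have e: "{r, s} \<in> E" using step(2) by (simp add: step_def)
    then have sV: "s \<in> V" using EV by blast
    show ?case
      using step.IH
    proof
      assume r: "r \<in> ?V1 \<and> (a, r) \<in> (step ?E1 (- {}))\<^sup>*"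
      show ?thesis
      proof (cases "s \<in> U2")
        case True
        then have "r = x" using r noedge[of r s] e by blast
        then show ?thesis using True r by blast
      next
        case False
        then have "s \<in> ?V1" using sV V by blast
        then have "(r, s) \<in> step ?E1 (- {})" using r e by (simp add: step_def)
        from rtrancl_into_rtrancl[OF r[THEN conjunct2] this] have "(a, s) \<in> (step ?E1 (- {}))\<^sup>*" .
        then show ?thesis using \<open>s \<in> ?V1\<close> by blast
      qed
    next
      assume r: "r \<in> U2 \<and> (a, x) \<in> (step ?E1 (- {}))\<^sup>*"
      have "s \<notin> U1" using noedge[of s r] r e by (auto simp: insert_commute)
      then show ?thesis using r sV V by blast
    qed
  qed (use a in blast)
  moreover have "(a, b) \<in> (step E (- {}))\<^sup>*" using con a b V unfolding conn_avoiding_def by blast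
  moreover have "b \<notin> U2" using b dis by blast
  ultimately show "(a, b) \<in> (step ?E1 (- {}))\<^sup>*" by blast
qed

text \<open>The stacking of the first side is replayed. Right after \<open>x\<close> is placed, the
  second side is stacked beside it and at once forgotten except for \<open>x\<close>, since no later
  vertex has a neighbour in \<open>U2\<close>.\<close>

lemma cut_stack:
  assumes V: "V = U1 \<union> U2 \<union> {x}" and dis: "U1 \<inter> U2 = {}" "x \<notin> U1 \<union> U2" and r: "r \<in> insert x U1"
    and noedge: "\<And>r s. r \<in> U1 \<Longrightarrow> s \<in> U2 \<Longrightarrow> {r, s} \<notin> E"
    and st1: "stacks {e \<in> E. e \<subseteq> insert x U1} {r} [r] (insert x U1) (r # C1)"
    and st2: "stacks {e \<in> E. e \<subseteq> insert x U2} {x} [x] (insert x U2) (x # C2)"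
  shows "stacks E {r} [r] V (r # C1)"
proof -
  let ?E1 = "{e \<in> E. e \<subseteq> insert x U1}" and ?E2 = "{e \<in> E. e \<subseteq> insert x U2}"
  have ins: "stacks E S (A @ [x] @ D) (S \<union> U2) (A @ [x] @ D)" if S: "x \<in> S" "S \<subseteq> insert x U1" for S A D
  proof -
    have "stacks E ({x} \<union> (S - {x})) (A @ [x] @ D) (insert x U2 \<union> (S - {x})) (A @ (x # C2) @ D)"
    proof (rule stacks_frame[OF st2])
      show "(S - {x}) \<inter> insert x U2 = {}" using S dis by blast
      fix q t assume q: "q \<in> insert x U2 - {x}" and t: "t \<in> insert x U2 \<union> (S - {x})"
      show "{q, t} \<in> E \<longleftrightarrow> {q, t} \<in> ?E2 \<and> t \<in> insert x U2"
      proof (cases "t \<in> insert x U2")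
        case False
        then have "t \<in> U1" using t S by blast
        then show ?thesis using False q noedge[of t q] by (auto simp: insert_commute)
      qed (use q in auto)
    qed
    moreover have "{x} \<union> (S - {x}) = S" "insert x U2 \<union> (S - {x}) = S \<union> U2" using S by auto
    ultimately have "stacks E S (A @ [x] @ D) (S \<union> U2) ((A @ [x]) @ C2 @ D)" by simp
    from stacks_drop[OF this] show ?thesis by simp
  qed
  define W where "W S = (if x \<in> S then U2 else {})" for S
  have "stacks E {r} [r] (S \<union> W S) C" if "stacks ?E1 {r} [r] S C" "S \<subseteq> insert x U1" for S C
    using that
  proof induction
    case stacks_refl
    show ?case
    proof (cases "r = x")
      case True
      then show ?thesis using ins[of "{x}" "[]" "[]"] by (simp add: W_def)
    next
      case False
      then show ?thesis using stacks.stacks_refl[of E "{r}" "[r]"] by (simp add: W_def)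
    qed
  next
    case (stacks_drop S A B D)
    then show ?case using stacks.stacks_drop by blast
  next
    case (stacks_add S A B D z)
    have IHs: "stacks E {r} [r] (S \<union> W S) (A @ B @ D)" using stacks_add by blast
    have zS: "z \<in> insert x U1" "S \<subseteq> insert x U1" using stacks_add.prems by auto
    have nn: "nbrs E (S \<union> W S) z = nbrs ?E1 S z"
    proof -
      have "w \<notin> U2" if "w \<in> S" for w using that zS dis by blast
      moreover have "{z, w} \<notin> E" if "w \<in> W S" for w
      proof -
        have "x \<in> S" "w \<in> U2" using that by (auto simp: W_def split: if_splits)
        then have "z \<in> U1" using stacks_add.hyps zS by blast
        then show ?thesis using noedge \<open>w \<in> U2\<close> by blast
      qed
      ultimately show ?thesis using zS unfolding nbrs_def by auto
    qed
    have zW: "z \<notin> S \<union> W S" using stacks_add.hyps zS dis by (auto simp: W_def)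
    have "stacks E {r} [r] (insert z (S \<union> W S)) (A @ z # D)"
      by (rule stacks.stacks_add[OF IHs]) (use stacks_add nn zW in auto)
    then have add: "stacks E {r} [r] (insert z S \<union> W S) (A @ z # D)" by simp
    show ?case
    proof (cases "z = x")
      case True
      then have W0: "W S = {}" "W (insert z S) = U2" using stacks_add.hyps by (auto simp: W_def)
      have "stacks E (insert z S) (A @ [z] @ D) (insert z S \<union> U2) (A @ [z] @ D)"
        using ins[of "insert z S" A D] zS True by auto
      moreover have "stacks E {r} [r] (insert z S) (A @ [z] @ D)" using add W0 by simp
      ultimately have "stacks E {r} [r] (insert z S \<union> U2) (A @ [z] @ D)" by (rule stacks_trans)
      then show ?thesis using W0 by simp
    next
      case False
      then have "W (insert z S) = W S" by (simp add: W_def)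
      then show ?thesis using add by simp
    qed
  qed
  from this[OF st1 subset_refl] have "stacks E {r} [r] (insert x U1 \<union> U2) (r # C1)" by (simp add: W_def)
  moreover have "insert x U1 \<union> U2 = V" using V by blast
  ultimately show ?thesis by simp
qed

text \<open>Keeping \<open>r\<close> on the contour matters when \<open>r\<close> is a cut vertex:
  it must still be visible after its block has been inserted.\<close>

theorem connected_stack:
  assumes "graph_plane V E" "conn_avoiding V E {}" "r \<in> V"
  shows "\<exists>C. stacks E {r} [r] V (r # C)"
  using assms
proof (induction "card V" arbitrary: V E r rule: less_induct)
  case less
  note pl = less.prems(1) and con = less.prems(2) and rV = less.prems(3)
  have fin: "finite V" using pl by (rule graph_plane_finite)
  have EV: "e \<subseteq> V" if "e \<in> E" for e by (rule graph_plane_edge[OF pl that]) auto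
  show ?case
  proof (cases "V = {r}")
    case True
    then show ?thesis using stacks_refl[of E "{r}" "[r]"] by blast
  next
    case False
    then obtain s where s: "s \<in> V" "s \<noteq> r" using rV by blast
    show ?thesis
    proof (cases "two_conn V E")
      case True
      have "(r, s) \<in> (step E (- {}))\<^sup>*" using con rV s unfolding conn_avoiding_def by blast
      then obtain v where v: "{r, v} \<in> E" using neighbour_exists[of r s] s by blast
      have vr: "v \<in> V" "v \<noteq> r" by (rule graph_plane_edge[OF pl v], auto simp: doubleton_eq_iff)+
      have vv: "{v, v} \<notin> E" using graph_plane_edge[OF pl, of "{v, v}"] by (auto simp: doubleton_eq_iff)
      obtain C where C: "stacks E {r} [r] (V - {v}) (r # C)" "nbrs E V v \<subseteq> set (r # C)"
        using two_conn_stack[OF pl True v] unfolding apex_stack_def by blast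
      \<comment> \<open>The apex \<open>v\<close> hides everything but \<open>r\<close>, and its
        neighbours are in the hidden stretch or equal to \<open>r\<close>.\<close>
      have "stacks E {r} [r] (insert v (V - {v})) ([r] @ v # [])"
      proof (rule stacks_add[where B = C])
        show "stacks E {r} [r] (V - {v}) ([r] @ C @ [])" using C(1) by simp
        have "r \<in> nbrs E (V - {v}) v" using v vr rV by (simp add: nbrs_def insert_commute)
        then show "nbrs E (V - {v}) v \<noteq> {}" by blast
        have "nbrs E (V - {v}) v \<subseteq> nbrs E V v" by (auto simp: nbrs_def)
        then show "nbrs E (V - {v}) v \<subseteq> set (take 1 (rev [r])) \<union> set C \<union> set (take 1 [])" using C(2) by auto
      qed simp
      moreover have "insert v (V - {v}) = V" using vr by blast
      ultimately show ?thesis by (intro exI[of _ "[v]"]) simp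
    next
      case False
      then obtain x a b where x: "x \<in> V" and ab: "a \<in> V - {x}" "b \<in> V - {x}" "(a, b) \<notin> (step E (- {x}))\<^sup>*"
        unfolding two_conn_def conn_avoiding_def by blast
      define A where "A = {q. (a, q) \<in> (step E (- {x}))\<^sup>*}"
      have AV: "A \<subseteq> V - {x}"
      proof
        fix q assume "q \<in> A"
        then have "(a, q) \<in> (step E (- {x}))\<^sup>*" by (simp add: A_def)
        then show "q \<in> V - {x}"
        proof (induction rule: rtrancl_induct)
          case (step t q)
          then have "{t, q} \<in> E" "q \<noteq> x" by (auto simp: step_def)
          then show ?case using EV by blast
        qed (use ab in simp)
      qed
      have noedge: "{q, t} \<notin> E" if "q \<in> A" "t \<in> V - {x} - A" for q t
      proof
        assume "{q, t} \<in> E"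
        then have "(q, t) \<in> step E (- {x})" using that AV by (auto simp: step_def)
        then have "t \<in> A" using that(1) unfolding A_def by (auto intro: rtrancl_into_rtrancl)
        then show False using that by blast
      qed
      have aA: "a \<in> A" and bA: "b \<in> V - {x} - A" using ab by (auto simp: A_def)
      have cut: "\<exists>C. stacks E {r} [r] V (r # C)"
        if V: "V = U1 \<union> U2 \<union> {x}" and d: "U1 \<inter> U2 = {}" "x \<notin> U1 \<union> U2" and ne: "U1 \<noteq> {}" "U2 \<noteq> {}"
          and n: "\<And>q t. q \<in> U1 \<Longrightarrow> t \<in> U2 \<Longrightarrow> {q, t} \<notin> E" and r: "r \<in> insert x U1" for U1 U2
      proof -
        have n': "{q, t} \<notin> E" if "q \<in> U2" "t \<in> U1" for q t using n[OF that(2,1)] by (simp add: insert_commute)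
        have V': "V = U2 \<union> U1 \<union> {x}" "U2 \<inter> U1 = {}" "x \<notin> U2 \<union> U1" using V d by blast+
        have pls: "graph_plane (insert x U) {e \<in> E. e \<subseteq> insert x U}" if "insert x U \<subseteq> V" for U
        proof -
          obtain p \<gamma> where "plane V E p \<gamma>" using pl unfolding graph_plane_def by blast
          then have "plane (insert x U) {e \<in> E. e \<subseteq> insert x U} p \<gamma>"
            by (rule plane_subgraph) (use that in auto)
          then show ?thesis unfolding graph_plane_def by blast
        qed
        have sub: "insert x U1 \<subseteq> V" "insert x U2 \<subseteq> V" using V by auto
        have "insert x U1 \<noteq> V" "insert x U2 \<noteq> V" using V d ne by auto
        then have c: "card (insert x U1) < card V" "card (insert x U2) < card V"
          using sub by (auto intro!: psubset_card_mono[OF fin])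
        obtain C1 where C1: "stacks {e \<in> E. e \<subseteq> insert x U1} {r} [r] (insert x U1) (r # C1)"
          using less.hyps[OF c(1) pls[OF sub(1)] cut_side_connected[OF con V d EV n] r] by blast
        obtain C2 where C2: "stacks {e \<in> E. e \<subseteq> insert x U2} {x} [x] (insert x U2) (x # C2)"
          using less.hyps[OF c(2) pls[OF sub(2)] cut_side_connected[OF con V' EV n'] insertI1] by blast
        from cut_stack[OF V d r n C1 C2] show ?thesis by blast
      qed
      show ?thesis
      proof (cases "r \<in> insert x A")
        case True
        show ?thesis by (rule cut[of A "V - {x} - A"]) (use True AV x aA bA noedge in blast)+
      next
        case False
        have noedge': "{q, t} \<notin> E" if "q \<in> V - {x} - A" "t \<in> A" for q t
          using noedge[OF that(2,1)] by (simp add: insert_commute)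
        show ?thesis by (rule cut[of "V - {x} - A" A]) (use False rV AV x aA bA noedge' in blast)+
      qed
    qed
  qed
qed

lemma walk_reachable:
  assumes "walk V E xs" "i < length xs"
  shows "(xs ! 0, xs ! i) \<in> (step E (- {}))\<^sup>*"
  using assms(2)
proof (induction i)
  case (Suc i)
  then have "{xs ! i, xs ! Suc i} \<in> E" using assms(1) by (simp add: walk_def)
  then have "(xs ! i, xs ! Suc i) \<in> step E (- {})" by (simp add: step_def)
  then show ?case using Suc by (auto intro: rtrancl_into_rtrancl)
qed simp

lemma connected_graph_conn:
  assumes "connected_graph V E"
  shows "conn_avoiding V E {}"
  unfolding conn_avoiding_def
proof (intro ballI)
  fix a b assume "a \<in> V - {}" "b \<in> V - {}"
  then obtain xs where xs: "walk V E xs" "hd xs = a" "last xs = b"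
    using assms unfolding connected_graph_def by blast
  then have "xs \<noteq> []" by (simp add: walk_def)
  then show "(a, b) \<in> (step E (- {}))\<^sup>*"
    using walk_reachable[OF xs(1), of "length xs - 1"] xs(2,3) by (simp add: hd_conv_nth last_conv_nth)
qed

text \<open>A planar drawing does not by definition keep a vertex off the interior of an edge. In a
  connected graph such a vertex would have an edge of its own, and the two edges would meet there
  without having that vertex as a common end.\<close>

lemma planar_graph_plane:
  assumes sg: "simple_graph V E" and con: "connected_graph V E" and pg: "planar_graph V E"
  shows "graph_plane V E"
proof -
  obtain p \<gamma> where pd: "planar_drawing V E p \<gamma>" using pg unfolding planar_graph_def by (elim exE)
  have dr: "drawing V E p \<gamma>" and cross: "\<forall>e\<in>E. \<forall>f\<in>E. e \<noteq> f \<longrightarrow> path_image (\<gamma> e) \<inter> path_image (\<gamma> f) \<subseteq> p ` (e \<inter> f)"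
    using pd by (simp_all add: planar_drawing_def)
  have inj: "inj_on p V" using dr by (simp add: drawing_def)
  have sgE: "\<exists>u v. u \<in> V \<and> v \<in> V \<and> u \<noteq> v \<and> e = {u, v}" if "e \<in> E" for e
    using sg that by (simp add: simple_graph_def)
  have edge: "\<exists>u w. u \<in> V \<and> w \<in> V \<and> u \<noteq> w \<and> e = {u, w} \<and> arc (\<gamma> e) \<and> pathstart (\<gamma> e) = p u \<and> pathfinish (\<gamma> e) = p w"
    if e: "e \<in> E" for e
  proof -
    obtain u w where uw: "e = {u, w}" "pathstart (\<gamma> e) = p u" "pathfinish (\<gamma> e) = p w" and a: "arc (\<gamma> e)"
      using dr e unfolding drawing_def by blast
    obtain u' w' where "u' \<in> V" "w' \<in> V" "u' \<noteq> w'" "e = {u', w'}" using sgE[OF e] by (elim exE conjE)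
    then have "u \<in> V" "w \<in> V" "u \<noteq> w" using uw(1) by (auto simp: doubleton_eq_iff)
    then show ?thesis using uw a by (intro exI[of _ u] exI[of _ w] conjI)
  qed
  have end_on: "p x \<in> path_image (\<gamma> e)" if ex: "e \<in> E" "x \<in> e" for e x
  proof -
    obtain u w where uw: "e = {u, w}" "pathstart (\<gamma> e) = p u" "pathfinish (\<gamma> e) = p w"
      using edge[OF ex(1)] by (elim exE conjE)
    then have "x = u \<or> x = w" using ex(2) by simp
    then show ?thesis using uw(2,3) pathstart_in_path_image[of "\<gamma> e"] pathfinish_in_path_image[of "\<gamma> e"] by auto
  qed
  have von: "w \<in> e" if e: "e \<in> E" and w: "w \<in> V" "p w \<in> path_image (\<gamma> e)" for e w
  proof (rule ccontr)
    assume nw: "w \<notin> e"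
    obtain u u' where uu: "u \<in> V" "u' \<in> V" "u \<noteq> u'" "e = {u, u'}" using sgE[OF e] by (elim exE conjE)
    then have u: "u \<in> V" "u \<in> e" and eV: "e \<subseteq> V" by auto
    then have "w \<noteq> u" using nw by blast
    moreover have "(w, u) \<in> (step E (- {}))\<^sup>*"
      using connected_graph_conn[OF con, unfolded conn_avoiding_def, rule_format, of w u] w(1) u(1) by simp
    ultimately obtain z where z: "{w, z} \<in> E" using neighbour_exists[of w u] by blast
    have ne: "e \<noteq> {w, z}" using nw by auto
    have "p w \<in> path_image (\<gamma> {w, z})" using end_on[OF z] by simp
    then have "p w \<in> p ` (e \<inter> {w, z})" using subsetD[OF cross[rule_format, OF e z ne]] w(2) by simp
    then obtain q where q: "q \<in> e" "p w = p q" by auto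
    have "q \<in> V" using q(1) eV by blast
    then have "w = q" using inj w(1) q(2) by (simp add: inj_on_eq_iff)
    then show False using nw q(1) by simp
  qed
  have finV: "finite V" using sg by (simp add: simple_graph_def)
  have "plane V E p \<gamma>"
    unfolding plane_def
  proof (intro conjI)
    show "\<forall>e\<in>E. \<exists>u w. u \<in> V \<and> w \<in> V \<and> u \<noteq> w \<and> e = {u, w} \<and> arc (\<gamma> e) \<and> pathstart (\<gamma> e) = p u \<and> pathfinish (\<gamma> e) = p w"
      by (rule ballI) (rule edge)
    show "\<forall>e\<in>E. \<forall>w\<in>V. p w \<in> path_image (\<gamma> e) \<longrightarrow> w \<in> e"
      by (intro ballI impI) (rule von)
  qed (rule finV inj cross)+
  then show ?thesis unfolding graph_plane_def by blast
qed

theorem theorem4: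
  fixes V :: "'a set" and E :: "'a set set" and \<epsilon> :: real
  assumes "\<epsilon> > 0"
    and "simple_graph V E"
    and "connected_graph V E"
    and "planar_graph V E"
  shows "\<exists>p \<gamma>. planar_drawing V E p \<gamma> \<and> straight_line_drawing V E p \<gamma> \<and>
           (card V \<ge> 2 \<longrightarrow> spanning_ratio V E p < 1 + \<epsilon>)"
proof (cases "V = {}")
  \<comment> \<open>A stacking starts with a vertex, so the empty graph is treated
    separately.\<close>
  case True
  then have "E = {}" using assms(2) by (auto simp: simple_graph_def)
  then show ?thesis
    using True by (simp add: planar_drawing_def straight_line_drawing_def drawing_def)
next
  case False
  then obtain r where r: "r \<in> V" by blast
  obtain C where "stacks E {r} [r] V (r # C)"
    using connected_stack[OF planar_graph_plane[OF assms(2-4)] connected_graph_conn[OF assms(3)] r] by blast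
  then show ?thesis using assms(1,2) by (rule stacks_imp_drawing)
qed

end
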